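(* Let $G$ be a (real or complex linear algebraic) semi-simple group acting on its Lie algebra $\mathfrak g$ by the adjoint representation. Then every $G$-orbit in the null-cone of $\mathfrak g$ is distinguished.
   Context: The null-cone of a representation $V$ of $G$ is the set of $v\in V$ with $0\in\overline{G\cdot v}$; for the adjoint representation $V=\mathfrak g$ it is the set of nilpotent elements. Setting for moment maps. Let $\mathbb K$ be $\mathbb R$ or $\mathbb C$, the ground field of $G$. A Cartan involution $\theta$ of $G$ is fixed, $K=G^\theta$ is the corresponding maximal compact subgroup, and $\mathfrak g=\mathfrak k\oplus\mathfrak p$ is the decomposition into $+1$ and $-1$ eigenspaces of $\theta$ ($\mathfrak p=i\mathfrak k$ when $\mathbb K=\mathbb C$). A representation space $V$ (here $V=\mathfrak g$ with the adjoint action) carries a real inner product $\langle\cdot,\cdot\rangle$ that is $G$-compatible: $K$-invariant, with elements of $\mathfrak p$ acting by symmetric operators, and (if $\mathbb K=\mathbb C$) $i$-invariant. The Lie algebra $\mathfrak g$ carries a real inner product $\langle\langle\cdot,\cdot\rangle\rangle$ that is $\mathrm{Ad}(K)$-invariant, $\theta$-invariant and (if $\mathbb K=\mathbb C$) $i$-invariant. The moment map $m:V\to\mathfrak p\subset\mathfrak g$ is defined by $\langle\langle m(v),X\rangle\rangle=2\langle X\cdot v,v\rangle$ for all $X\in\mathfrak g$, and $m[v]=m(v)/|v|^2$ on $\mathbb PV$. Distinguished. A point $v\in V$ is distinguished if $[v]\in\mathbb PV$ is a critical point of $\|m\|^2:\mathbb PV\to\mathbb R$ (equivalently $m(v)\cdot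 v=cv$ for some scalar $c$; with this form of the condition $v=0$ counts as distinguished). An orbit $G\cdot v$ is distinguished if it contains a distinguished point. *)

theory Defs
  imports "HOL-Analysis.Analysis"
begin

text \<open>
  The ground field is a type of class \<open>real_normed_field\<close>; it is only ever meant to be
  \<open>real\<close> or \<open>complex\<close>. Groups and Lie algebras are sets of square matrices over it.
\<close>

inductive_set matrix_polys :: "(('k::comm_ring_1)^'n^'n \<Rightarrow> 'k) set" where
  const: "(\<lambda>A. c) \<in> matrix_polys"
| entry: "(\<lambda>A. A $ i $ j) \<in> matrix_polys"
| add: "p \<in> matrix_polys \<Longrightarrow> q \<in> matrix_polys \<Longrightarrow> (\<lambda>A. p A + q A) \<in> matrix_polys"
| mult: "p \<in> matrix_polys \<Longrightarrow> q \<in> matrix_polys \<Longrightarrow> (\<lambda>A. p A * q A) \<in> matrix_polys"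

definition matrix_group :: "(('k::field)^'n^'n) set \<Rightarrow> bool" where
  "matrix_group G \<longleftrightarrow> (\<forall>A\<in>G. invertible A) \<and> mat 1 \<in> G \<and>
     (\<forall>A\<in>G. \<forall>B\<in>G. A ** B \<in> G) \<and> (\<forall>A\<in>G. matrix_inv A \<in> G)"

definition linear_algebraic_group :: "(('k::field)^'n^'n) set \<Rightarrow> bool" where
  "linear_algebraic_group G \<longleftrightarrow> matrix_group G \<and>
     (\<exists>P \<subseteq> matrix_polys. G = {A. invertible A \<and> (\<forall>p\<in>P. p A = 0)})"

text \<open>The powers are spelled out because \<open>A ^ k\<close> on the vector type is entrywise.\<close>

definition mexp :: "('k::real_normed_field)^'n^'n \<Rightarrow> 'k^'n^'n" where
  "mexp A = (\<Sum>k. (((**) A ^^ k) (mat 1)) /\<^sub>R fact k)"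

definition lie_algebra :: "(('k::real_normed_field)^'n^'n) set \<Rightarrow> ('k^'n^'n) set" where
  "lie_algebra G = {X. \<forall>t::real. mexp (t *\<^sub>R X) \<in> G}"

definition bracket :: "('k::comm_ring_1)^'n^'n \<Rightarrow> 'k^'n^'n \<Rightarrow> 'k^'n^'n" where
  "bracket X Y = X ** Y - Y ** X"

definition Ad :: "('k::field)^'n^'n \<Rightarrow> 'k^'n^'n \<Rightarrow> 'k^'n^'n" where
  "Ad A X = A ** X ** matrix_inv A"

text \<open>Multiplication of a matrix by a scalar \<open>c\<close> of the ground field is \<open>mat c ** X\<close>.\<close>

definition lie_ideal :: "(('k::real_normed_field)^'n^'n) set \<Rightarrow> ('k^'n^'n) set \<Rightarrow> bool" where
  "lie_ideal I L \<longleftrightarrow> I \<subseteq> L \<and> subspace I \<and> (\<forall>c. \<forall>X\<in>I. mat c ** X \<in> I) \<and>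
     (\<forall>X\<in>L. \<forall>Y\<in>I. bracket X Y \<in> I)"

definition derived_algebra :: "(('k::real_normed_field)^'n^'n) set \<Rightarrow> ('k^'n^'n) set" where
  "derived_algebra L = span {bracket X Y | X Y. X \<in> L \<and> Y \<in> L}"

definition solvable_lie :: "(('k::real_normed_field)^'n^'n) set \<Rightarrow> bool" where
  "solvable_lie L \<longleftrightarrow> (\<exists>r. (derived_algebra ^^ r) L = {0})"

definition semisimple_group :: "(('k::real_normed_field)^'n^'n) set \<Rightarrow> bool" where
  "semisimple_group G \<longleftrightarrow>
     (\<forall>I. lie_ideal I (lie_algebra G) \<and> solvable_lie I \<longrightarrow> I = {0})"

text \<open>The trace does not depend on the chosen basis.\<close>

definition trace_on :: "('a::real_vector) set \<Rightarrow> ('a \<Rightarrow> 'a) \<Rightarrow> real" where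
  "trace_on S f = (let B = (SOME B. independent B \<and> span B = S)
                   in \<Sum>b\<in>B. representation B (f b) b)"

text \<open>
  For a complex group this is the Killing form of the underlying real Lie algebra, i.e. twice
  the real part of the complex Killing form.
\<close>

definition killing_form ::
  "(('k::real_normed_field)^'n^'n) set \<Rightarrow> 'k^'n^'n \<Rightarrow> 'k^'n^'n \<Rightarrow> real" where
  "killing_form L X Y = trace_on L (\<lambda>Z. bracket X (bracket Y Z))"

definition differential ::
  "(('k::real_normed_field)^'n^'n \<Rightarrow> 'k^'n^'n) \<Rightarrow> 'k^'n^'n \<Rightarrow> 'k^'n^'n" where
  "differential \<theta> X = vector_derivative (\<lambda>t. \<theta> (mexp (t *\<^sub>R X))) (at 0)"

definition fixed_group :: "'a set \<Rightarrow> ('a \<Rightarrow> 'a) \<Rightarrow> 'a set" where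
  "fixed_group G \<theta> = {A \<in> G. \<theta> A = A}"

definition k_part ::
  "(('k::real_normed_field)^'n^'n) set \<Rightarrow> ('k^'n^'n \<Rightarrow> 'k^'n^'n) \<Rightarrow> ('k^'n^'n) set" where
  "k_part G \<theta> = {X \<in> lie_algebra G. differential \<theta> X = X}"

definition p_part ::
  "(('k::real_normed_field)^'n^'n) set \<Rightarrow> ('k^'n^'n \<Rightarrow> 'k^'n^'n) \<Rightarrow> ('k^'n^'n) set" where
  "p_part G \<theta> = {X \<in> lie_algebra G. differential \<theta> X = - X}"

definition maximal_compact_subgroup ::
  "(('k::real_normed_field)^'n^'n) set \<Rightarrow> ('k^'n^'n) set \<Rightarrow> bool" where
  "maximal_compact_subgroup K G \<longleftrightarrow> K \<subseteq> G \<and> matrix_group K \<and> compact K \<and>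
     (\<forall>L. K \<subseteq> L \<and> L \<subseteq> G \<and> matrix_group L \<and> compact L \<longrightarrow> L = K)"

text \<open>
  An involutive automorphism of the (possibly disconnected) Lie group \<open>G\<close> whose differential is
  a Cartan involution of the semisimple Lie algebra and whose fixed points form a maximal compact
  subgroup. The last clause, with \<open>j\<close> a square root of \<open>-1\<close>, is \<open>\<pp> = i\<kk>\<close> over the complex
  numbers and is void over the reals.
\<close>

definition cartan_involution ::
  "(('k::real_normed_field)^'n^'n) set \<Rightarrow> ('k^'n^'n \<Rightarrow> 'k^'n^'n) \<Rightarrow> bool" where
  "cartan_involution G \<theta> \<longleftrightarrow>
     (\<forall>A\<in>G. \<theta> A \<in> G \<and> \<theta> (\<theta> A) = A) \<and>
     (\<forall>A\<in>G. \<forall>B\<in>G. \<theta> (A ** B) = \<theta> A ** \<theta> B) \<and>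
     continuous_on G \<theta> \<and>
     (\<forall>X\<in>lie_algebra G. X \<noteq> 0 \<longrightarrow> killing_form (lie_algebra G) X (differential \<theta> X) < 0) \<and>
     maximal_compact_subgroup (fixed_group G \<theta>) G \<and>
     (\<forall>j. j * j = -1 \<longrightarrow> p_part G \<theta> = (\<lambda>X. mat j ** X) ` k_part G \<theta>)"

definition inner_product_on :: "('a::real_vector) set \<Rightarrow> ('a \<Rightarrow> 'a \<Rightarrow> real) \<Rightarrow> bool" where
  "inner_product_on S ip \<longleftrightarrow>
     (\<forall>x\<in>S. \<forall>y\<in>S. ip x y = ip y x) \<and>
     (\<forall>x\<in>S. \<forall>y\<in>S. \<forall>z\<in>S. ip (x + y) z = ip x z + ip y z) \<and>
     (\<forall>a. \<forall>x\<in>S. \<forall>y\<in>S. ip (a *\<^sub>R x) y = a * ip x y) \<and>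
     (\<forall>x\<in>S. x \<noteq> 0 \<longrightarrow> ip x x > 0)"

text \<open>Invariance under multiplication by the imaginary unit; void over the reals.\<close>

definition i_invariant_on ::
  "(('k::real_normed_field)^'n^'n) set \<Rightarrow> ('k^'n^'n \<Rightarrow> 'k^'n^'n \<Rightarrow> real) \<Rightarrow> bool" where
  "i_invariant_on S ip \<longleftrightarrow>
     (\<forall>j. j * j = -1 \<longrightarrow> (\<forall>X\<in>S. \<forall>Y\<in>S. ip (mat j ** X) (mat j ** Y) = ip X Y))"

definition Ad_invariant_on ::
  "(('k::real_normed_field)^'n^'n) set \<Rightarrow> ('k^'n^'n) set \<Rightarrow>
     ('k^'n^'n \<Rightarrow> 'k^'n^'n \<Rightarrow> real) \<Rightarrow> bool" where
  "Ad_invariant_on K S ip \<longleftrightarrow> (\<forall>A\<in>K. \<forall>X\<in>S. \<forall>Y\<in>S. ip (Ad A X) (Ad A Y) = ip X Y)"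

text \<open>The inner product on the representation space, here the Lie algebra itself.\<close>

definition compatible_inner_product ::
  "(('k::real_normed_field)^'n^'n) set \<Rightarrow> ('k^'n^'n \<Rightarrow> 'k^'n^'n) \<Rightarrow>
     ('k^'n^'n \<Rightarrow> 'k^'n^'n \<Rightarrow> real) \<Rightarrow> bool" where
  "compatible_inner_product G \<theta> ipV \<longleftrightarrow>
     inner_product_on (lie_algebra G) ipV \<and>
     Ad_invariant_on (fixed_group G \<theta>) (lie_algebra G) ipV \<and>
     (\<forall>P\<in>p_part G \<theta>. \<forall>X\<in>lie_algebra G. \<forall>Y\<in>lie_algebra G.
        ipV (bracket P X) Y = ipV X (bracket P Y)) \<and>
     i_invariant_on (lie_algebra G) ipV"

text \<open>The inner product on the Lie algebra as the target of the moment map.\<close>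

definition lie_inner_product ::
  "(('k::real_normed_field)^'n^'n) set \<Rightarrow> ('k^'n^'n \<Rightarrow> 'k^'n^'n) \<Rightarrow>
     ('k^'n^'n \<Rightarrow> 'k^'n^'n \<Rightarrow> real) \<Rightarrow> bool" where
  "lie_inner_product G \<theta> ipg \<longleftrightarrow>
     inner_product_on (lie_algebra G) ipg \<and>
     Ad_invariant_on (fixed_group G \<theta>) (lie_algebra G) ipg \<and>
     (\<forall>X\<in>lie_algebra G. \<forall>Y\<in>lie_algebra G.
        ipg (differential \<theta> X) (differential \<theta> Y) = ipg X Y) \<and>
     i_invariant_on (lie_algebra G) ipg"

definition moment_map ::
  "(('k::real_normed_field)^'n^'n) set \<Rightarrow> ('k^'n^'n \<Rightarrow> 'k^'n^'n) \<Rightarrow>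
     ('k^'n^'n \<Rightarrow> 'k^'n^'n \<Rightarrow> real) \<Rightarrow> ('k^'n^'n \<Rightarrow> 'k^'n^'n \<Rightarrow> real) \<Rightarrow>
     'k^'n^'n \<Rightarrow> 'k^'n^'n" where
  "moment_map G \<theta> ipV ipg v =
     (THE M. M \<in> p_part G \<theta> \<and> (\<forall>X\<in>lie_algebra G. ipg M X = 2 * ipV (bracket X v) v))"

text \<open>
  The function \<open>[v] \<mapsto> \<parallel>m[v]\<parallel>\<^sup>2\<close> on projective space, pulled back to the nonzero vectors.
\<close>

definition moment_norm_sq ::
  "(('k::real_normed_field)^'n^'n) set \<Rightarrow> ('k^'n^'n \<Rightarrow> 'k^'n^'n) \<Rightarrow>
     ('k^'n^'n \<Rightarrow> 'k^'n^'n \<Rightarrow> real) \<Rightarrow> ('k^'n^'n \<Rightarrow> 'k^'n^'n \<Rightarrow> real) \<Rightarrow>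
     'k^'n^'n \<Rightarrow> real" where
  "moment_norm_sq G \<theta> ipV ipg v =
     (let M = moment_map G \<theta> ipV ipg v /\<^sub>R ipV v v in ipg M M)"

text \<open>
  As the projection from the nonzero vectors to projective space is a submersion, \<open>[v]\<close> is a
  critical point iff the pulled back function has derivative zero at \<open>v\<close>, along the Lie algebra.
  By convention \<open>0\<close> is distinguished.
\<close>

definition distinguished ::
  "(('k::real_normed_field)^'n^'n) set \<Rightarrow> ('k^'n^'n \<Rightarrow> 'k^'n^'n) \<Rightarrow>
     ('k^'n^'n \<Rightarrow> 'k^'n^'n \<Rightarrow> real) \<Rightarrow> ('k^'n^'n \<Rightarrow> 'k^'n^'n \<Rightarrow> real) \<Rightarrow>
     'k^'n^'n \<Rightarrow> bool" where
  "distinguished G \<theta> ipV ipg v \<longleftrightarrow> v \<in> lie_algebra G \<and>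
     (v = 0 \<or> (moment_norm_sq G \<theta> ipV ipg has_derivative (\<lambda>_. 0)) (at v within lie_algebra G))"

definition adjoint_orbit :: "(('k::field)^'n^'n) set \<Rightarrow> 'k^'n^'n \<Rightarrow> ('k^'n^'n) set" where
  "adjoint_orbit G X = (\<lambda>A. Ad A X) ` G"

definition null_cone :: "(('k::real_normed_field)^'n^'n) set \<Rightarrow> ('k^'n^'n) set" where
  "null_cone G = {X \<in> lie_algebra G. 0 \<in> closure (adjoint_orbit G X)}"

definition distinguished_orbit ::
  "(('k::real_normed_field)^'n^'n) set \<Rightarrow> ('k^'n^'n \<Rightarrow> 'k^'n^'n) \<Rightarrow>
     ('k^'n^'n \<Rightarrow> 'k^'n^'n \<Rightarrow> real) \<Rightarrow> ('k^'n^'n \<Rightarrow> 'k^'n^'n \<Rightarrow> real) \<Rightarrow>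
     ('k^'n^'n) set \<Rightarrow> bool" where
  "distinguished_orbit G \<theta> ipV ipg Orb \<longleftrightarrow> (\<exists>v\<in>Orb. distinguished G \<theta> ipV ipg v)"

end

theory Submission
  imports Defs
begin

text \<open>
  Let e be in the null cone. As e is conjugate to arbitrarily small elements, ad e is nilpotent, and e
  lies in a triple (h, e, f). Taking h modulo the nilradical of the parabolic subalgebra attached to h,
  one conjugates h into p. Next one minimises |v|^2 + |w|^2 over the closure of the pairs
  (Ad A e, star (Ad A f)), where star = - theta and A centralises h: at a minimum [v, star v] = h, and v
  lies in the orbit of e because this orbit is open in the 2-eigenspace of ad h. Finally p is
  the sum of the mutually commuting eigenspaces of the inner product of V relative to that of the Lie algebra;
  rescaling the components of v accordingly, by the exponential of an element of p, makes h proportional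
  to the moment map at v, and [h, v] = 2v says that v is critical.
\<close>

text \<open>Minimising |v|^2 alone would be useless: exp(t h) centralises h and scales e to 0. The
  second component w keeps the relation [v, star w] = h in force. This relation is closed, so a
  minimising sequence cannot degenerate. What is lost is only that the minimum may lie in the
  closure of the orbit instead of the orbit itself, and openness repairs this. The relation also
  explains why h must be in p beforehand: only for h fixed by star does star exchange the weights 2
  and -2 of ad h, so that v and w live in the same space. Three forms occur. Minus K(theta X, Y)
  produces the triple and moves h into p; the form on V measures the pairs; the form on the Lie
  algebra enters at the end. The last two may have a different ratio on different ideals, so after
  the minimisation h and the moment map need not yet be proportional. The eigenspaces of this ratio
  inside p take the place of a decomposition into simple ideals. Dimensions, traces and forms are
  all real; a complex group is read as a real one.\<close>

section \<open>Exponentials of endomorphisms\<close>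

text \<open>A wrapper type is needed because the bounded linear functions cannot be made an instance
  of the algebra classes, on which the library's exponential function lives.\<close>

typedef (overloaded) 'a endo = "UNIV :: ('a::euclidean_space \<Rightarrow>\<^sub>L 'a) set"
  morphisms blf Endo by simp

setup_lifting type_definition_endo

instantiation endo :: (euclidean_space) real_normed_vector
begin

lift_definition zero_endo :: "'a endo" is 0 .
lift_definition plus_endo :: "'a endo \<Rightarrow> 'a endo \<Rightarrow> 'a endo" is "(+)" .
lift_definition minus_endo :: "'a endo \<Rightarrow> 'a endo \<Rightarrow> 'a endo" is "(-)" .
lift_definition uminus_endo :: "'a endo \<Rightarrow> 'a endo" is uminus .
lift_definition scaleR_endo :: "real \<Rightarrow> 'a endo \<Rightarrow> 'a endo" is scaleR .
lift_definition norm_endo :: "'a endo \<Rightarrow> real" is norm .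
definition dist_endo :: "'a endo \<Rightarrow> 'a endo \<Rightarrow> real" where "dist_endo a b = norm (a - b)"
definition sgn_endo :: "'a endo \<Rightarrow> 'a endo" where "sgn_endo a = scaleR (inverse (norm a)) a"
definition uniformity_endo :: "('a endo \<times> 'a endo) filter" where
  "uniformity_endo = (INF e\<in>{0 <..}. principal {(x, y). dist x y < e})"
definition open_endo :: "'a endo set \<Rightarrow> bool" where
  "open_endo U = (\<forall>x\<in>U. eventually (\<lambda>(x', y). x' = x \<longrightarrow> y \<in> U) uniformity)"

instance
proof
  fix a b c :: "'a endo" and r s :: real
  show "a + b + c = a + (b + c)" "a + b = b + a" "0 + a = a" "- a + a = 0" "a - b = a + - b"
    "r *\<^sub>R (a + b) = r *\<^sub>R a + r *\<^sub>R b" "(r + s) *\<^sub>R a = r *\<^sub>R a + s *\<^sub>R a"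
    "r *\<^sub>R s *\<^sub>R a = (r * s) *\<^sub>R a" "1 *\<^sub>R a = a"
    by (transfer, simp add: algebra_simps)+
  show "norm (a + b) \<le> norm a + norm b" by transfer (rule norm_triangle_ineq)
  show "(norm a = 0) = (a = 0)" "norm (r *\<^sub>R a) = \<bar>r\<bar> * norm a" by (transfer, simp)+
qed (simp_all add: dist_endo_def sgn_endo_def uniformity_endo_def open_endo_def)

end

lemma blf_add: "blf (a + b) = blf a + blf b"
  and blf_diff: "blf (a - b) = blf a - blf b"
  and blf_scaleR: "blf (r *\<^sub>R a) = r *\<^sub>R blf a"
  and norm_blf: "norm (blf a) = norm a"
  by (transfer, simp)+

instance endo :: (euclidean_space) banach
proof
  fix X :: "nat \<Rightarrow> 'a endo"
  assume X: "Cauchy X"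
  have "Cauchy (\<lambda>n. blf (X n))"
    using X by (simp only: Cauchy_def dist_norm norm_blf flip: blf_diff)
  then obtain L where "(\<lambda>n. blf (X n)) \<longlonglongrightarrow> L"
    using convergent_eq_Cauchy by blast
  then have "(\<lambda>n. norm (blf (X n) - blf (Endo L))) \<longlonglongrightarrow> 0"
    by (simp add: Endo_inverse LIM_zero tendsto_norm_zero)
  then have "(\<lambda>n. norm (X n - Endo L)) \<longlonglongrightarrow> 0"
    by (simp only: norm_blf flip: blf_diff)
  then have "X \<longlonglongrightarrow> Endo L"
    using LIM_zero_cancel tendsto_norm_zero_iff by blast
  then show "convergent X" by (auto simp: convergent_def)
qed

instantiation endo :: (euclidean_space) real_normed_algebra_1
begin

lift_definition times_endo :: "'a endo \<Rightarrow> 'a endo \<Rightarrow> 'a endo" is blinfun_compose .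
lift_definition one_endo :: "'a endo" is id_blinfun .

instance
proof
  fix a b c :: "'a endo" and r :: real
  show "a * b * c = a * (b * c)" by transfer (rule blinfun_eqI, simp)
  show "(a + b) * c = a * c + b * c"
    by transfer (rule blinfun_eqI, simp add: blinfun.bilinear_simps)
  show "a * (b + c) = a * b + a * c"
    by transfer (rule blinfun_eqI, simp add: blinfun.bilinear_simps)
  show "1 * a = a" "a * 1 = a" by (transfer, rule blinfun_eqI, simp)+
  show "r *\<^sub>R a * b = r *\<^sub>R (a * b)" "a * r *\<^sub>R b = r *\<^sub>R (a * b)"
    by (transfer, rule blinfun_eqI, simp add: blinfun.bilinear_simps)+
  show "norm (a * b) \<le> norm a * norm b" by transfer (rule norm_blinfun_compose)
  show one: "norm (1 :: 'a endo) = 1" by transfer simp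
  show "(0 :: 'a endo) \<noteq> 1" by (metis norm_zero one zero_neq_one)
qed

end

definition app :: "'a::euclidean_space endo \<Rightarrow> 'a \<Rightarrow> 'a" where
  "app a x = blinfun_apply (blf a) x"

definition endo :: "('a::euclidean_space \<Rightarrow> 'a) \<Rightarrow> 'a endo" where
  "endo f = Endo (Blinfun f)"

lemma app_endo: "linear f \<Longrightarrow> app (endo f) = f"
  by (simp add: app_def endo_def Endo_inverse bounded_linear_Blinfun_apply
      linear_conv_bounded_linear fun_eq_iff)

lemma endo_eqI: "(\<And>x. app a x = app b x) \<Longrightarrow> a = b"
  unfolding app_def by (metis blf_inject blinfun_eqI)

lemma app_add [simp]: "app (a + b) x = app a x + app b x"
  and app_diff [simp]: "app (a - b) x = app a x - app b x"
  and app_scaleR [simp]: "app (r *\<^sub>R a) x = r *\<^sub>R app a x"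
  by (simp_all add: app_def blf_add blf_diff blf_scaleR blinfun.bilinear_simps)

lemma app_mult [simp]: "app (a * b) x = app a (app b x)"
  unfolding app_def by transfer simp

lemma app_one [simp]: "app 1 x = x" and app_zero [simp]: "app 0 x = 0"
  unfolding app_def by (transfer, simp)+

lemma app_minus [simp]: "app (- a) x = - app a x"
  by (metis app_add app_zero add.right_inverse add_eq_0_iff)

lemma norm_app_le: "norm (app a x) \<le> norm a * norm x"
  unfolding app_def by (metis norm_blf norm_blinfun)

lemma bounded_bilinear_app: "bounded_bilinear app"
proof
  show "\<exists>K. \<forall>(a::'a endo) b. norm (app a b) \<le> norm a * norm b * K"
    by (intro exI[of _ 1]) (simp add: norm_app_le)
qed (simp_all add: app_def blinfun.bilinear_simps blf_add blf_scaleR)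

lemma linear_app: "linear (app a)"
  using bounded_bilinear.bounded_linear_right[OF bounded_bilinear_app]
  by (rule bounded_linear.linear)

lemmas app_linear = linear_add[OF linear_app] linear_diff[OF linear_app] linear_cmul[OF linear_app]
  linear_0[OF linear_app]

lemma app_power: "app (a ^ n) x = (app a ^^ n) x"
  by (induction n arbitrary: x) (simp_all add: funpow_swap1)

lemma app_exp: "(\<lambda>k. (app a ^^ k) x /\<^sub>R fact k) sums app (exp a) x"
proof -
  have "(\<lambda>k. app (a ^ k /\<^sub>R fact k) x) sums app (exp a) x"
    using bounded_linear.sums[OF bounded_bilinear.bounded_linear_left[OF bounded_bilinear_app] exp_converges] .
  then show ?thesis by (simp add: app_power)
qed

section \<open>Product formula and one-parameter subgroups in a Banach algebra\<close>

lemma norm_power_diff_le: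
  fixes a b :: "'a::real_normed_algebra_1"
  assumes "norm a \<le> M" "norm b \<le> M" "1 \<le> M"
  shows "norm (a ^ n - b ^ n) \<le> real n * M ^ n * norm (a - b)"
proof (induction n)
  case (Suc n)
  have "a ^ Suc n - b ^ Suc n = a * (a ^ n - b ^ n) + (a - b) * b ^ n"
    by (simp add: algebra_simps)
  also have "norm \<dots> \<le> norm a * norm (a ^ n - b ^ n) + norm (a - b) * norm (b ^ n)"
    by (meson add_mono norm_mult_ineq norm_triangle_le)
  also have "\<dots> \<le> M * (real n * M ^ n * norm (a - b)) + norm (a - b) * M ^ Suc n"
  proof (intro add_mono mult_mono)
    have "norm (b ^ n) \<le> norm b ^ n" by (rule norm_power_ineq)
    also have "\<dots> \<le> M ^ n" using assms by (simp add: power_mono)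
    also have "\<dots> \<le> M ^ Suc n" using assms by (simp add: mult_left_mono)
    finally show "norm (b ^ n) \<le> M ^ Suc n" .
  qed (use Suc assms in auto)
  also have "\<dots> = real (Suc n) * M ^ Suc n * norm (a - b)"
    by (simp add: algebra_simps)
  finally show ?case .
qed simp

lemma exp_power_real: "exp (a /\<^sub>R real (Suc n)) ^ Suc n = exp (a :: 'a::{real_normed_algebra_1,banach})"
proof -
  have "exp (s *\<^sub>R a) ^ m = exp ((real m * s) *\<^sub>R a)" for m and s :: real
    by (induction m) (simp_all add: algebra_simps flip: exp_add_commuting)
  from this[of "inverse (real (Suc n))" "Suc n"] show ?thesis
    by (simp del: of_nat_Suc power_Suc)
qed

text \<open>With s = 1/(n+1), the factors exp(s a) exp(s b) and exp(s (a + b)) have the same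
  derivative at s = 0, so they differ by \<open>D s\<close> = o(s). Telescoping the power n+1
  multiplies this error by at most (n+1) \<open>E\<close>, which leaves a multiple of
  |\<open>D s\<close>| / s.\<close>

lemma trotter:
  fixes a b :: "'a::{real_normed_algebra_1,banach}"
  shows "(\<lambda>n. (exp (a /\<^sub>R real (Suc n)) * exp (b /\<^sub>R real (Suc n))) ^ Suc n) \<longlonglongrightarrow> exp (a + b)"
proof -
  define D where "D = (\<lambda>s::real. exp (s *\<^sub>R a) * exp (s *\<^sub>R b) - exp (s *\<^sub>R (a + b)))"
  have "(D has_vector_derivative ((exp (0 *\<^sub>R a) * (exp (0 *\<^sub>R b) * b) + exp (0 *\<^sub>R a) * a * exp (0 *\<^sub>R b)) - exp (0 *\<^sub>R (a+b)) * (a+b))) (at 0)"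
    unfolding D_def
    by (intro has_vector_derivative_diff has_vector_derivative_mult exp_scaleR_has_vector_derivative_right)
  then have "(D has_vector_derivative 0) (at 0)"
    by (simp add: algebra_simps)
  then have lim: "((\<lambda>s. norm (D s) / norm s) \<longlongrightarrow> 0) (at 0)"
    by (simp add: has_vector_derivative_def has_derivative_at D_def)
  have inv: "filterlim (\<lambda>n. inverse (real (Suc n))) (at 0) sequentially"
    unfolding filterlim_at using LIMSEQ_inverse_real_of_nat by simp
  have lim2: "(\<lambda>n. norm (D (inverse (real (Suc n)))) / norm (inverse (real (Suc n)))) \<longlonglongrightarrow> 0"
    using filterlim_compose[OF lim inv] .
  define E where "E = exp (norm a + norm b)"
  have bound: "norm ((exp (a /\<^sub>R real (Suc n)) * exp (b /\<^sub>R real (Suc n))) ^ Suc n - exp (a + b))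
     \<le> E * (norm (D (inverse (real (Suc n)))) / norm (inverse (real (Suc n))))" for n
  proof -
    define s where "s = inverse (real (Suc n))"
    have s: "s > 0" by (simp add: s_def)
    define M where "M = exp (s * (norm a + norm b))"
    have "norm (exp (s *\<^sub>R a) * exp (s *\<^sub>R b)) \<le> norm (exp (s *\<^sub>R a)) * norm (exp (s *\<^sub>R b))"
      by (rule norm_mult_ineq)
    also have "\<dots> \<le> exp (norm (s *\<^sub>R a)) * exp (norm (s *\<^sub>R b))"
      by (intro mult_mono norm_exp) auto
    also have "\<dots> = M" using s by (simp add: M_def algebra_simps flip: exp_add)
    finally have 1: "norm (exp (s *\<^sub>R a) * exp (s *\<^sub>R b)) \<le> M" .
    have "norm (exp (s *\<^sub>R (a + b))) \<le> exp (norm (s *\<^sub>R (a + b)))" by (rule norm_exp)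
    also have "\<dots> \<le> M"
      using s norm_triangle_ineq[of a b] by (simp add: M_def)
    finally have 2: "norm (exp (s *\<^sub>R (a + b))) \<le> M" .
    have 3: "1 \<le> M" using s by (simp add: M_def)
    have "M ^ Suc n = E"
      using exp_power_real[of n "norm a + norm b"] by (simp add: M_def E_def s_def divide_inverse del: power_Suc of_nat_Suc)
    moreover have "exp (s *\<^sub>R (a + b)) ^ Suc n = exp (a + b)"
      unfolding s_def using exp_power_real[of n "a + b"] by (simp del: power_Suc of_nat_Suc)
    ultimately have "norm ((exp (s *\<^sub>R a) * exp (s *\<^sub>R b)) ^ Suc n - exp (a + b)) \<le> real (Suc n) * E * norm (D s)"
      using norm_power_diff_le[OF 1 2 3, of "Suc n"] by (simp add: D_def del: power_Suc of_nat_Suc)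
    then show ?thesis
      by (simp add: s_def divide_inverse mult_ac del: power_Suc of_nat_Suc)
  qed
  have "(\<lambda>n. E * (norm (D (inverse (real (Suc n)))) / norm (inverse (real (Suc n))))) \<longlonglongrightarrow> 0"
    using tendsto_mult_right_zero[OF lim2] .
  then have "(\<lambda>n. (exp (a /\<^sub>R real (Suc n)) * exp (b /\<^sub>R real (Suc n))) ^ Suc n - exp (a + b)) \<longlonglongrightarrow> 0"
    by (rule Lim_null_comparison[OF always_eventually[OF allI[OF bound]]])
  then show ?thesis by (rule LIM_zero_cancel)
qed

lemma has_vector_derivative_quotient:
  assumes "(f has_vector_derivative d) (at 0)"
  shows "((\<lambda>h. (f h - f 0) /\<^sub>R h) \<longlongrightarrow> d) (at 0)"
proof -
  have "((\<lambda>h. norm (f h - f 0 - h *\<^sub>R d) / norm h) \<longlongrightarrow> 0) (at 0)"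
    using assms by (simp add: has_vector_derivative_def has_derivative_at)
  moreover have "norm (f h - f 0 - h *\<^sub>R d) / norm h = norm ((f h - f 0) /\<^sub>R h - d)" if "h \<noteq> 0" for h
  proof -
    have "(f h - f 0) /\<^sub>R h - d = (f h - f 0 - h *\<^sub>R d) /\<^sub>R h"
      using that by (simp add: scaleR_diff_right)
    then show ?thesis by (simp add: divide_inverse mult.commute)
  qed
  then have "\<forall>\<^sub>F h in at 0. norm (f h - f 0 - h *\<^sub>R d) / norm h = norm ((f h - f 0) /\<^sub>R h - d)"
    by (simp add: eventually_at_filter)
  ultimately have "((\<lambda>h. norm ((f h - f 0) /\<^sub>R h - d)) \<longlongrightarrow> 0) (at 0)"
    by (rule Lim_transform_eventually)
  then show ?thesis
    by (intro LIM_zero_cancel[of _ d]) (simp add: tendsto_norm_zero_iff)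
qed

text \<open>Neumann series: the sum of the powers of 1 - x is a right inverse.\<close>

lemma right_inverse_near_one:
  fixes x :: "'a::{real_normed_algebra_1,banach}"
  assumes "norm (1 - x) < 1"
  shows "\<exists>y. x * y = 1"
proof -
  define z where "z = 1 - x"
  have s: "summable (\<lambda>n. z ^ n)"
    using assms complete_algebra_summable_geometric z_def by blast
  have "(\<Sum>n. z ^ n) = 1 + (\<Sum>n. z ^ Suc n)"
    using suminf_split_head[OF s] by (simp add: algebra_simps)
  also have "(\<Sum>n. z ^ Suc n) = z * (\<Sum>n. z ^ n)"
    using suminf_mult[OF s] by simp
  finally have "(1 - z) * (\<Sum>n. z ^ n) = 1" by (simp add: algebra_simps)
  then show ?thesis by (auto simp: z_def)
qed

text \<open>The integral of a continuous one-parameter subgroup over a short interval is invertible,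
  which gives differentiability.\<close>

lemma one_parameter_subgroup_exp:
  fixes \<gamma> :: "real \<Rightarrow> 'a::{real_normed_algebra_1,banach}"
  assumes cont: "continuous_on UNIV \<gamma>" and hom: "\<And>s t. \<gamma> (s + t) = \<gamma> s * \<gamma> t" and one: "\<gamma> 0 = 1"
  shows "\<exists>y. \<forall>t. \<gamma> t = exp (t *\<^sub>R y)"
proof -
  \<comment> \<open>The lower limit -2 leaves room: for -1 < t < 1 and 0 \<le> u \<le> a < 1 both u
    and t + u lie in the open interval where \<open>P\<close> is known to be differentiable.\<close>
  define P where "P = (\<lambda>u. integral {-2..u} \<gamma>)"
  have P': "(P has_vector_derivative \<gamma> u) (at u)" if "-2 < u" "u < 2" for u
    using integral_has_vector_derivative[OF continuous_on_subset[OF cont], of "-2" 2 u] that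
    unfolding P_def by (simp add: at_within_Icc_at)
  have "(P has_vector_derivative 1) (at 0)" using P'[of 0] one by simp
  then have "((\<lambda>h. (P h - P 0) /\<^sub>R h) \<longlongrightarrow> 1) (at 0)"
    by (rule has_vector_derivative_quotient)
  then have "eventually (\<lambda>h. dist ((P h - P 0) /\<^sub>R h) 1 < 1) (at 0)"
    by (rule tendstoD) simp
  then obtain d where d: "d > 0" "\<And>h. h \<noteq> 0 \<Longrightarrow> dist h 0 < d \<Longrightarrow> dist ((P h - P 0) /\<^sub>R h) 1 < 1"
    by (auto simp: eventually_at)
  define a where "a = min (d/2) (1/2)"
  have a: "a > 0" "a < 1" "a < d" using d by (auto simp: a_def)
  have "norm (1 - (P a - P 0) /\<^sub>R a) < 1"
    using d(2)[of a] a by (simp add: dist_norm norm_minus_commute)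
  then obtain y where y: "((P a - P 0) /\<^sub>R a) * y = 1" using right_inverse_near_one by blast
  define J where "J = y /\<^sub>R a"
  have J: "(P a - P 0) * J = 1" using y by (simp add: J_def)
  \<comment> \<open>After replacing a by a variable u, both sides have derivative \<gamma> (t + u).
    With the right inverse \<open>J\<close> this expresses \<gamma> through the differentiable
    function \<open>P\<close>.\<close>
  have shift: "\<gamma> t * (P a - P 0) = P (t + a) - P t" if t: "-1 < t" "t < 1" for t
  proof -
    have "((\<lambda>u. P (t + u) - \<gamma> t * P u) has_derivative (\<lambda>h. 0)) (at u within {0..a})" if "u \<in> {0..a}" for u
    proof -
      have 1: "((\<lambda>u. P (t + u)) has_vector_derivative (1 *\<^sub>R \<gamma> (t + u))) (at u within {0..a})"
      proof -
        have s: "((\<lambda>u. t + u) has_vector_derivative 1) (at u within {0..a})"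
          by (auto simp: has_vector_derivative_def intro!: derivative_eq_intros)
        have "(P has_vector_derivative \<gamma> (t + u)) (at (t + u) within ((\<lambda>u. t + u) ` {0..a}))"
          using t that a by (intro has_vector_derivative_at_within[OF P']) auto
        from vector_diff_chain_within[OF s this] show ?thesis by (simp add: o_def)
      qed
      have 2: "((\<lambda>u. \<gamma> t * P u) has_vector_derivative (\<gamma> t * \<gamma> u)) (at u within {0..a})"
        using that a by (intro has_vector_derivative_mult_right has_vector_derivative_at_within[OF P']) auto
      show ?thesis
        using has_vector_derivative_diff[OF 1 2] by (simp add: hom has_vector_derivative_def)
    qed
    then have "P (t + a) - \<gamma> t * P a = P (t + 0) - \<gamma> t * P 0"
      using has_derivative_zero_unique[of "{0..a}" "\<lambda>u. P (t + u) - \<gamma> t * P u" a 0] a by auto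
    then show ?thesis by (simp add: algebra_simps)
  qed
  have \<gamma>_eq: "\<gamma> t = (P (t + a) - P t) * J" if "-1 < t" "t < 1" for t
    using shift[OF that] J by (metis mult.assoc mult.right_neutral)
  define Y where "Y = (\<gamma> a - 1) * J"
  have "((\<lambda>t. (P (t + a) - P t) * J) has_vector_derivative (1 *\<^sub>R \<gamma> (0 + a) - \<gamma> 0) * J) (at 0)"
  proof (intro has_vector_derivative_mult_left has_vector_derivative_diff)
    have s: "((\<lambda>t. t + a) has_vector_derivative 1) (at 0)"
      by (auto simp: has_vector_derivative_def intro!: derivative_eq_intros)
    have "(P has_vector_derivative \<gamma> (0 + a)) (at (0 + a))"
      using a by (intro P') auto
    from vector_diff_chain_at[OF s this]
    show "((\<lambda>t. P (t + a)) has_vector_derivative 1 *\<^sub>R \<gamma> (0 + a)) (at 0)" by (simp add: o_def)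
  qed (auto intro: P')
  then have "((\<lambda>t. (P (t + a) - P t) * J) has_vector_derivative Y) (at 0)"
    by (simp add: Y_def one)
  then have D0: "(\<gamma> has_vector_derivative Y) (at 0)"
    by (rule has_vector_derivative_transform_within_open[of _ _ _ "{-1<..<1}"]) (auto simp: \<gamma>_eq)
  have D: "(\<gamma> has_vector_derivative (\<gamma> t * Y)) (at t)" for t
  proof -
    have "((\<lambda>s. \<gamma> t * \<gamma> (s - t)) has_vector_derivative (\<gamma> t * (1 *\<^sub>R Y))) (at t)"
    proof (intro has_vector_derivative_mult_right)
      have s: "((\<lambda>s. s - t) has_vector_derivative 1) (at t)"
        by (auto simp: has_vector_derivative_def intro!: derivative_eq_intros)
      have "(\<gamma> has_vector_derivative Y) (at (t - t))" using D0 by simp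
      from vector_diff_chain_at[OF s this]
      show "((\<lambda>s. \<gamma> (s - t)) has_vector_derivative 1 *\<^sub>R Y) (at t)" by (simp add: o_def)
    qed
    then show ?thesis by (simp flip: hom)
  qed
  have "\<gamma> t = exp (t *\<^sub>R Y)" for t
  proof -
    have "((\<lambda>s. \<gamma> s * exp (s *\<^sub>R (- Y))) has_derivative (\<lambda>h. 0)) (at s within UNIV)" for s
    proof -
      have "((\<lambda>s. \<gamma> s * exp (s *\<^sub>R (- Y))) has_vector_derivative
          (\<gamma> s * (exp (s *\<^sub>R (- Y)) * (- Y)) + \<gamma> s * Y * exp (s *\<^sub>R (- Y)))) (at s)"
        by (intro has_vector_derivative_mult D exp_scaleR_has_vector_derivative_right)
      moreover have "Y * exp (s *\<^sub>R (- Y)) = exp (s *\<^sub>R (- Y)) * Y"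
        using exp_times_scaleR_commute[of s "- Y"] by simp
      ultimately show ?thesis by (simp add: has_vector_derivative_def mult.assoc)
    qed
    then have "\<gamma> t * exp (t *\<^sub>R (- Y)) = \<gamma> 0 * exp (0 *\<^sub>R (- Y))"
      using has_derivative_zero_unique[of UNIV "\<lambda>s. \<gamma> s * exp (s *\<^sub>R (- Y))" t 0] by simp
    then have "\<gamma> t * exp (- (t *\<^sub>R Y)) * exp (t *\<^sub>R Y) = exp (t *\<^sub>R Y)"
      by (simp add: one)
    moreover have "exp (- (t *\<^sub>R Y)) * exp (t *\<^sub>R Y) = 1"
      using exp_minus_inverse[of "- (t *\<^sub>R Y)"] by simp
    ultimately show ?thesis by (simp add: mult.assoc)
  qed
  then show ?thesis by blast
qed

section \<open>Matrix exponentials and the adjoint action\<close>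

text \<open>Matrices over such a field form a Euclidean space, so their linear endomorphisms are
  bounded and have an exponential in \<open>endo\<close>. Both ground fields are treated at once, as
  real vector spaces.\<close>

class rcfield = real_normed_field + euclidean_space

instance real :: rcfield ..
instance complex :: rcfield ..

lemma matrix_add_rdistrib: "(A + B) ** C = A ** C + B ** (C :: 'k::semiring_1^'n^'n)"
  by (simp add: vec_eq_iff matrix_matrix_mult_def sum.distrib distrib_right)

lemma scaleR_matrix_mult_left: "(r *\<^sub>R A) ** B = r *\<^sub>R (A ** (B :: 'k::real_normed_field^'n^'n))"
  and scaleR_matrix_mult_right: "A ** (r *\<^sub>R B) = r *\<^sub>R (A ** (B :: 'k::real_normed_field^'n^'n))"
  by (simp_all add: vec_eq_iff matrix_matrix_mult_def scaleR_sum_right)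

lemma matrix_diff_ldistrib: "A ** (B - C) = A ** B - A ** (C :: 'k::ring_1^'n^'n)"
  and matrix_diff_rdistrib: "(A - B) ** C = A ** C - B ** (C :: 'k::ring_1^'n^'n)"
  by (simp_all add: vec_eq_iff matrix_matrix_mult_def sum_subtractf algebra_simps)

lemma bounded_bilinear_matrix_mult:
  "bounded_bilinear ((**) :: 'k::rcfield^'n^'n \<Rightarrow> 'k^'n^'n \<Rightarrow> 'k^'n^'n)"
  unfolding bilinear_conv_bounded_bilinear[symmetric] bilinear_def
  by (auto intro!: linearI simp: matrix_add_ldistrib matrix_add_rdistrib scaleR_matrix_mult_left
      scaleR_matrix_mult_right)

lemma linear_matrix_mult_left: "linear (\<lambda>B. A ** (B :: 'k::real_normed_field^'n^'n))"
  and linear_matrix_mult_right: "linear (\<lambda>B. B ** (A :: 'k::real_normed_field^'n^'n))"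
  by (auto intro!: linearI simp: matrix_add_ldistrib matrix_add_rdistrib scaleR_matrix_mult_left
      scaleR_matrix_mult_right)

text \<open>Left multiplication embeds the matrices into the algebra of endomorphisms. The
  exponential is transported along this embedding, because the matrix type itself carries the
  entrywise product.\<close>

definition lmult :: "('k::rcfield)^'n^'n \<Rightarrow> ('k^'n^'n) endo" where
  "lmult A = endo (\<lambda>B. A ** B)"

definition rmult :: "('k::rcfield)^'n^'n \<Rightarrow> ('k^'n^'n) endo" where
  "rmult A = endo (\<lambda>B. B ** A)"

definition ad :: "('k::rcfield)^'n^'n \<Rightarrow> ('k^'n^'n) endo" where
  "ad A = lmult A - rmult A"

lemma app_lmult [simp]: "app (lmult A) B = A ** B"
  by (simp add: lmult_def app_endo linear_matrix_mult_left)

lemma app_rmult [simp]: "app (rmult A) B = B ** A"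
  by (simp add: rmult_def app_endo linear_matrix_mult_right)

lemma app_ad [simp]: "app (ad A) B = bracket A B"
  by (simp add: ad_def bracket_def)

lemma lmult_mult: "lmult (A ** B) = lmult A * lmult B"
  by (rule endo_eqI) (simp add: matrix_mul_assoc)

lemma lmult_one: "lmult (mat 1) = 1"
  by (rule endo_eqI) simp

lemma lmult_scaleR: "lmult (r *\<^sub>R A) = r *\<^sub>R lmult A"
  and rmult_scaleR: "rmult (r *\<^sub>R A) = r *\<^sub>R rmult A"
  and ad_scaleR: "ad (r *\<^sub>R A) = r *\<^sub>R ad A"
  by (rule endo_eqI, simp add: bracket_def scaleR_matrix_mult_left scaleR_matrix_mult_right
      scaleR_diff_right)+

lemma lmult_add: "lmult (A + B) = lmult A + lmult B"
  by (rule endo_eqI) (simp add: matrix_add_rdistrib)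

lemma mexp_eq_app: "mexp A = app (exp (lmult A)) (mat 1)"
proof -
  have "app (lmult A) = (**) A" by (simp add: fun_eq_iff)
  then show ?thesis
    using sums_unique[OF app_exp[of "lmult A" "mat 1"]] by (simp add: mexp_def)
qed

text \<open>The powers of left multiplication applied to B are those applied to the unit, times B on
  the right; the factor B passes through the series.\<close>

lemma exp_lmult: "exp (lmult A) = lmult (mexp (A :: 'k::rcfield^'n^'n))"
proof (rule endo_eqI)
  fix B :: "'k^'n^'n"
  have pow: "((**) A ^^ k) B = ((**) A ^^ k) (mat 1) ** B" for k
    by (induction k) (simp_all add: matrix_mul_assoc)
  have app: "app (lmult A) = (**) A" by (simp add: fun_eq_iff)
  have "(\<lambda>k. ((**) A ^^ k) (mat 1) /\<^sub>R fact k) sums mexp A"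
    using app_exp[of "lmult A" "mat 1"] by (simp add: mexp_eq_app app)
  then have "(\<lambda>k. (((**) A ^^ k) (mat 1) /\<^sub>R fact k) ** B) sums (mexp A ** B)"
    by (rule bounded_linear.sums[OF bounded_bilinear.bounded_linear_left[OF bounded_bilinear_matrix_mult]])
  then have "(\<lambda>k. ((**) A ^^ k) B /\<^sub>R fact k) sums (mexp A ** B)"
    by (simp only: pow scaleR_matrix_mult_left)
  then show "app (exp (lmult A)) B = app (lmult (mexp A)) B"
    using app_exp[of "lmult A" B] sums_unique2 by (fastforce simp: app)
qed

lemma lmult_inj: "lmult A = lmult B \<Longrightarrow> A = B"
  by (metis app_lmult matrix_mul_rid)

lemma mexp_add_scaleR:
  fixes A :: "'k::rcfield^'n^'n"
  shows "mexp ((s + t) *\<^sub>R A) = mexp (s *\<^sub>R A) ** mexp (t *\<^sub>R A)"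
proof (rule lmult_inj)
  have "exp (lmult ((s + t) *\<^sub>R A)) = exp (s *\<^sub>R lmult A + t *\<^sub>R lmult A)"
    by (simp only: lmult_scaleR lmult_add scaleR_add_left)
  also have "\<dots> = exp (s *\<^sub>R lmult A) * exp (t *\<^sub>R lmult A)"
    by (rule exp_add_commuting) simp
  finally show "lmult (mexp ((s + t) *\<^sub>R A)) = lmult (mexp (s *\<^sub>R A) ** mexp (t *\<^sub>R A))"
    by (simp add: lmult_mult lmult_scaleR flip: exp_lmult)
qed

lemma mexp_zero [simp]: "mexp (0 :: 'k::rcfield^'n^'n) = mat 1"
proof -
  have "lmult (0 :: 'k^'n^'n) = 0" by (rule endo_eqI) simp
  then show ?thesis by (simp add: mexp_eq_app)
qed

lemma mexp_minus:
  fixes A :: "'k::rcfield^'n^'n"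
  shows "mexp A ** mexp (- A) = mat 1" "mexp (- A) ** mexp A = mat 1"
  using mexp_add_scaleR[of 1 "-1" A] mexp_add_scaleR[of "-1" 1 A] by simp_all

lemma matrix_inv_unique_field:
  assumes "A ** B = mat 1" "B ** A = mat (1 :: 'k::field)"
  shows "matrix_inv A = B"
proof -
  have "\<exists>B. A ** B = mat 1 \<and> B ** A = mat 1" using assms by blast
  then have "A ** matrix_inv A = mat 1 \<and> matrix_inv A ** A = mat 1"
    unfolding matrix_inv_def by (rule someI_ex)
  then show ?thesis using assms by (metis matrix_mul_assoc matrix_mul_lid matrix_mul_rid)
qed

lemma matrix_inv_mexp: "matrix_inv (mexp A) = mexp (- (A :: 'k::rcfield^'n^'n))"
  by (rule matrix_inv_unique_field) (rule mexp_minus)+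

lemma invertible_matrix_inv:
  assumes "invertible (A :: 'k::field^'n^'n)"
  shows "A ** matrix_inv A = mat 1" "matrix_inv A ** A = mat 1"
  using someI_ex[OF assms[unfolded invertible_def]] by (simp_all add: matrix_inv_def)

lemma invertible_mexp: "invertible (mexp (A :: 'k::rcfield^'n^'n))"
  using mexp_minus invertible_def by blast

lemma exp_rmult: "exp (rmult A) = rmult (mexp (A :: 'k::rcfield^'n^'n))"
proof (rule endo_eqI)
  fix B :: "'k^'n^'n"
  have pow: "((\<lambda>B. B ** A) ^^ k) B = B ** ((**) A ^^ k) (mat 1)" for k
  proof (induction k arbitrary: B)
    case (Suc k)
    have "((**) A ^^ k) (mat 1) ** A = A ** ((**) A ^^ k) (mat 1)"
      by (induction k) (simp_all flip: matrix_mul_assoc)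
    then show ?case using Suc by (simp flip: matrix_mul_assoc)
  qed simp
  have app: "app (rmult A) = (\<lambda>B. B ** A)" by (simp add: fun_eq_iff)
  have app': "app (lmult A) = (**) A" by (simp add: fun_eq_iff)
  have "(\<lambda>k. ((**) A ^^ k) (mat 1) /\<^sub>R fact k) sums mexp A"
    using app_exp[of "lmult A" "mat 1"] by (simp add: mexp_eq_app app')
  then have "(\<lambda>k. B ** (((**) A ^^ k) (mat 1) /\<^sub>R fact k)) sums (B ** mexp A)"
    by (rule bounded_linear.sums[OF bounded_bilinear.bounded_linear_right[OF bounded_bilinear_matrix_mult]])
  then have "(\<lambda>k. ((\<lambda>B. B ** A) ^^ k) B /\<^sub>R fact k) sums (B ** mexp A)"
    by (simp only: pow scaleR_matrix_mult_right)
  then show "app (exp (rmult A)) B = app (rmult (mexp A)) B"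
    using app_exp[of "rmult A" B] sums_unique2 by (fastforce simp: app)
qed

text \<open>Left and right multiplications commute, so the exponential of their difference
  \<open>ad X\<close> splits into left multiplication by \<open>mexp X\<close> and right
  multiplication by its inverse.\<close>

lemma Ad_mexp: "Ad (mexp X) (Y :: 'k::rcfield^'n^'n) = app (exp (ad X)) Y"
proof -
  have "- rmult X = rmult (- X)" using rmult_scaleR[of "-1" X] by simp
  then have "ad X = lmult X + rmult (- X)" unfolding ad_def by (metis diff_conv_add_uminus)
  then have "exp (ad X) = exp (lmult X + rmult (- X))" by simp
  also have "\<dots> = exp (lmult X) * exp (rmult (- X))"
    by (rule exp_add_commuting, rule endo_eqI) (simp add: matrix_mul_assoc)
  finally show ?thesis
    by (simp add: exp_lmult exp_rmult Ad_def matrix_inv_mexp matrix_mul_assoc)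
qed

lemma Ad_mexp_has_vector_derivative:
  fixes X Y :: "'k::rcfield^'n^'n"
  shows
  "((\<lambda>t. Ad (mexp (t *\<^sub>R X)) Y) has_vector_derivative bracket X (Ad (mexp (t *\<^sub>R X)) Y)) (at t within S)"
proof -
  have "((\<lambda>t. app (exp (t *\<^sub>R ad X)) Y) has_vector_derivative app (exp (t *\<^sub>R ad X) * ad X) Y) (at t within S)"
    by (rule bounded_linear.has_vector_derivative[OF bounded_bilinear.bounded_linear_left[OF bounded_bilinear_app]
        exp_scaleR_has_vector_derivative_right])
  moreover have "exp (t *\<^sub>R ad X) * ad X = ad X * exp (t *\<^sub>R ad X)"
    by (rule exp_times_scaleR_commute)
  ultimately show ?thesis by (simp add: Ad_mexp ad_scaleR)
qed

lemma mexp_has_vector_derivative: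
  fixes X :: "'k::rcfield^'n^'n"
  shows
  "((\<lambda>t. mexp (t *\<^sub>R X)) has_vector_derivative X ** mexp (t *\<^sub>R X)) (at t within S)"
proof -
  have "((\<lambda>t. app (exp (t *\<^sub>R lmult X)) (mat 1)) has_vector_derivative app (exp (t *\<^sub>R lmult X) * lmult X) (mat 1)) (at t within S)"
    by (rule bounded_linear.has_vector_derivative[OF bounded_bilinear.bounded_linear_left[OF bounded_bilinear_app]
        exp_scaleR_has_vector_derivative_right])
  moreover have "exp (t *\<^sub>R lmult X) * lmult X = lmult X * exp (t *\<^sub>R lmult X)"
    by (rule exp_times_scaleR_commute)
  ultimately show ?thesis by (simp add: mexp_eq_app lmult_scaleR)
qed

lemma continuous_mexp: "continuous_on UNIV (\<lambda>t. mexp (t *\<^sub>R (X :: 'k::rcfield^'n^'n)))"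
  by (intro continuous_at_imp_continuous_on ballI has_vector_derivative_continuous[OF mexp_has_vector_derivative])

lemma mexp_scaleR_inj:
  fixes X Y :: "'k::rcfield^'n^'n"
  assumes "\<And>t. mexp (t *\<^sub>R X) = mexp (t *\<^sub>R Y)"
  shows "X = Y"
  using vector_derivative_unique_at[OF mexp_has_vector_derivative[of X 0 UNIV, unfolded assms]
      mexp_has_vector_derivative[of Y 0 UNIV]]
  by simp

lemma linear_Ad: "linear (Ad A :: 'k::real_normed_field^'n^'n \<Rightarrow> _)"
  unfolding Ad_def by (rule linearI) (simp_all add: matrix_add_ldistrib matrix_add_rdistrib
      scaleR_matrix_mult_left scaleR_matrix_mult_right)

lemma Ad_mult:
  assumes "invertible A" "invertible (B :: 'k::field^'n^'n)"
  shows "Ad (A ** B) X = Ad A (Ad B X)"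
proof -
  have "matrix_inv (A ** B) = matrix_inv B ** matrix_inv A"
    using invertible_matrix_inv[OF assms(1)] invertible_matrix_inv[OF assms(2)]
    by (intro matrix_inv_unique_field) (metis matrix_mul_assoc matrix_mul_lid)+
  then show ?thesis by (simp add: Ad_def matrix_mul_assoc)
qed

lemma Ad_one [simp]: "Ad (mat 1) X = (X :: 'k::field^'n^'n)"
  by (simp add: Ad_def matrix_inv_unique_field)

lemma Ad_matrix_mult:
  assumes "invertible (A :: 'k::field^'n^'n)"
  shows "Ad A (X ** Y) = Ad A X ** Ad A Y"
  using invertible_matrix_inv[OF assms] by (simp add: Ad_def) (metis matrix_mul_assoc matrix_mul_lid)

lemma Ad_bracket:
  assumes "invertible (A :: 'k::real_normed_field^'n^'n)"
  shows "Ad A (bracket X Y) = bracket (Ad A X) (Ad A Y)"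
  by (simp add: bracket_def linear_diff[OF linear_Ad] Ad_matrix_mult assms)

lemma Ad_mexp_eq:
  assumes "invertible (A :: 'k::rcfield^'n^'n)"
  shows "mexp (Ad A X) = Ad A (mexp X)"
proof -
  have pow: "((**) (Ad A X) ^^ k) (mat 1) = Ad A (((**) X ^^ k) (mat 1))" for k
    using invertible_matrix_inv[OF assms]
    by (induction k) (simp_all add: Ad_matrix_mult[OF assms], simp add: Ad_def)
  have app: "app (lmult X) = (**) X" for X by (simp add: fun_eq_iff)
  have "(\<lambda>k. Ad A (((**) X ^^ k) (mat 1) /\<^sub>R fact k)) sums Ad A (mexp X)"
    using app_exp[of "lmult X" "mat 1", unfolded app, folded mexp_eq_app] linear_Ad[of A]
    by (intro bounded_linear.sums[of "Ad A"]) (simp only: linear_conv_bounded_linear)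
  then have "(\<lambda>k. ((**) (Ad A X) ^^ k) (mat 1) /\<^sub>R fact k) sums Ad A (mexp X)"
    by (simp add: pow linear_cmul[OF linear_Ad])
  then show ?thesis
    using app_exp[of "lmult (Ad A X)" "mat 1"] sums_unique2 by (fastforce simp: app mexp_eq_app)
qed

text \<open>Seen as left multiplications, the curve is exp(t y) for some endomorphism y. Its
  derivative at 0 commutes with right multiplications, so y is itself left multiplication, by its
  value at the unit.\<close>

lemma matrix_one_parameter_subgroup:
  fixes \<gamma> :: "real \<Rightarrow> 'k::rcfield^'n^'n"
  assumes cont: "continuous_on UNIV \<gamma>" and hom: "\<And>s t. \<gamma> (s + t) = \<gamma> s ** \<gamma> t" and one: "\<gamma> 0 = mat 1"
  shows "\<exists>Y. \<forall>t. \<gamma> t = mexp (t *\<^sub>R Y)"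
proof -
  have lin: "linear (lmult :: 'k^'n^'n \<Rightarrow> _)" by (rule linearI) (simp_all add: lmult_add lmult_scaleR)
  have "continuous_on UNIV (\<lambda>t. lmult (\<gamma> t))"
    using cont lin by (simp add: linear_continuous_on_compose)
  then obtain y where y: "\<And>t. lmult (\<gamma> t) = exp (t *\<^sub>R y)"
    using one_parameter_subgroup_exp[of "\<lambda>t. lmult (\<gamma> t)"] by (auto simp: hom one lmult_mult lmult_one)
  have "((\<lambda>t. lmult (\<gamma> t)) has_vector_derivative (exp (0 *\<^sub>R y) * y)) (at 0)"
    unfolding y by (rule exp_scaleR_has_vector_derivative_right)
  then have "((\<lambda>t. app (lmult (\<gamma> t)) B) has_vector_derivative app y B) (at 0)" for B
    using bounded_linear.has_vector_derivative[OF bounded_bilinear.bounded_linear_left[OF bounded_bilinear_app, of B]] by fastforce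
  then have D: "((\<lambda>t. \<gamma> t ** B) has_vector_derivative app y B) (at 0)" for B by simp
  have "app y B = app y (mat 1) ** B" for B
  proof -
    have "((\<lambda>t. \<gamma> t ** mat 1 ** B) has_vector_derivative app y (mat 1) ** B) (at 0)"
      using bounded_linear.has_vector_derivative[OF bounded_bilinear.bounded_linear_left[OF bounded_bilinear_matrix_mult] D] .
    then show ?thesis using vector_derivative_unique_at[OF D] by simp
  qed
  then have "y = lmult (app y (mat 1))" by (intro endo_eqI) (metis app_lmult)
  then have "lmult (\<gamma> t) = lmult (mexp (t *\<^sub>R app y (mat 1)))" for t
    unfolding y exp_lmult[symmetric] lmult_scaleR by simp
  then show ?thesis using lmult_inj by blast
qed

lemma matrix_trotter:
  fixes X Y :: "'k::rcfield^'n^'n"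
  shows "(\<lambda>n. (((**) (mexp (X /\<^sub>R real (Suc n)) ** mexp (Y /\<^sub>R real (Suc n)))) ^^ Suc n) (mat 1)) \<longlonglongrightarrow> mexp (X + Y)"
proof -
  have "(\<lambda>n. app ((exp (lmult X /\<^sub>R real (Suc n)) * exp (lmult Y /\<^sub>R real (Suc n))) ^ Suc n) (mat 1)) \<longlonglongrightarrow> app (exp (lmult X + lmult Y)) (mat 1)"
    by (rule bounded_linear.tendsto[OF bounded_bilinear.bounded_linear_left[OF bounded_bilinear_app] trotter])
  moreover have "app (lmult A) = (**) A" for A :: "'k^'n^'n" by (simp add: fun_eq_iff)
  ultimately show ?thesis
    unfolding mexp_eq_app[of "X + Y"] lmult_add app_power
    by (simp add: exp_lmult del: of_nat_Suc flip: lmult_scaleR lmult_mult)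
qed

section \<open>The Lie algebra of a closed matrix group\<close>

text \<open>Difference quotients stay in S, and subspaces are closed in finite dimension.\<close>

lemma closed_subspace_derivative:
  fixes f :: "real \<Rightarrow> 'a::euclidean_space"
  assumes S: "subspace S" and f: "\<And>t. f t \<in> S" and D: "(f has_vector_derivative d) (at 0)"
  shows "d \<in> S"
proof -
  have "((\<lambda>h. (f h - f 0) /\<^sub>R h) \<longlongrightarrow> d) (at 0)"
    using D by (rule has_vector_derivative_quotient)
  moreover have "\<forall>\<^sub>F h in at 0. (f h - f 0) /\<^sub>R h \<in> S"
    using S f by (intro always_eventually allI) (simp add: subspace_diff subspace_scale)
  ultimately show ?thesis
    by (intro Lim_in_closed_set[OF closed_subspace[OF S] _ at_neq_bot])
qed

lemma continuous_on_matrix_polys: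
  assumes "p \<in> (matrix_polys :: ('k::rcfield^'n^'n \<Rightarrow> 'k) set)"
  shows "continuous_on UNIV p"
  using assms by induction (auto intro!: continuous_intros)

text \<open>Closedness is relative to the invertible matrices: an algebraic group is a zero set cut
  down to the general linear group, and a limit in the space of all matrices may be
  singular.\<close>

locale closed_matrix_group =
  fixes G :: "('k::rcfield^'n^'n) set"
  assumes mgroup: "matrix_group G"
    and lim_closed: "\<And>X A. (\<And>n::nat. X n \<in> G) \<Longrightarrow> X \<longlonglongrightarrow> A \<Longrightarrow> invertible A \<Longrightarrow> A \<in> G"

lemma algebraic_closed_matrix_group:
  assumes "linear_algebraic_group (G :: ('k::rcfield^'n^'n) set)"
  shows "closed_matrix_group G"
proof
  show "matrix_group G" using assms by (simp add: linear_algebraic_group_def)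
  fix X A assume X: "\<And>n::nat. X n \<in> G" and lim: "X \<longlonglongrightarrow> A" and inv: "invertible A"
  from assms obtain P where P: "P \<subseteq> matrix_polys" "G = {A. invertible A \<and> (\<forall>p\<in>P. p A = 0)}"
    by (auto simp: linear_algebraic_group_def)
  have "p A = 0" if "p \<in> P" for p
  proof -
    have "continuous_on UNIV p" using P that continuous_on_matrix_polys by blast
    then have "(\<lambda>n. p (X n)) \<longlonglongrightarrow> p A"
      by (rule continuous_on_tendsto_compose[OF _ lim]) auto
    moreover have "p (X n) = 0" for n using X[of n] P that by auto
    ultimately show ?thesis by (simp add: LIMSEQ_const_iff)
  qed
  then show "A \<in> G" using P inv by simp
qed

context closed_matrix_group
begin

abbreviation "\<gg> \<equiv> lie_algebra G"

lemma G_invertible: "A \<in> G \<Longrightarrow> invertible A"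
  and G_mult: "A \<in> G \<Longrightarrow> B \<in> G \<Longrightarrow> A ** B \<in> G"
  and G_one: "mat 1 \<in> G"
  and G_inv: "A \<in> G \<Longrightarrow> matrix_inv A \<in> G"
  using mgroup by (simp_all add: matrix_group_def)

lemma mexp_in_G: "X \<in> \<gg> \<Longrightarrow> mexp (t *\<^sub>R X) \<in> G"
  by (simp add: lie_algebra_def)

lemma mexp_in_G': "X \<in> \<gg> \<Longrightarrow> mexp X \<in> G"
  using mexp_in_G[of X 1] by simp

lemma G_power: "A \<in> G \<Longrightarrow> ((**) A ^^ n) (mat 1) \<in> G"
  by (induction n) (auto simp: G_one G_mult)

lemma lie_scaleR: "X \<in> \<gg> \<Longrightarrow> r *\<^sub>R X \<in> \<gg>"
  by (simp add: lie_algebra_def)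

text \<open>The product formula writes exp(t (X + Y)) as a limit of elements of G; being an
  exponential, the limit is invertible, as \<open>lim_closed\<close> requires.\<close>

lemma lie_add:
  assumes "X \<in> \<gg>" "Y \<in> \<gg>" shows "X + Y \<in> \<gg>"
proof -
  have "mexp (t *\<^sub>R X + t *\<^sub>R Y) \<in> G" for t
  proof (rule lim_closed[OF _ matrix_trotter invertible_mexp])
    show "((**) (mexp ((t *\<^sub>R X) /\<^sub>R real (Suc n)) ** mexp ((t *\<^sub>R Y) /\<^sub>R real (Suc n))) ^^ Suc n) (mat 1) \<in> G" for n
      using assms by (intro G_power G_mult mexp_in_G' lie_scaleR)
  qed
  then show ?thesis by (simp add: lie_algebra_def scaleR_add_right)
qed

lemma subspace_lie: "subspace \<gg>"
  by (auto simp: subspace_def lie_add lie_scaleR) (simp add: lie_algebra_def G_one)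

lemma Ad_in_lie: "A \<in> G \<Longrightarrow> X \<in> \<gg> \<Longrightarrow> Ad A X \<in> \<gg>"
proof -
  assume A: "A \<in> G" and X: "X \<in> \<gg>"
  have "mexp (t *\<^sub>R Ad A X) \<in> G" for t
  proof -
    have "mexp (t *\<^sub>R Ad A X) = Ad A (mexp (t *\<^sub>R X))"
      using Ad_mexp_eq[OF G_invertible[OF A], of "t *\<^sub>R X"] by (simp add: linear_cmul[OF linear_Ad])
    then show ?thesis unfolding Ad_def using A X by (simp add: G_mult G_inv mexp_in_G)
  qed
  then show ?thesis by (simp add: lie_algebra_def)
qed

text \<open>The bracket is the velocity at t = 0 of the curve Ad(exp(t X)) Y, which stays in the
  subspace \<open>\<gg>\<close>.\<close>

lemma bracket_in_lie: "X \<in> \<gg> \<Longrightarrow> Y \<in> \<gg> \<Longrightarrow> bracket X Y \<in> \<gg>"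
  by (rule closed_subspace_derivative[OF subspace_lie _ Ad_mexp_has_vector_derivative[of X Y 0 UNIV, simplified]])
    (simp_all add: Ad_in_lie mexp_in_G)

end

section \<open>Involutions of a closed matrix group and their differentials\<close>

locale group_involution = closed_matrix_group +
  fixes \<theta> :: "'a^'b^'b \<Rightarrow> 'a^'b^'b"
  assumes theta_G: "A \<in> G \<Longrightarrow> \<theta> A \<in> G"
    and theta_theta: "A \<in> G \<Longrightarrow> \<theta> (\<theta> A) = A"
    and theta_mult: "A \<in> G \<Longrightarrow> B \<in> G \<Longrightarrow> \<theta> (A ** B) = \<theta> A ** \<theta> B"
    and theta_cont: "continuous_on G \<theta>"
begin

lemma theta_one: "\<theta> (mat 1) = mat 1"
proof -
  have "\<theta> (mat 1) = \<theta> (mat 1) ** \<theta> (mat 1)" using theta_mult[OF G_one G_one] by simp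
  then have "matrix_inv (\<theta> (mat 1)) ** \<theta> (mat 1) = matrix_inv (\<theta> (mat 1)) ** (\<theta> (mat 1) ** \<theta> (mat 1))"
    by simp
  then show ?thesis
    using invertible_matrix_inv[OF G_invertible[OF theta_G[OF G_one]]] by (simp add: matrix_mul_assoc)
qed

lemma theta_inv:
  assumes "A \<in> G" shows "\<theta> (matrix_inv A) = matrix_inv (\<theta> A)"
proof (rule sym[OF matrix_inv_unique_field])
  note A = invertible_matrix_inv[OF G_invertible[OF assms]]
  show "\<theta> A ** \<theta> (matrix_inv A) = mat 1"
    using theta_mult[OF assms G_inv[OF assms]] by (simp only: A theta_one)
  show "\<theta> (matrix_inv A) ** \<theta> A = mat 1"
    using theta_mult[OF G_inv[OF assms] assms] by (simp only: A theta_one)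
qed

lemma theta_power: "A \<in> G \<Longrightarrow> \<theta> (((**) A ^^ n) (mat 1)) = ((**) (\<theta> A) ^^ n) (mat 1)"
  by (induction n) (auto simp: theta_one theta_mult G_power)

text \<open>Continuity of \<theta> suffices for differentiability here: the image of a one-parameter
  subgroup is a continuous one-parameter subgroup, hence an exponential, and its generator is the
  derivative taken in \<open>differential\<close>.\<close>

lemma theta_mexp: "X \<in> \<gg> \<Longrightarrow> \<theta> (mexp (t *\<^sub>R X)) = mexp (t *\<^sub>R differential \<theta> X)"
proof -
  assume X: "X \<in> \<gg>"
  have "continuous_on UNIV (\<lambda>t. \<theta> (mexp (t *\<^sub>R X)))"
    by (rule continuous_on_compose2[OF theta_cont continuous_mexp]) (use X mexp_in_G in auto)
  then obtain Y where Y: "\<And>t. \<theta> (mexp (t *\<^sub>R X)) = mexp (t *\<^sub>R Y)"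
    using matrix_one_parameter_subgroup[of "\<lambda>t. \<theta> (mexp (t *\<^sub>R X))"] X
    by (auto simp: mexp_add_scaleR theta_mult mexp_in_G theta_one)
  have "differential \<theta> X = Y"
    using mexp_has_vector_derivative[of Y 0 UNIV] by (simp add: differential_def Y vector_derivative_at)
  then show ?thesis using Y by simp
qed

lemma theta_mexp': "X \<in> \<gg> \<Longrightarrow> \<theta> (mexp X) = mexp (differential \<theta> X)"
  using theta_mexp[of X 1] by simp

lemma differential_in_lie:
  assumes "X \<in> \<gg>" shows "differential \<theta> X \<in> \<gg>"
proof -
  have "mexp (t *\<^sub>R differential \<theta> X) \<in> G" for t
    unfolding theta_mexp[OF assms, symmetric] using assms by (intro theta_G mexp_in_G)
  then show ?thesis by (simp add: lie_algebra_def)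
qed

lemma differential_eqI:
  assumes "X \<in> \<gg>" "\<And>t. \<theta> (mexp (t *\<^sub>R X)) = mexp (t *\<^sub>R Y)"
  shows "differential \<theta> X = Y"
proof (rule mexp_scaleR_inj)
  show "mexp (t *\<^sub>R differential \<theta> X) = mexp (t *\<^sub>R Y)" for t
    unfolding theta_mexp[OF assms(1), symmetric] by (rule assms(2))
qed

lemma differential_scaleR:
  assumes "X \<in> \<gg>" shows "differential \<theta> (r *\<^sub>R X) = r *\<^sub>R differential \<theta> X"
proof (rule differential_eqI[OF lie_scaleR[OF assms]])
  show "\<theta> (mexp (t *\<^sub>R r *\<^sub>R X)) = mexp (t *\<^sub>R r *\<^sub>R differential \<theta> X)" for t
    using theta_mexp[OF assms, of "t * r"] by simp
qed

lemma differential_differential: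
  assumes "X \<in> \<gg>" shows "differential \<theta> (differential \<theta> X) = X"
proof (rule differential_eqI[OF differential_in_lie[OF assms]])
  show "\<theta> (mexp (t *\<^sub>R differential \<theta> X)) = mexp (t *\<^sub>R X)" for t
    unfolding theta_mexp[OF assms, symmetric] using assms by (intro theta_theta mexp_in_G)
qed

text \<open>\<theta> is applied to the products of the product formula for X and Y, and the two
  limits are compared. It is continuous on G only, which is why the limit has to be in G.\<close>

lemma differential_add:
  assumes X: "X \<in> \<gg>" and Y: "Y \<in> \<gg>"
  shows "differential \<theta> (X + Y) = differential \<theta> X + differential \<theta> Y"
proof (rule differential_eqI)
  show "X + Y \<in> \<gg>" using assms by (rule lie_add)
  fix t
  define A where "A = (\<lambda>n. mexp ((t *\<^sub>R X) /\<^sub>R real (Suc n)) ** mexp ((t *\<^sub>R Y) /\<^sub>R real (Suc n)))"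
  have A: "A n \<in> G" for n
    unfolding A_def using assms by (intro G_mult mexp_in_G' lie_scaleR)
  have tA: "\<theta> (A n) = mexp ((t *\<^sub>R differential \<theta> X) /\<^sub>R real (Suc n)) ** mexp ((t *\<^sub>R differential \<theta> Y) /\<^sub>R real (Suc n))" for n
    unfolding A_def using assms
    by (simp add: theta_mult mexp_in_G' lie_scaleR theta_mexp' differential_scaleR del: of_nat_Suc)
  have "(\<lambda>n. ((**) (A n) ^^ Suc n) (mat 1)) \<longlonglongrightarrow> mexp (t *\<^sub>R X + t *\<^sub>R Y)"
    unfolding A_def by (rule matrix_trotter)
  moreover have "mexp (t *\<^sub>R X + t *\<^sub>R Y) \<in> G"
    using assms by (intro mexp_in_G' lie_add lie_scaleR)
  ultimately have "(\<lambda>n. \<theta> (((**) (A n) ^^ Suc n) (mat 1))) \<longlonglongrightarrow> \<theta> (mexp (t *\<^sub>R X + t *\<^sub>R Y))"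
    using G_power[OF A]
    by (intro continuous_on_tendsto_compose[OF theta_cont]) (auto simp del: funpow.simps)
  moreover have "(\<lambda>n. \<theta> (((**) (A n) ^^ Suc n) (mat 1))) \<longlonglongrightarrow> mexp (t *\<^sub>R differential \<theta> X + t *\<^sub>R differential \<theta> Y)"
    unfolding theta_power[OF A] tA by (rule matrix_trotter)
  ultimately show "\<theta> (mexp (t *\<^sub>R (X + Y))) = mexp (t *\<^sub>R (differential \<theta> X + differential \<theta> Y))"
    using LIMSEQ_unique by (simp add: scaleR_add_right)
qed

lemma projection_exists: "\<exists>p. linear p \<and> range p \<subseteq> \<gg> \<and> (\<forall>x\<in>\<gg>. p x = x)"
  using linear_exists_left_inverse_on[of "\<lambda>x. x" \<gg>] subspace_lie by (auto simp: linear_id[unfolded id_def])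

definition proj :: "'a^'b^'b \<Rightarrow> 'a^'b^'b" where
  "proj = (SOME p. linear p \<and> range p \<subseteq> \<gg> \<and> (\<forall>x\<in>\<gg>. p x = x))"

lemma linear_proj: "linear proj" and proj_in_lie: "proj x \<in> \<gg>" and proj_id: "x \<in> \<gg> \<Longrightarrow> proj x = x"
  using someI_ex[OF projection_exists] unfolding proj_def[symmetric] by auto

text \<open>The differential, extended from the Lie algebra to all matrices by a projection, so that
  it is linear as a total function.\<close>

definition sig :: "'a^'b^'b \<Rightarrow> 'a^'b^'b" where
  "sig x = differential \<theta> (proj x)"

lemma linear_sig: "linear sig"
  unfolding sig_def
  by (rule linearI) (simp_all add: linear_add[OF linear_proj] linear_cmul[OF linear_proj]
      differential_add differential_scaleR proj_in_lie)

lemma sig_eq: "X \<in> \<gg> \<Longrightarrow> sig X = differential \<theta> X"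
  by (simp add: sig_def proj_id)

lemma sig_in_lie: "sig X \<in> \<gg>"
  by (simp add: sig_def differential_in_lie proj_in_lie)

lemma sig_sig: "X \<in> \<gg> \<Longrightarrow> sig (sig X) = X"
  by (simp add: sig_eq differential_in_lie differential_differential)

lemma sig_Ad:
  assumes "A \<in> G" "X \<in> \<gg>"
  shows "sig (Ad A X) = Ad (\<theta> A) (sig X)"
proof -
  have "differential \<theta> (Ad A X) = Ad (\<theta> A) (differential \<theta> X)"
  proof (rule differential_eqI)
    fix t
    have "mexp (t *\<^sub>R Ad A X) = Ad A (mexp (t *\<^sub>R X))"
      using Ad_mexp_eq[OF G_invertible[OF assms(1)], of "t *\<^sub>R X"] by (simp add: linear_cmul[OF linear_Ad])
    then have "\<theta> (mexp (t *\<^sub>R Ad A X)) = Ad (\<theta> A) (mexp (t *\<^sub>R differential \<theta> X))"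
      using assms by (simp add: Ad_def theta_mult G_mult G_inv theta_inv mexp_in_G theta_mexp)
    also have "\<dots> = mexp (t *\<^sub>R Ad (\<theta> A) (differential \<theta> X))"
      using Ad_mexp_eq[OF G_invertible[OF theta_G[OF assms(1)]], of "t *\<^sub>R differential \<theta> X"]
      by (simp add: linear_cmul[OF linear_Ad])
    finally show "\<theta> (mexp (t *\<^sub>R Ad A X)) = mexp (t *\<^sub>R Ad (\<theta> A) (differential \<theta> X))" .
  qed (rule Ad_in_lie[OF assms])
  then show ?thesis using assms by (simp add: sig_eq Ad_in_lie)
qed

lemma sig_bracket:
  assumes "X \<in> \<gg>" "Y \<in> \<gg>"
  shows "sig (bracket X Y) = bracket (sig X) (sig Y)"
proof -
  have "((\<lambda>t. sig (Ad (mexp (t *\<^sub>R X)) Y)) has_vector_derivative sig (bracket X (Ad (mexp (0 *\<^sub>R X)) Y))) (at 0)"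
    using linear_sig
    by (intro bounded_linear.has_vector_derivative[OF _ Ad_mexp_has_vector_derivative]) (simp add: linear_conv_bounded_linear)
  moreover have "sig (Ad (mexp (t *\<^sub>R X)) Y) = Ad (mexp (t *\<^sub>R sig X)) (sig Y)" for t
    using assms by (simp add: sig_Ad mexp_in_G theta_mexp sig_eq)
  ultimately have "((\<lambda>t. Ad (mexp (t *\<^sub>R sig X)) (sig Y)) has_vector_derivative sig (bracket X Y)) (at 0)"
    by simp
  then show ?thesis
    using vector_derivative_unique_at[OF _ Ad_mexp_has_vector_derivative[of "sig X" "sig Y" 0 UNIV]] by simp
qed

text \<open>Differentiate the invariance at t = 0 along exp(t Z), which consists of fixed points
  because Z is fixed by the differential. Inserting \<open>proj\<close> makes the form bilinear on
  the whole space, so that the product rule applies.\<close>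

lemma Ad_fixed_skew:
  fixes ip :: "'a^'b^'b \<Rightarrow> 'a^'b^'b \<Rightarrow> real"
  assumes ip: "inner_product_on \<gg> ip" and inv: "Ad_invariant_on (fixed_group G \<theta>) \<gg> ip"
    and Z: "Z \<in> \<gg>" "sig Z = Z" and X: "X \<in> \<gg>" and Y: "Y \<in> \<gg>"
  shows "ip (bracket Z X) Y = - ip X (bracket Z Y)"
proof -
  define b where "b = (\<lambda>x y. ip (proj x) (proj y))"
  have b_eq: "b x y = ip x y" if "x \<in> \<gg>" "y \<in> \<gg>" for x y using that by (simp add: b_def proj_id)
  have "bilinear b"
    using ip proj_in_lie unfolding bilinear_def b_def inner_product_on_def
    by (auto intro!: linearI simp: linear_add[OF linear_proj] linear_cmul[OF linear_proj] lie_add lie_scaleR)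
  then have b: "bounded_bilinear b" by (simp add: bilinear_conv_bounded_bilinear)
  let ?g = "\<lambda>W t. Ad (mexp (t *\<^sub>R Z)) W"
  have "mexp (t *\<^sub>R Z) \<in> fixed_group G \<theta>" for t
    using Z by (simp add: fixed_group_def mexp_in_G theta_mexp sig_eq)
  then have const: "b (?g X t) (?g Y t) = b X Y" for t
    using inv X Y Z by (simp add: Ad_invariant_on_def b_eq Ad_in_lie mexp_in_G)
  have "((\<lambda>t. b (?g X t) (?g Y t)) has_vector_derivative
      (b (?g X 0) (bracket Z (?g Y 0)) + b (bracket Z (?g X 0)) (?g Y 0))) (at 0)"
    by (intro bounded_bilinear.has_vector_derivative[OF b] Ad_mexp_has_vector_derivative)
  then have "b X (bracket Z Y) + b (bracket Z X) Y = 0"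
    unfolding const using vector_derivative_unique_at[OF _ has_vector_derivative_const] by simp
  then show ?thesis using X Y Z by (simp add: b_eq bracket_in_lie)
qed

end

section \<open>Traces on subspaces\<close>

definition basis_trace :: "'a::euclidean_space set \<Rightarrow> ('a \<Rightarrow> 'a) \<Rightarrow> real" where
  "basis_trace B f = (\<Sum>b\<in>B. representation B (f b) b)"

lemma representation_linear_expand:
  fixes f :: "'a::euclidean_space \<Rightarrow> 'a"
  assumes B: "independent B" and C: "independent C" and f: "linear f"
    and v: "v \<in> span C" and fC: "\<And>x. x \<in> span C \<Longrightarrow> f x \<in> span B"
  shows "representation B (f v) b = (\<Sum>c\<in>C. representation C v c * representation B (f c) b)"
proof -
  have fin: "finite C" using C by (simp add: independent_imp_finite)
  have "f v = f (\<Sum>c\<in>C. representation C v c *\<^sub>R c)"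
    using sum_representation_eq[OF C v fin] by simp
  also have "\<dots> = (\<Sum>c\<in>C. representation C v c *\<^sub>R f c)"
    by (simp add: linear_sum[OF f] linear_cmul[OF f])
  finally show ?thesis
    using B fC by (simp add: representation_sum representation_scale span_base span_scale)
qed

text \<open>With each basis expanded in the other, both traces become the same double sum of
  products of coefficients.\<close>

lemma basis_trace_unique:
  fixes B :: "'a::euclidean_space set"
  assumes B: "independent B" and C: "independent C" and BC: "span B = span C" and f: "linear f"
    and fB: "\<And>x. x \<in> span B \<Longrightarrow> f x \<in> span B"
  shows "basis_trace B f = basis_trace C f"
proof -
  have fin: "finite B" using B by (simp add: independent_imp_finite)
  have "basis_trace B f = (\<Sum>b\<in>B. \<Sum>c\<in>C. representation C b c * representation B (f c) b)"
    unfolding basis_trace_def using assms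
    by (intro sum.cong refl representation_linear_expand) (auto simp: span_base simp flip: BC)
  also have "\<dots> = (\<Sum>c\<in>C. \<Sum>b\<in>B. representation B (f c) b * representation C b c)"
    by (subst sum.swap) (simp add: mult.commute)
  also have "\<dots> = (\<Sum>c\<in>C. representation C (f c) c)"
  proof (rule sum.cong[OF refl])
    fix c assume "c \<in> C"
    then have "f c \<in> span B" using fB BC by (simp add: span_base)
    then show "(\<Sum>b\<in>B. representation B (f c) b * representation C b c) = representation C (f c) c"
      using representation_linear_expand[OF C B linear_id, of "f c" c] BC by simp
  qed
  finally show ?thesis by (simp add: basis_trace_def)
qed

lemma trace_on_eq:
  fixes L :: "'a::euclidean_space set"
  assumes "independent B" "span B = L" "linear f" "\<And>x. x \<in> L \<Longrightarrow> f x \<in> L"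
  shows "trace_on L f = basis_trace B f"
proof -
  define C where "C = (SOME B. independent B \<and> span B = L)"
  have C: "independent C \<and> span C = L"
    unfolding C_def by (rule someI[of _ B]) (use assms in auto)
  have "trace_on L f = basis_trace C f"
    by (simp add: trace_on_def basis_trace_def C_def Let_def)
  also have "\<dots> = basis_trace B f"
    using assms C by (intro basis_trace_unique) auto
  finally show ?thesis .
qed

lemma subspace_basis:
  fixes L :: "'a::euclidean_space set"
  assumes "subspace L"
  obtains B where "independent B" "span B = L" "finite B"
proof -
  obtain B where B: "B \<subseteq> L" "independent B" "L \<subseteq> span B" using basis_exists[of L] by metis
  show ?thesis
  proof (rule that)
    show "span B = L" using B assms by (intro span_subspace)
  qed (use B independent_imp_finite in auto)
qed

lemma trace_on_cyclic:
  fixes L :: "'a::euclidean_space set"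
  assumes L: "subspace L" and f: "linear f" and g: "linear g"
    and fL: "\<And>x. x \<in> L \<Longrightarrow> f x \<in> L" and gL: "\<And>x. x \<in> L \<Longrightarrow> g x \<in> L"
  shows "trace_on L (\<lambda>x. f (g x)) = trace_on L (\<lambda>x. g (f x))"
proof -
  obtain B where B: "independent B" "span B = L" using L by (rule subspace_basis)
  have *: "trace_on L (\<lambda>x. h (k x)) = (\<Sum>b\<in>B. \<Sum>c\<in>B. representation B (k b) c * representation B (h c) b)"
    if "linear h" "linear k" "\<And>x. x \<in> L \<Longrightarrow> h x \<in> L" "\<And>x. x \<in> L \<Longrightarrow> k x \<in> L" for h k
  proof -
    have "trace_on L (\<lambda>x. h (k x)) = basis_trace B (\<lambda>x. h (k x))"
      using that linear_compose[of k h] by (intro trace_on_eq B) (auto simp: o_def)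
    also have "\<dots> = (\<Sum>b\<in>B. \<Sum>c\<in>B. representation B (k b) c * representation B (h c) b)"
      unfolding basis_trace_def using that B
      by (intro sum.cong refl representation_linear_expand) (auto simp: span_base)
    finally show ?thesis .
  qed
  have "(\<Sum>b\<in>B. \<Sum>c\<in>B. representation B (g b) c * representation B (f c) b) =
      (\<Sum>b\<in>B. \<Sum>c\<in>B. representation B (f b) c * representation B (g c) b)"
    by (subst sum.swap) (simp add: mult.commute)
  then show ?thesis using *[OF f g fL gL] *[OF g f gL fL] by simp
qed

lemma trace_on_cong: "(\<And>x. x \<in> L \<Longrightarrow> f x = g x) \<Longrightarrow> subspace L \<Longrightarrow> trace_on L f = trace_on L g"
proof -
  assume eq: "\<And>x. x \<in> L \<Longrightarrow> f x = g x" and L: "subspace L"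
  define C where "C = (SOME B. independent B \<and> span B = L)"
  have "\<exists>B. independent B \<and> span B = L"
    using basis_exists[of L] span_subspace[OF _ _ L] by metis
  then have C: "independent C \<and> span C = L" unfolding C_def by (rule someI_ex)
  have "(\<Sum>b\<in>C. representation C (f b) b) = (\<Sum>b\<in>C. representation C (g b) b)"
    using eq C by (intro sum.cong) (auto simp: span_base)
  then show ?thesis by (simp add: trace_on_def C_def Let_def)
qed

lemma trace_on_add:
  fixes L :: "'a::euclidean_space set"
  assumes L: "subspace L" and f: "linear f" and g: "linear g"
    and fL: "\<And>x. x \<in> L \<Longrightarrow> f x \<in> L" and gL: "\<And>x. x \<in> L \<Longrightarrow> g x \<in> L"
  shows "trace_on L (\<lambda>x. f x + g x) = trace_on L f + trace_on L g"
proof -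
  obtain B where B: "independent B" "span B = L" using L by (rule subspace_basis)
  have "trace_on L (\<lambda>x. f x + g x) = basis_trace B (\<lambda>x. f x + g x)"
    using assms by (intro trace_on_eq B linear_compose_add) (auto intro: subspace_add)
  also have "\<dots> = basis_trace B f + basis_trace B g"
    unfolding basis_trace_def sum.distrib[symmetric]
    using B fL gL by (intro sum.cong refl) (metis (no_types, lifting) representation_add span_base)
  finally show ?thesis using trace_on_eq[OF B f fL] trace_on_eq[OF B g gL] by simp
qed

lemma trace_on_scaleR:
  fixes L :: "'a::euclidean_space set"
  assumes L: "subspace L" and f: "linear f" and fL: "\<And>x. x \<in> L \<Longrightarrow> f x \<in> L"
  shows "trace_on L (\<lambda>x. r *\<^sub>R f x) = r * trace_on L f"
proof -
  obtain B where B: "independent B" "span B = L" using L by (rule subspace_basis)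
  have "trace_on L (\<lambda>x. r *\<^sub>R f x) = basis_trace B (\<lambda>x. r *\<^sub>R f x)"
    using assms by (intro trace_on_eq B linear_compose_scale_right) (auto intro: subspace_scale)
  also have "\<dots> = r * basis_trace B f"
    unfolding basis_trace_def sum_distrib_left
    using B fL by (intro sum.cong refl) (metis (no_types, lifting) representation_scale span_base)
  finally show ?thesis using trace_on_eq[OF B f fL] by simp
qed

text \<open>In a basis of L that extends one of the image, every f b has coordinates along the image
  part only; the added basis vectors contribute nothing to the diagonal.\<close>

lemma trace_on_image:
  fixes L :: "'a::euclidean_space set"
  assumes L: "subspace L" and f: "linear f" and fL: "\<And>x. x \<in> L \<Longrightarrow> f x \<in> L"
  shows "trace_on L f = trace_on (f ` L) f"
proof -
  have sub: "subspace (f ` L)" using f L by (rule linear_subspace_image)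
  then obtain C where C: "independent C" "span C = f ` L" by (rule subspace_basis)
  have "C \<subseteq> L" using C(2) span_superset[of C] fL by auto
  then obtain B where B: "C \<subseteq> B" "B \<subseteq> L" "independent B" "L \<subseteq> span B"
    using maximal_independent_subset_extend[of C L] C(1) by metis
  have spB: "span B = L" using span_subspace[OF B(2,4) L] .
  have fin: "finite B" using B by (simp add: independent_imp_finite)
  have rep: "representation B (f b) = representation C (f b)" if "b \<in> B" for b
    using B C that by (intro representation_extend) auto
  have "trace_on L f = basis_trace B f" using B spB f fL by (intro trace_on_eq) auto
  also have "\<dots> = (\<Sum>b\<in>B. representation C (f b) b)"
    unfolding basis_trace_def using rep by (intro sum.cong) auto
  also have "\<dots> = (\<Sum>b\<in>C. representation C (f b) b)"
    using fin B by (intro sum.mono_neutral_right) (auto intro: ccontr dest: representation_ne_zero)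
  also have "\<dots> = trace_on (f ` L) f"
    unfolding basis_trace_def[symmetric] using fL by (intro trace_on_eq[OF C f, symmetric]) auto
  finally show ?thesis .
qed

text \<open>Passing to the image keeps the trace and lowers the nilpotency index by one.\<close>

lemma trace_on_nilpotent:
  fixes L :: "'a::euclidean_space set"
  assumes L: "subspace L" and f: "linear f" and fL: "\<And>x. x \<in> L \<Longrightarrow> f x \<in> L"
    and nil: "\<And>x. x \<in> L \<Longrightarrow> (f ^^ n) x = 0"
  shows "trace_on L f = 0"
  using L fL nil
proof (induction n arbitrary: L)
  case 0
  then have "L = {0}" by (auto simp: subspace_0)
  then have "trace_on L f = basis_trace {} f" using f
    by (intro trace_on_eq) (auto simp: independent_empty linear_0)
  then show ?case by (simp add: basis_trace_def)
next
  case (Suc n)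
  have "trace_on (f ` L) f = 0"
  proof (rule Suc.IH)
    show "subspace (f ` L)" using f Suc.prems(1) by (rule linear_subspace_image)
    show "(f ^^ n) x = 0" if "x \<in> f ` L" for x
      using Suc.prems(3) that by (auto simp: funpow_swap1)
  qed (use Suc.prems(2) in auto)
  then show ?case using trace_on_image[OF Suc.prems(1) f Suc.prems(2)] by simp
qed

section \<open>Nilpotent elements of an algebra\<close>

lemma commutator_power:
  fixes A B C :: "'a::real_algebra_1"
  assumes AB: "A * B = B * A + C" and AC: "A * C = C * A"
  shows "A ^ Suc j * B = B * A ^ Suc j + real (Suc j) *\<^sub>R (C * A ^ j)"
proof (induction j)
  case 0
  then show ?case by (simp add: AB)
next
  case (Suc j)
  have "A ^ Suc (Suc j) * B = A * (A ^ Suc j * B)" by (simp add: mult.assoc)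
  also have "\<dots> = (A * B) * A ^ Suc j + real (Suc j) *\<^sub>R ((A * C) * A ^ j)"
    unfolding Suc by (simp add: distrib_left mult.assoc)
  also have "\<dots> = B * A ^ Suc (Suc j) + real (Suc (Suc j)) *\<^sub>R (C * A ^ Suc j)"
    unfolding AB AC by (simp add: algebra_simps scaleR_2)
  finally show ?case .
qed

text \<open>Jacobson's lemma, by lowering the power of A. If A^(j+1) C^r = 0, multiply [A^(j+1), B]
  = (j+1) C A^j by C^r on both sides: the left-hand terms die, and A^j C^(2r+1) = 0 remains, since A
  and C commute.\<close>

lemma commutator_nilpotent:
  fixes A B C :: "'a::real_algebra_1"
  assumes AB: "A * B = B * A + C" and AC: "A * C = C * A" and nil: "A ^ N = 0"
  shows "\<exists>r. C ^ r = 0"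
proof -
  have comm: "A ^ j * C ^ r = C ^ r * A ^ j" for j r
    by (metis AC power_commuting_commutes)
  have "k \<le> N \<Longrightarrow> \<exists>r. A ^ (N - k) * C ^ r = 0" for k
  proof (induction k)
    case 0
    then show ?case using nil by (intro exI[of _ 0]) simp
  next
    case (Suc k)
    then obtain r where r: "A ^ (N - k) * C ^ r = 0" by auto
    define j where "j = N - Suc k"
    have j: "N - k = Suc j" using Suc.prems by (simp add: j_def)
    have r': "A ^ Suc j * C ^ r = 0" using r by (simp only: j)
    then have r'': "C ^ r * A ^ Suc j = 0" by (simp only: comm)
    have "0 = (C ^ r * A ^ Suc j) * (B * C ^ r)" by (simp only: r'' mult_zero_left)
    also have "\<dots> = C ^ r * (A ^ Suc j * B) * C ^ r" by (simp only: mult.assoc)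
    also have "\<dots> = C ^ r * B * (A ^ Suc j * C ^ r) + real (Suc j) *\<^sub>R (C ^ r * C * (A ^ j * C ^ r))"
      unfolding commutator_power[OF AB AC]
      by (simp only: distrib_left distrib_right mult_scaleR_left mult_scaleR_right mult.assoc)
    also have "\<dots> = real (Suc j) *\<^sub>R (C ^ Suc r * (A ^ j * C ^ r))"
      by (simp only: r' mult_zero_right add_0_left) (simp only: power_Suc2 mult.assoc)
    finally have "C ^ Suc r * (A ^ j * C ^ r) = 0" by simp
    moreover have "C ^ Suc r * (A ^ j * C ^ r) = A ^ j * C ^ (Suc r + r)"
      by (simp only: comm[of j "Suc r", symmetric] mult.assoc[symmetric]) (simp only: mult.assoc power_add)
    ultimately show ?case unfolding j_def by metis
  qed
  from this[of N] show ?thesis by auto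
qed

text \<open>The X with A^j X = 0 are filtered by j. If A^(j+1) X = 0, then A^j (A B X) = (j+1) C A^j
  X, and A B X is again killed by A^(j+1). Since C^r = 0 for some r, multiplying r times by A B
  drops one layer.\<close>

lemma mult_nilpotent:
  fixes A B C :: "'a::real_algebra_1"
  assumes AB: "A * B = B * A + C" and AC: "A * C = C * A" and nil: "A ^ N = 0"
  shows "\<exists>m. (A * B) ^ m = 0"
proof -
  define D where "D = A * B"
  obtain r where r: "C ^ r = 0" using commutator_nilpotent[OF assms] by blast
  have "\<exists>m. \<forall>X. A ^ j * X = 0 \<longrightarrow> D ^ m * X = 0" for j
  proof (induction j)
    case 0
    show ?case by (intro exI[of _ 0]) simp
  next
    case (Suc j)
    then obtain m where m: "\<And>X. A ^ j * X = 0 \<Longrightarrow> D ^ m * X = 0" by blast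
    have step: "A ^ j * (D ^ i * X) = real (Suc j) ^ i *\<^sub>R (C ^ i * (A ^ j * X)) \<and> A ^ Suc j * (D ^ i * X) = 0"
      if X: "A ^ Suc j * X = 0" for X i
    proof (induction i)
      case 0
      then show ?case using X by simp
    next
      case (Suc i)
      define Y where "Y = D ^ i * X"
      have Y0: "A ^ Suc j * Y = 0" using Suc by (simp add: Y_def)
      have "A ^ j * (D * Y) = (A ^ Suc j * B) * Y"
        by (simp only: D_def power_Suc2 mult.assoc)
      also have "\<dots> = B * (A ^ Suc j * Y) + real (Suc j) *\<^sub>R (C * (A ^ j * Y))"
        unfolding commutator_power[OF AB AC] by (simp add: algebra_simps del: power_Suc of_nat_Suc)
      finally have 1: "A ^ j * (D * Y) = real (Suc j) *\<^sub>R (C * (A ^ j * Y))"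
        by (simp only: Y0 mult_zero_right add_0_left)
      have "A ^ Suc j * (D * Y) = A * (A ^ j * (D * Y))" by (simp add: mult.assoc)
      also have "\<dots> = real (Suc j) *\<^sub>R ((A * C) * (A ^ j * Y))" unfolding 1 by (simp add: mult.assoc)
      also have "\<dots> = real (Suc j) *\<^sub>R (C * (A ^ Suc j * Y))" by (simp only: AC mult.assoc power_Suc)
      finally have 2: "A ^ Suc j * (D * Y) = 0" by (simp only: Y0 mult_zero_right scaleR_zero_right)
      have D: "D ^ Suc i * X = D * Y" by (simp add: Y_def mult.assoc)
      have "A ^ j * Y = real (Suc j) ^ i *\<^sub>R (C ^ i * (A ^ j * X))" using Suc by (simp add: Y_def)
      then show ?case unfolding D using 1 2 by (simp add: mult.assoc)
    qed
    have "D ^ (m + r) * X = 0" if "A ^ Suc j * X = 0" for X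
    proof -
      have "A ^ j * (D ^ r * X) = 0" using step[OF that, of r] r by simp
      then show ?thesis using m by (simp add: power_add mult.assoc)
    qed
    then show ?case by blast
  qed
  from this[of N] nil show ?thesis unfolding D_def by (metis mult_zero_left mult.right_neutral)
qed

section \<open>Representations of sl2\<close>

lemma power_mult_neutral:
  fixes E H :: "'a::real_algebra_1"
  assumes HE: "H * E = E * H + 2 *\<^sub>R E"
  shows "E ^ k * H = H * E ^ k - (2 * real k) *\<^sub>R E ^ k"
proof (induction k)
  case (Suc k)
  have "E ^ Suc k * H = E * (E ^ k * H)" by (simp add: mult.assoc)
  also have "\<dots> = (E * H) * E ^ k - (2 * real k) *\<^sub>R E ^ Suc k" unfolding Suc by (simp add: algebra_simps)
  also have "E * H = H * E - 2 *\<^sub>R E" by (simp add: HE)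
  finally show ?case by (simp add: algebra_simps)
qed simp

text \<open>Kept apart from the representations below, since the construction of a triple uses it at
  a stage when [H, F] = -2 F is not yet available.\<close>

lemma power_mult_lowering:
  fixes E F H :: "'a::real_algebra_1"
  assumes HE: "H * E = E * H + 2 *\<^sub>R E" and EF: "E * F = F * E + H"
  shows "E ^ Suc k * F = F * E ^ Suc k + real (Suc k) *\<^sub>R (E ^ k * (H + real k *\<^sub>R 1))"
proof (induction k)
  case 0
  then show ?case by (simp add: EF)
next
  case (Suc k)
  have "E ^ Suc (Suc k) * F = E * (E ^ Suc k * F)" by (simp add: mult.assoc)
  also have "\<dots> = (E * F) * E ^ Suc k + real (Suc k) *\<^sub>R (E ^ Suc k * (H + real k *\<^sub>R 1))"
    unfolding Suc by (simp add: distrib_left mult.assoc)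
  also have "\<dots> = F * E ^ Suc (Suc k) + H * E ^ Suc k + real (Suc k) *\<^sub>R (E ^ Suc k * (H + real k *\<^sub>R 1))"
    unfolding EF by (simp add: algebra_simps)
  also have "H * E ^ Suc k = E ^ Suc k * H + (2 * real (Suc k)) *\<^sub>R E ^ Suc k"
    using power_mult_neutral[OF HE, of "Suc k"] by (simp only: diff_add_cancel)
  finally show ?case by (simp add: algebra_simps scaleR_2)
qed

locale sl2_rep =
  fixes H E F :: "'a::euclidean_space endo" and N :: nat
  assumes HE: "H * E = E * H + 2 *\<^sub>R E" and HF: "H * F = F * H - 2 *\<^sub>R F"
    and EF: "E * F = F * E + H" and nil: "E ^ N = 0"
begin

lemmas E_power_H = power_mult_neutral[OF HE]

lemmas E_power_F = power_mult_lowering[OF HE EF]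

lemma E_F_power: "E * F ^ Suc k = F ^ Suc k * E + real (Suc k) *\<^sub>R (F ^ k * (H - real k *\<^sub>R 1))"
proof (induction k)
  case 0
  then show ?case by (simp add: EF)
next
  case (Suc k)
  have "E * F ^ Suc (Suc k) = (E * F ^ Suc k) * F" by (simp only: power_Suc2 mult.assoc)
  also have "\<dots> = F ^ Suc k * (E * F) + real (Suc k) *\<^sub>R (F ^ k * (H * F - real k *\<^sub>R F))"
    unfolding Suc by (simp add: algebra_simps)
  also have "\<dots> = F ^ Suc k * F * E + F ^ Suc k * H + real (Suc k) *\<^sub>R (F ^ k * F * H - (2 + real k) *\<^sub>R (F ^ k * F))"
    unfolding EF HF by (simp add: algebra_simps)
  also have "\<dots> = F ^ Suc (Suc k) * E + real (Suc (Suc k)) *\<^sub>R (F ^ Suc k * (H - real (Suc k) *\<^sub>R 1))"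
  proof -
    have "Z * H + r *\<^sub>R (Z * H - (1 + r) *\<^sub>R Z) = (1 + r) *\<^sub>R (Z * (H - r *\<^sub>R 1))" for Z r
      by (simp add: algebra_simps)
    from this[of "F ^ Suc k" "real (Suc k)"] show ?thesis
      by (simp only: power_Suc2[symmetric] add.assoc) (simp add: add.commute)
  qed
  finally show ?case .
qed

text \<open>A polynomial in H given by the list of its roots; a distinct list means a squarefree
  polynomial.\<close>

definition hprod :: "real list \<Rightarrow> 'a endo" where
  "hprod cs = prod_list (map (\<lambda>c. H - c *\<^sub>R 1) cs)"

lemma hprod_simps [simp]: "hprod [] = 1" "hprod (c # cs) = (H - c *\<^sub>R 1) * hprod cs"
  "hprod (cs @ ds) = hprod cs * hprod ds"
  by (simp_all add: hprod_def)

lemma hprod_eigenvector: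
  assumes "app H x = c *\<^sub>R x" "c \<in> set cs"
  shows "app (hprod cs) x = 0"
proof -
  have ev: "\<exists>r. app (hprod ds) x = r *\<^sub>R x" for ds
  proof (induction ds)
    case Nil
    show ?case by (intro exI[of _ 1]) simp
  next
    case (Cons d ds)
    then obtain r where "app (hprod ds) x = r *\<^sub>R x" by blast
    then have "app (hprod (d # ds)) x = (r * (c - d)) *\<^sub>R x"
      by (simp add: assms(1) linear_cmul[OF linear_app] algebra_simps)
    then show ?case by blast
  qed
  from assms(2) obtain as bs where "cs = as @ c # bs" by (meson split_list)
  moreover obtain r where "app (hprod bs) x = r *\<^sub>R x" using ev by blast
  ultimately show ?thesis
    by (simp add: linear_cmul[OF linear_app] assms(1) linear_0[OF linear_app])
qed

text \<open>The induction hypothesis decomposes (H - c) x into eigenvectors for values d \<noteq> c.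
  On these H - c acts as d - c and can be inverted, which gives x' with (H - c) x' = (H - c) x; the
  difference x - x' is an eigenvector for c.\<close>

lemma eigenvector_decomposition:
  assumes S: "subspace S" "\<And>x. x \<in> S \<Longrightarrow> app H x \<in> S" and cs: "distinct cs"
    and x: "x \<in> S" "app (hprod cs) x = 0"
  shows "x \<in> span {y \<in> S. \<exists>c\<in>set cs. app H y = c *\<^sub>R y}"
  using cs x
proof (induction cs arbitrary: x)
  case Nil
  then show ?case by (simp add: span_zero)
next
  case (Cons c cs)
  let ?V = "\<lambda>cs. {y \<in> S. \<exists>c\<in>set cs. app H y = c *\<^sub>R y}"
  have comm: "H * hprod ds = hprod ds * H" for ds
    by (induction ds) (simp_all add: algebra_simps, metis mult.assoc)
  define y where "y = app H x - c *\<^sub>R x"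
  have "y \<in> S" using Cons.prems S by (simp add: y_def subspace_diff subspace_scale)
  moreover have "(H - c *\<^sub>R 1) * hprod cs = hprod cs * (H - c *\<^sub>R 1)"
    by (simp add: algebra_simps comm)
  then have "app (hprod cs) y = app (hprod (c # cs)) x"
    by (simp only: hprod_simps) (simp add: y_def)
  ultimately have "y \<in> span (?V cs)" using Cons by simp
  then have "\<exists>x'\<in>span (?V cs). app H x' - c *\<^sub>R x' = y"
  proof (induction rule: span_induct_alt)
    case base
    show ?case by (intro bexI[of _ 0]) (simp_all add: linear_0[OF linear_app] span_zero)
  next
    case (step r z w)
    then obtain x' where x': "x' \<in> span (?V cs)" "app H x' - c *\<^sub>R x' = w" by blast
    from step obtain d where d: "d \<in> set cs" "app H z = d *\<^sub>R z" by auto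
    have "d \<noteq> c" using d Cons.prems(1) by auto
    let ?u = "(r / (d - c)) *\<^sub>R z + x'"
    have "?u \<in> span (?V cs)" using x' step(1) by (intro span_add[OF span_scale[OF span_base]]) auto
    moreover have "app H ?u - c *\<^sub>R ?u = r *\<^sub>R z + w"
    proof -
      have "app H ?u - c *\<^sub>R ?u = ((r / (d - c)) * (d - c)) *\<^sub>R z + (app H x' - c *\<^sub>R x')"
        by (simp add: app_linear d algebra_simps diff_divide_distrib)
      then show ?thesis using \<open>d \<noteq> c\<close> x' by simp
    qed
    ultimately show ?case by blast
  qed
  then obtain x' where x': "x' \<in> span (?V cs)" "app H x' - c *\<^sub>R x' = y" by blast
  have "span (?V cs) \<subseteq> S" using S by (intro span_minimal) auto
  then have "x - x' \<in> ?V (c # cs)"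
    using x' Cons.prems S y_def
    by (auto simp: linear_diff[OF linear_app] subspace_diff algebra_simps intro!: bexI[of _ c])
  then have "x - x' \<in> span (?V (c # cs))" by (rule span_base)
  moreover have "x' \<in> span (?V (c # cs))"
    using x'(1) span_mono[of "?V cs" "?V (c # cs)"] by auto
  ultimately show ?case using span_add by fastforce
qed

text \<open>If E^(m+1) z = 0, then E F z is (m+1)(\<mu> + m) z plus a vector w of the same weight
  with E^m w = 0. The factor is positive for \<mu> \<ge> 1, so F z minus a preimage of w, divided by
  the factor, is a preimage of z.\<close>

lemma E_surj_positive:
  assumes "app H z = \<mu> *\<^sub>R z" "1 \<le> \<mu>" "app (E ^ m) z = 0"
  shows "\<exists>y. app H y = (\<mu> - 2) *\<^sub>R y \<and> app E y = z"
  using assms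
proof (induction m arbitrary: z)
  case 0
  then show ?case by (intro exI[of _ 0]) (simp add: linear_0[OF linear_app])
next
  case (Suc m)
  define c where "c = real (Suc m) * (\<mu> + real m)"
  have c: "c > 0" using Suc.prems by (simp add: c_def)
  have HF': "app H (app F z) = (\<mu> - 2) *\<^sub>R app F z"
    using arg_cong[OF HF, of "\<lambda>a. app a z"] Suc.prems(1)
    by (simp add: linear_cmul[OF linear_app] scaleR_diff_left)
  have HE': "app H (app E y) = (\<nu> + 2) *\<^sub>R app E y" if "app H y = \<nu> *\<^sub>R y" for y \<nu>
    using arg_cong[OF HE, of "\<lambda>a. app a y"] that
    by (simp add: linear_cmul[OF linear_app] scaleR_add_left)
  define w where "w = app E (app F z) - c *\<^sub>R z"
  have "app H w = \<mu> *\<^sub>R w"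
    using HE'[OF HF'] Suc.prems(1)
    by (simp add: w_def app_linear algebra_simps)
  moreover have "app (E ^ m) w = 0"
  proof -
    have "app (E ^ m) (app E (app F z)) = app (E ^ Suc m * F) z"
      by (simp only: power_Suc2 app_mult)
    also have "\<dots> = app F (app (E ^ Suc m) z) + real (Suc m) *\<^sub>R app (E ^ m) (app H z + real m *\<^sub>R z)"
      unfolding E_power_F by (simp del: power_Suc of_nat_Suc)
    also have "\<dots> = c *\<^sub>R app (E ^ m) z"
      using Suc.prems by (simp add: c_def app_linear
          del: power_Suc of_nat_Suc flip: scaleR_add_left)
    finally show ?thesis by (simp add: w_def app_linear)
  qed
  ultimately obtain y where y: "app H y = (\<mu> - 2) *\<^sub>R y" "app E y = w"
    using Suc.IH Suc.prems(2) by blast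
  have "app E ((1 / c) *\<^sub>R (app F z - y)) = (1 / c) *\<^sub>R (app E (app F z) - w)"
    using y by (simp add: app_linear)
  also have "\<dots> = z" using c by (simp add: w_def)
  finally have "app E ((1 / c) *\<^sub>R (app F z - y)) = z" .
  moreover have "app H ((1 / c) *\<^sub>R (app F z - y)) = (\<mu> - 2) *\<^sub>R ((1 / c) *\<^sub>R (app F z - y))"
    by (simp only: app_linear y HF' scaleR_diff_right[symmetric])
      (simp only: scaleR_scaleR mult.commute)
  ultimately show ?case by blast
qed

text \<open>On the kernel of E one has E F^(k+1) x = (k+1) F^k (H - k) x, and (H - k) x stays in the
  kernel. Each step thus contributes one factor k+1 and one root k.\<close>

lemma E_power_F_power_kernel:
  assumes "app E x = 0"
  shows "app (E ^ k * F ^ k) x = fact k *\<^sub>R app (hprod (map real [0..<k])) x"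
  using assms
proof (induction k arbitrary: x)
  case (Suc k)
  have comm: "H * hprod ds = hprod ds * H" for ds
    by (induction ds) (simp_all add: algebra_simps, metis mult.assoc)
  define y where "y = app H x - real k *\<^sub>R x"
  have y: "app E y = 0"
    using arg_cong[OF HE, of "\<lambda>a. app a x"] Suc.prems
    by (simp add: y_def app_linear)
  have "app (E ^ Suc k * F ^ Suc k) x = app (E ^ k) (app (E * F ^ Suc k) x)"
    by (simp only: power_Suc2[of E] app_mult)
  also have "\<dots> = real (Suc k) *\<^sub>R app (E ^ k * F ^ k) y"
    unfolding E_F_power using Suc.prems
    by (simp add: y_def app_linear del: power_Suc of_nat_Suc)
  also have "\<dots> = fact (Suc k) *\<^sub>R app (hprod (map real [0..<k])) y"
    using Suc.IH[OF y] by simp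
  also have "app (hprod (map real [0..<k])) y = app (hprod (map real [0..<Suc k])) x"
    by (simp add: y_def)
  finally show ?case .
qed simp

text \<open>On the kernel of E the identity E^k F^k = k! H (H - 1) ... (H - k + 1) provides a squarefree
  annihilating polynomial of H. In the inductive step x is first corrected by a preimage of the part of
  E x of positive weight; what remains is mapped into that kernel by a product of distinct factors H - c
  with c negative.\<close>

lemma kernel_filtration:
  "app (E ^ m) x = 0 \<Longrightarrow>
    x \<in> span {y. app (E ^ m) y = 0 \<and> (\<exists>i::int. - 2 * int m \<le> i \<and> i \<le> int N \<and> app H y = of_int i *\<^sub>R y)}"
proof (induction m arbitrary: x)
  case 0
  then show ?case by (simp add: span_zero)
next
  case (Suc m)
  let ?W = "\<lambda>m. {y. app (E ^ m) y = 0 \<and> (\<exists>i::int. - 2 * int m \<le> i \<and> i \<le> int N \<and> app H y = of_int i *\<^sub>R y)}"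
  \<comment> \<open>The non-positive weights that the induction hypothesis allows in E x; the
    positive ones are removed by the correction y.\<close>
  define cs where "cs = map real_of_int [- 2 * int m..0]"
  let ?K = "{x. app (E ^ Suc m) x = 0}"
  have K: "subspace ?K" by (rule linear_subspace_kernel[OF linear_app])
  have KH: "app H x \<in> ?K" if "x \<in> ?K" for x
    using arg_cong[OF E_power_H[of "Suc m"], of "\<lambda>a. app a x"] that
    by (simp add: linear_0[OF linear_app] del: power_Suc)
  have EK: "app (E ^ m) (app E x) = app (E ^ Suc m) x" for x by (simp only: power_Suc2 app_mult)
  \<comment> \<open>E raises weights by 2, so moving it past a factor H - c shifts the root by
    2.\<close>
  have shift: "E * hprod (map (\<lambda>c. c - 2) ds) = hprod ds * E" for ds
  proof (induction ds)
    case (Cons d ds)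
    have "E * hprod (map (\<lambda>c. c - 2) (d # ds)) = (E * H - (d - 2) *\<^sub>R E) * hprod (map (\<lambda>c. c - 2) ds)"
      by (simp add: algebra_simps)
    also have "E * H - (d - 2) *\<^sub>R E = (H - d *\<^sub>R 1) * E" by (simp add: HE algebra_simps)
    also have "\<dots> * hprod (map (\<lambda>c. c - 2) ds) = hprod (d # ds) * E"
      using Cons by (simp add: mult.assoc)
    finally show ?case .
  qed simp
  have "app E x \<in> span (?W m)" using Suc.prems by (intro Suc.IH) (simp only: EK)
  then have "\<exists>y\<in>span (?W (Suc m)). app (hprod cs) (app E x - app E y) = 0"
  proof (induction rule: span_induct_alt)
    case base
    show ?case by (intro bexI[of _ 0]) (simp_all add: linear_0[OF linear_app] span_zero)
  next
    case (step r u v)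
    then obtain y where y: "y \<in> span (?W (Suc m))" "app (hprod cs) (v - app E y) = 0" by blast
    from step obtain i :: int where i: "- 2 * int m \<le> i" "i \<le> int N" "app H u = of_int i *\<^sub>R u" "app (E ^ m) u = 0" by blast
    show ?case
    proof (cases "1 \<le> i")
      case True
      then obtain z where z: "app H z = (of_int i - 2) *\<^sub>R z" "app E z = u"
        using E_surj_positive[OF i(3) _ i(4)] by auto
      have "z \<in> ?W (Suc m)"
      proof -
        have "app (E ^ Suc m) z = 0" using z i by (simp only: EK[symmetric])
        moreover have "app H z = of_int (i - 2) *\<^sub>R z" using z by simp
        moreover have "- 2 * int (Suc m) \<le> i - 2" "i - 2 \<le> int N" using i by auto
        ultimately show ?thesis by blast
      qed
      then have "r *\<^sub>R z + y \<in> span (?W (Suc m))" using y(1) by (intro span_add[OF span_scale[OF span_base]])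
      moreover have "r *\<^sub>R u + v - app E (r *\<^sub>R z + y) = v - app E y"
        using z by (simp add: app_linear)
      ultimately show ?thesis by (intro bexI[of _ "r *\<^sub>R z + y"]) (simp_all only: y(2))
    next
      case False
      then have "app (hprod cs) u = 0" using i by (intro hprod_eigenvector[OF i(3)]) (auto simp: cs_def)
      then have "app (hprod cs) (r *\<^sub>R u + v - app E y) = 0"
        using y by (simp add: app_linear)
      then show ?thesis using y by blast
    qed
  qed
  then obtain y where y: "y \<in> span (?W (Suc m))" "app (hprod cs) (app E x - app E y) = 0" by blast
  have "span (?W (Suc m)) \<subseteq> ?K" using K by (intro span_minimal) auto
  then have yK: "x - y \<in> ?K" using Suc.prems y K by (intro subspace_diff) auto
  \<comment> \<open>The roots in \<open>bs\<close> are 0, ..., N-1 and those in \<open>ds\<close>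
    are at most -2, so the combined product is still squarefree. N roots suffice because E^N =
    0.\<close>
  define bs where "bs = map real [0..<N]"
  define ds where "ds = map (\<lambda>c. c - 2) cs"
  have "app E (app (hprod ds) (x - y)) = app (hprod cs) (app E (x - y))"
    using arg_cong[OF shift[of cs], of "\<lambda>a. app a (x - y)"] by (simp add: ds_def)
  also have "\<dots> = 0" using y by (simp add: linear_diff[OF linear_app])
  finally have "app (E ^ N * F ^ N) (app (hprod ds) (x - y)) = fact N *\<^sub>R app (hprod bs) (app (hprod ds) (x - y))"
    unfolding bs_def by (rule E_power_F_power_kernel)
  then have "app (hprod (bs @ ds)) (x - y) = 0" by (simp add: nil)
  moreover have "distinct (bs @ ds)"
    by (auto simp: bs_def ds_def cs_def distinct_map inj_on_def)
  ultimately have "x - y \<in> span {z \<in> ?K. \<exists>c\<in>set (bs @ ds). app H z = c *\<^sub>R z}"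
    using yK K KH by (intro eigenvector_decomposition)
  also have "\<dots> \<subseteq> span (?W (Suc m))"
  proof (intro span_mono subsetI)
    fix z assume "z \<in> {z \<in> ?K. \<exists>c\<in>set (bs @ ds). app H z = c *\<^sub>R z}"
    then obtain c where c: "c \<in> set (bs @ ds)" "app H z = c *\<^sub>R z" "app (E ^ Suc m) z = 0" by blast
    from c(1) have "\<exists>i::int. - 2 * int (Suc m) \<le> i \<and> i \<le> int N \<and> c = of_int i"
    proof (cases "c \<in> set bs")
      case True
      then obtain j where "c = real j" "j < N" by (auto simp: bs_def)
      then show ?thesis by (intro exI[of _ "int j"]) auto
    next
      case False
      with c(1) obtain i :: int where "- 2 * int m \<le> i" "i \<le> 0" "c = of_int i - 2"
        by (auto simp: ds_def cs_def)
      then show ?thesis by (intro exI[of _ "i - 2"]) auto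
    qed
    then show "z \<in> ?W (Suc m)" using c by blast
  qed
  finally have "x - y \<in> span (?W (Suc m))" .
  then show ?case using y(1) span_add by fastforce
qed

text \<open>For m = N the kernel of E^m is everything. The subspace S is carried along because E, F
  and H act on all matrices, whereas the decomposition is wanted inside the Lie algebra.\<close>

theorem H_diagonalizable:
  assumes S: "subspace S" "\<And>x. x \<in> S \<Longrightarrow> app H x \<in> S"
  shows "S = span {y \<in> S. \<exists>i::int. - 2 * int N \<le> i \<and> i \<le> int N \<and> app H y = of_int i *\<^sub>R y}"
proof
  define cs where "cs = map real_of_int [- 2 * int N..int N]"
  have "app (hprod cs) x = 0" for x
  proof -
    have "x \<in> span {y. app (E ^ N) y = 0 \<and> (\<exists>i::int. - 2 * int N \<le> i \<and> i \<le> int N \<and> app H y = of_int i *\<^sub>R y)}"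
      by (rule kernel_filtration) (simp add: nil)
    also have "\<dots> \<subseteq> {x. app (hprod cs) x = 0}"
      by (intro span_minimal linear_subspace_kernel[OF linear_app])
        (auto simp: cs_def intro!: hprod_eigenvector)
    finally show ?thesis by simp
  qed
  then have "S \<subseteq> span {y \<in> S. \<exists>c\<in>set cs. app H y = c *\<^sub>R y}"
    using S by (intro subsetI eigenvector_decomposition) (auto simp: cs_def distinct_map inj_on_def)
  also have "\<dots> \<subseteq> span {y \<in> S. \<exists>i::int. - 2 * int N \<le> i \<and> i \<le> int N \<and> app H y = of_int i *\<^sub>R y}"
    by (intro span_mono) (auto simp: cs_def)
  finally show "S \<subseteq> \<dots>" .
qed (use S in \<open>intro span_minimal; auto\<close>)

end

section \<open>Inner products on subspaces\<close>

text \<open>The form is a total function with arbitrary values off S, hence the membership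
  conditions in all the rules.\<close>

locale ip_space =
  fixes S :: "'a::euclidean_space set" and ip :: "'a \<Rightarrow> 'a \<Rightarrow> real"
  assumes subspace_S: "subspace S" and inner_prod: "inner_product_on S ip"
begin

lemma ip_sym: "x \<in> S \<Longrightarrow> y \<in> S \<Longrightarrow> ip x y = ip y x"
  and ip_add_left: "x \<in> S \<Longrightarrow> y \<in> S \<Longrightarrow> z \<in> S \<Longrightarrow> ip (x + y) z = ip x z + ip y z"
  and ip_scale_left: "x \<in> S \<Longrightarrow> y \<in> S \<Longrightarrow> ip (r *\<^sub>R x) y = r * ip x y"
  and ip_pos: "x \<in> S \<Longrightarrow> x \<noteq> 0 \<Longrightarrow> ip x x > 0"
  using inner_prod unfolding inner_product_on_def by blast+

lemma S_closed: "x \<in> S \<Longrightarrow> y \<in> S \<Longrightarrow> x + y \<in> S" "x \<in> S \<Longrightarrow> y \<in> S \<Longrightarrow> x - y \<in> S"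
  "x \<in> S \<Longrightarrow> r *\<^sub>R x \<in> S" "x \<in> S \<Longrightarrow> - x \<in> S" "0 \<in> S"
  using subspace_S by (auto intro: subspace_add subspace_diff subspace_scale subspace_neg subspace_0)

lemma ip_add_right: "x \<in> S \<Longrightarrow> y \<in> S \<Longrightarrow> z \<in> S \<Longrightarrow> ip z (x + y) = ip z x + ip z y"
  by (simp add: ip_sym[of z] S_closed ip_add_left)

lemma ip_scale_right: "x \<in> S \<Longrightarrow> y \<in> S \<Longrightarrow> ip y (r *\<^sub>R x) = r * ip y x"
  by (simp add: ip_sym[of y] S_closed ip_scale_left)

lemma ip_minus_left: "x \<in> S \<Longrightarrow> y \<in> S \<Longrightarrow> ip (- x) y = - ip x y"
  using ip_scale_left[of x y "-1"] by simp

lemma ip_minus_right: "x \<in> S \<Longrightarrow> y \<in> S \<Longrightarrow> ip y (- x) = - ip y x"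
  using ip_scale_right[of x y "-1"] by simp

lemma ip_diff_left: "x \<in> S \<Longrightarrow> y \<in> S \<Longrightarrow> z \<in> S \<Longrightarrow> ip (x - y) z = ip x z - ip y z"
  using ip_add_left[of x "- y" z] by (simp add: ip_minus_left S_closed)

lemma ip_diff_right: "x \<in> S \<Longrightarrow> y \<in> S \<Longrightarrow> z \<in> S \<Longrightarrow> ip z (x - y) = ip z x - ip z y"
  using ip_add_right[of x "- y" z] by (simp add: ip_minus_right S_closed)

lemma ip_zero_left: "x \<in> S \<Longrightarrow> ip 0 x = 0" and ip_zero_right: "x \<in> S \<Longrightarrow> ip x 0 = 0"
  using ip_scale_left[of x x 0] ip_scale_right[of x x 0] by simp_all

lemma ip_nonneg: "x \<in> S \<Longrightarrow> ip x x \<ge> 0"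
  by (cases "x = 0") (auto simp: ip_zero_left S_closed dest: ip_pos)

lemma ip_eq_zero: "x \<in> S \<Longrightarrow> ip x x = 0 \<Longrightarrow> x = 0"
  using ip_pos by fastforce

lemma ip_sum_left:
  "finite A \<Longrightarrow> (\<And>a. a \<in> A \<Longrightarrow> f a \<in> S) \<Longrightarrow> z \<in> S \<Longrightarrow> ip (sum f A) z = (\<Sum>a\<in>A. ip (f a) z)"
  by (induction A rule: finite_induct)
    (simp_all add: ip_zero_left ip_add_left subspace_sum[OF subspace_S])

lemma ip_sum_right:
  "finite A \<Longrightarrow> (\<And>a. a \<in> A \<Longrightarrow> f a \<in> S) \<Longrightarrow> z \<in> S \<Longrightarrow> ip z (sum f A) = (\<Sum>a\<in>A. ip z (f a))"
  by (induction A rule: finite_induct)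
    (simp_all add: ip_zero_right ip_add_right subspace_sum[OF subspace_S])

lemma ip_eqI:
  assumes "x \<in> S" "y \<in> S" "\<And>z. z \<in> S \<Longrightarrow> ip x z = ip y z"
  shows "x = y"
proof -
  have "ip (x - y) (x - y) = 0" using assms by (simp add: ip_diff_left S_closed)
  then show ?thesis using ip_eq_zero[of "x - y"] assms by (simp add: S_closed)
qed

lemma ip_cauchy_schwarz:
  assumes "x \<in> S" "y \<in> S"
  shows "(ip x y)\<^sup>2 \<le> ip x x * ip y y"
proof (cases "y = 0")
  case True
  then show ?thesis using assms by (simp add: ip_zero_right)
next
  case False
  then have y: "ip y y > 0" using assms ip_pos by blast
  define r where "r = ip x y / ip y y"
  have "0 \<le> ip (x - r *\<^sub>R y) (x - r *\<^sub>R y)" using assms by (intro ip_nonneg S_closed)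
  also have "\<dots> = ip x x - 2 * r * ip x y + r\<^sup>2 * ip y y"
    using assms by (simp add: ip_diff_left ip_diff_right ip_scale_left ip_scale_right S_closed
        ip_sym[of y x] power2_eq_square algebra_simps)
  also have "\<dots> = ip x x - (ip x y)\<^sup>2 / ip y y"
    using y by (simp add: r_def power2_eq_square field_simps)
  finally show ?thesis using y by (simp add: field_simps)
qed

definition orthonormal :: "'a set \<Rightarrow> bool" where
  "orthonormal B \<longleftrightarrow> finite B \<and> B \<subseteq> S \<and> (\<forall>b\<in>B. \<forall>c\<in>B. ip b c = (if b = c then 1 else 0))"

lemma orthonormal_residual:
  assumes B: "orthonormal B" and a: "a \<in> S" and z: "z \<in> span B"
  shows "ip (a - (\<Sum>b\<in>B. ip a b *\<^sub>R b)) z = 0"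
proof -
  have fin: "finite B" and BS: "B \<subseteq> S" using B by (auto simp: orthonormal_def)
  let ?u = "a - (\<Sum>b\<in>B. ip a b *\<^sub>R b)"
  have sumS: "(\<Sum>b\<in>B. ip a b *\<^sub>R b) \<in> S" using BS by (intro subspace_sum[OF subspace_S]) (auto intro: S_closed)
  have uS: "?u \<in> S" using a sumS by (rule S_closed)
  have base: "ip ?u c = 0" if c: "c \<in> B" for c
  proof -
    have "ip (\<Sum>b\<in>B. ip a b *\<^sub>R b) c = (\<Sum>b\<in>B. ip (ip a b *\<^sub>R b) c)"
      using fin BS c by (intro ip_sum_left) (auto intro: S_closed)
    also have "\<dots> = (\<Sum>b\<in>B. if b = c then ip a c else 0)"
      using BS c B by (intro sum.cong) (auto simp: ip_scale_left orthonormal_def subset_iff)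
    also have "\<dots> = ip a c" using fin c by simp
    finally show ?thesis using a sumS BS c by (simp add: ip_diff_left subset_iff)
  qed
  have "span B \<subseteq> {z \<in> S. ip ?u z = 0}"
    using BS base uS
    by (intro span_minimal subspaceI) (auto simp: S_closed ip_zero_right ip_add_right ip_scale_right)
  then show ?thesis using z by auto
qed

lemma orthonormal_basis_exists:
  assumes "finite A" "A \<subseteq> S"
  shows "\<exists>B. orthonormal B \<and> span B = span A"
  using assms
proof (induction A rule: finite_induct)
  case empty
  then show ?case by (intro exI[of _ "{}"]) (simp add: orthonormal_def)
next
  case (insert a A)
  then obtain B where B: "orthonormal B" "span B = span A" by auto
  have fin: "finite B" and BS: "B \<subseteq> S" using B by (auto simp: orthonormal_def)
  define y where "y = (\<Sum>b\<in>B. ip a b *\<^sub>R b)"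
  have yB: "y \<in> span B" unfolding y_def by (intro span_sum span_scale span_base)
  have yS: "y \<in> S" using yB span_minimal[OF BS subspace_S] by auto
  have aS: "a \<in> S" using insert.prems by simp
  have orth: "ip (a - y) z = 0" if "z \<in> span B" for z
    unfolding y_def using orthonormal_residual[OF B(1) aS that] .
  show ?case
  proof (cases "a = y")
    case True
    then have "span (insert a A) = span A" using yB B(2) by (intro span_redundant) simp
    then show ?thesis using B by auto
  next
    case False
    define s where "s = sqrt (ip (a - y) (a - y))"
    have pos: "ip (a - y) (a - y) > 0" using False aS yS by (intro ip_pos S_closed) auto
    then have s: "s > 0" "s * s = ip (a - y) (a - y)" by (auto simp: s_def)
    define u where "u = (1 / s) *\<^sub>R (a - y)"
    have uS: "u \<in> S" using aS yS by (simp add: u_def S_closed)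
    have uz: "ip u z = 0" if "z \<in> span B" for z
      using orth[OF that] that span_minimal[OF BS subspace_S] aS yS
      by (auto simp: u_def ip_scale_left S_closed)
    have uu: "ip u u = 1"
    proof -
      have "ip u u = (1 / s) * ((1 / s) * ip (a - y) (a - y))"
        using S_closed(2)[OF aS yS] by (simp only: u_def ip_scale_left ip_scale_right S_closed)
      then show ?thesis using s pos by (simp add: field_simps)
    qed
    have "orthonormal (insert u B)"
    proof -
      have uB: "ip u b = 0" "ip b u = 0" "b \<noteq> u" if "b \<in> B" for b
      proof -
        show "ip u b = 0" using uz[OF span_base[OF that]] .
        then show "ip b u = 0" using that BS uS ip_sym[of b u] by (simp add: subset_iff)
        show "b \<noteq> u" using \<open>ip u b = 0\<close> uu by auto
      qed
      show ?thesis
        unfolding orthonormal_def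
      proof (intro conjI ballI)
        show "finite (insert u B)" "insert u B \<subseteq> S" using fin uS BS by simp_all
        fix b c assume "b \<in> insert u B" "c \<in> insert u B"
        then consider "b = u" "c = u" | "b = u" "c \<in> B" | "b \<in> B" "c = u" | "b \<in> B" "c \<in> B" by blast
        then show "ip b c = (if b = c then 1 else 0)"
        proof cases
          case 4
          then show ?thesis using B(1) unfolding orthonormal_def by blast
        qed (use uu uB in \<open>auto dest: sym\<close>)
      qed
    qed
    moreover have "span (insert u B) = span (insert a A)"
    proof -
      have "a \<in> span (insert u B)"
      proof -
        have "a = s *\<^sub>R u + y" using s by (simp add: u_def)
        moreover have "y \<in> span (insert u B)" using yB span_mono[of B "insert u B"] by auto
        ultimately show ?thesis by (metis insertI1 span_add span_base span_scale)
      qed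
      moreover have "u \<in> span (insert a B)"
      proof -
        have "y \<in> span (insert a B)" using yB span_mono[of B "insert a B"] by auto
        then show ?thesis unfolding u_def by (intro span_scale span_diff) (auto intro: span_base)
      qed
      ultimately have "span (insert u B) = span (insert a B)"
        by (intro subset_antisym span_minimal) (auto intro: span_base)
      also have "\<dots> = span (insert a A)"
        using B(2) by (simp add: span_insert)
      finally show ?thesis .
    qed
    ultimately show ?thesis by blast
  qed
qed

lemma orthonormal_basis_subspace:
  assumes "subspace W" "W \<subseteq> S"
  obtains B where "orthonormal B" "span B = W"
proof -
  obtain A where "independent A" "span A = W" "finite A" using subspace_basis[OF assms(1)] .
  moreover have "A \<subseteq> S" using \<open>span A = W\<close> span_superset[of A] assms by auto
  ultimately show ?thesis using orthonormal_basis_exists[of A] that by auto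
qed

lemma projection:
  assumes "subspace W" "W \<subseteq> S" "x \<in> S"
  shows "\<exists>y\<in>W. \<forall>z\<in>W. ip (x - y) z = 0"
proof -
  obtain B where B: "orthonormal B" "span B = W"
    using orthonormal_basis_subspace[OF assms(1,2)] .
  have "(\<Sum>b\<in>B. ip x b *\<^sub>R b) \<in> W"
    unfolding B(2)[symmetric] by (intro span_sum span_scale span_base)
  then show ?thesis using orthonormal_residual[OF B(1) assms(3)] B(2) by blast
qed

text \<open>Composing both arguments with a projection onto S gives a bilinear form on the whole
  space, to which the rules for continuity and differentiation apply.\<close>

lemma bounded_bilinear_extension:
  "\<exists>b. bounded_bilinear b \<and> (\<forall>x\<in>S. \<forall>y\<in>S. b x y = ip x y)"
proof -
  obtain p where p: "linear p" "\<And>x. p x \<in> S" "\<And>x. x \<in> S \<Longrightarrow> p x = x"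
    using linear_exists_left_inverse_on[of "\<lambda>x. x" S] subspace_S by (auto simp: linear_id[unfolded id_def] image_subset_iff)
  have "bilinear (\<lambda>x y. ip (p x) (p y))"
    unfolding bilinear_def
    by (auto intro!: linearI simp: linear_add[OF p(1)] linear_cmul[OF p(1)] ip_add_left ip_add_right
        ip_scale_left ip_scale_right p(2))
  then have "bounded_bilinear (\<lambda>x y. ip (p x) (p y))" by (simp add: bilinear_conv_bounded_bilinear)
  then show ?thesis using p(3) by auto
qed

lemma continuous_on_ip:
  assumes "continuous_on T f" "continuous_on T g" "\<And>t. t \<in> T \<Longrightarrow> f t \<in> S" "\<And>t. t \<in> T \<Longrightarrow> g t \<in> S"
  shows "continuous_on T (\<lambda>t. ip (f t) (g t))"
proof -
  obtain b where b: "bounded_bilinear b" "\<And>x y. x \<in> S \<Longrightarrow> y \<in> S \<Longrightarrow> b x y = ip x y"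
    using bounded_bilinear_extension by blast
  have "continuous_on T (\<lambda>t. b (f t) (g t))"
    by (rule bounded_bilinear.continuous_on[OF b(1) assms(1,2)])
  then show ?thesis by (rule continuous_on_eq) (use assms b in auto)
qed

text \<open>The constant is the minimum of the form on the compact unit sphere of S; if S = {0},
  there are no unit vectors and the constant 1 serves.\<close>

lemma ip_coercive: "\<exists>c>0. \<forall>x\<in>S. c * (norm x)\<^sup>2 \<le> ip x x"
proof -
  let ?T = "S \<inter> sphere 0 1"
  have comp: "compact ?T" using closed_subspace[OF subspace_S] by (intro closed_Int_compact) auto
  have cont: "continuous_on ?T (\<lambda>x. ip x x)"
    by (intro continuous_on_ip continuous_intros) auto
  show ?thesis
  proof (cases "?T = {}")
    case True
    have "x = 0" if "x \<in> S" for x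
    proof (rule ccontr)
      assume "x \<noteq> 0"
      then have "(1 / norm x) *\<^sub>R x \<in> ?T" using that by (simp add: S_closed)
      then show False using True by blast
    qed
    then have "\<forall>x\<in>S. 1 * (norm x)\<^sup>2 \<le> ip x x"
      using ip_nonneg by (metis mult_1 norm_zero zero_power2)
    then show ?thesis using zero_less_one by blast
  next
    case False
    obtain m where m: "m \<in> ?T" "\<And>x. x \<in> ?T \<Longrightarrow> ip m m \<le> ip x x"
      using continuous_attains_inf[OF comp False cont] by blast
    have "ip m m > 0" using m(1) by (intro ip_pos) auto
    moreover have "ip m m * (norm x)\<^sup>2 \<le> ip x x" if "x \<in> S" for x
    proof (cases "x = 0")
      case True
      then show ?thesis by (simp add: ip_zero_left S_closed)
    next
      case False
      have "ip m m \<le> ip ((1 / norm x) *\<^sub>R x) ((1 / norm x) *\<^sub>R x)"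
        using False that by (intro m(2)) (simp add: S_closed)
      also have "\<dots> = ip x x / (norm x)\<^sup>2"
        using that by (simp add: ip_scale_left ip_scale_right S_closed power2_eq_square)
      finally show ?thesis using False by (simp add: field_simps)
    qed
    ultimately show ?thesis by blast
  qed
qed

end

section \<open>The Killing form and Jacobson--Morozov triples\<close>

lemma bracket_add_left: "bracket (X + Y) Z = bracket X Z + bracket Y (Z :: 'k::rcfield^'n^'n)"
  and bracket_add_right: "bracket Z (X + Y) = bracket Z X + bracket Z (Y :: 'k^'n^'n)"
  and bracket_scale_left: "bracket (r *\<^sub>R X) Z = r *\<^sub>R bracket X (Z :: 'k^'n^'n)"
  and bracket_scale_right: "bracket X (r *\<^sub>R Z) = r *\<^sub>R bracket X (Z :: 'k^'n^'n)"
  and bracket_minus_left: "bracket (- X) Z = - bracket X (Z :: 'k^'n^'n)"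
  and bracket_minus_right: "bracket X (- Z) = - bracket X (Z :: 'k^'n^'n)"
  and bracket_diff_left: "bracket (X - Y) Z = bracket X Z - bracket Y (Z :: 'k^'n^'n)"
  and bracket_diff_right: "bracket Z (X - Y) = bracket Z X - bracket Z (Y :: 'k^'n^'n)"
  and bracket_zero_left [simp]: "bracket 0 Z = (0 :: 'k^'n^'n)"
  and bracket_zero_right [simp]: "bracket Z 0 = (0 :: 'k^'n^'n)"
  and bracket_self [simp]: "bracket X X = (0 :: 'k^'n^'n)"
proof -
  show r: "bracket Z (X + Y) = bracket Z X + bracket Z Y" "bracket X (r *\<^sub>R Z) = r *\<^sub>R bracket X Z"
    "bracket X (- Z) = - bracket X Z" "bracket Z (X - Y) = bracket Z X - bracket Z Y" "bracket Z 0 = 0" for X Y Z :: "'k^'n^'n" and r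
    using linear_app[of "ad Z"] linear_app[of "ad X"]
    by (simp_all only: app_ad[symmetric] linear_add linear_cmul linear_neg linear_diff linear_0)
  have s: "bracket X Y = - bracket Y X" for X Y :: "'k^'n^'n" by (simp add: bracket_def)
  show "bracket (X + Y) Z = bracket X Z + bracket Y Z" "bracket (r *\<^sub>R X) Z = r *\<^sub>R bracket X Z"
    "bracket (- X) Z = - bracket X Z" "bracket (X - Y) Z = bracket X Z - bracket Y Z" "bracket 0 Z = 0"
    unfolding s[of _ Z] by (simp_all add: r)
  show "bracket X X = 0" by (simp add: bracket_def)
qed

lemma bracket_skew: "bracket X Y = - bracket Y (X :: 'k::rcfield^'n^'n)"
  by (simp add: bracket_def)

lemma jacobi: "bracket (bracket X Y) Z = bracket X (bracket Y Z) - bracket Y (bracket X (Z :: 'k::rcfield^'n^'n))"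
  by (simp add: bracket_def matrix_diff_ldistrib matrix_diff_rdistrib matrix_mul_assoc)

lemma ad_bracket: "ad (bracket X Y) = ad X * ad Y - ad Y * ad X"
  by (rule endo_eqI) (simp add: jacobi)

lemma linear_bracket: "linear (bracket (X :: 'k::rcfield^'n^'n))"
  by (rule linearI) (simp_all add: bracket_add_right bracket_scale_right)

text \<open>Fredholm alternative. The component u of e orthogonal to the range satisfies |f' u|^2 =
  <f (f' u), u> = 0, so f' u = 0. Then e is orthogonal to u by assumption, and u = 0.\<close>

lemma endo_range_iff_adjoint:
  assumes "ip_space S ip" and f: "linear f" "\<And>x. x \<in> S \<Longrightarrow> f x \<in> S"
    and adj: "\<And>x y. x \<in> S \<Longrightarrow> y \<in> S \<Longrightarrow> ip (f x) y = ip x (f' y)"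
    and f': "\<And>x. x \<in> S \<Longrightarrow> f' x \<in> S"
    and e: "e \<in> S" "\<And>z. z \<in> S \<Longrightarrow> f' z = 0 \<Longrightarrow> ip e z = 0"
  shows "\<exists>x\<in>S. f x = e"
proof -
  interpret ip_space S ip by fact
  have W: "subspace (f ` S)" using f(1) subspace_S by (rule linear_subspace_image)
  have WS: "f ` S \<subseteq> S" using f(2) by auto
  obtain y where y: "y \<in> f ` S" "\<And>z. z \<in> f ` S \<Longrightarrow> ip (e - y) z = 0"
    using projection[OF W WS e(1)] by blast
  let ?u = "e - y"
  have uS: "?u \<in> S" using y(1) WS e(1) by (intro S_closed) auto
  have "ip (f' ?u) (f' ?u) = ip (f (f' ?u)) ?u" using adj[of "f' ?u" ?u] uS f' by simp
  also have "\<dots> = ip ?u (f (f' ?u))" using uS f f' by (intro ip_sym) auto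
  also have "\<dots> = 0" using f'[OF uS] by (intro y(2)) auto
  finally have "f' ?u = 0" using ip_eq_zero f'[OF uS] by blast
  then have "ip e ?u = 0" using e(2) uS by blast
  moreover have "ip ?u y = 0" using y by blast
  moreover have "ip ?u ?u = ip e ?u - ip y ?u"
    using uS y(1) WS e(1) by (intro ip_diff_left) auto
  ultimately have "ip ?u ?u = 0" using uS y(1) WS by (simp add: ip_sym subset_iff)
  then have "e = y" using ip_eq_zero[OF uS] by simp
  then show ?thesis using y(1) by auto
qed

section \<open>Killing form, Cartan involution and sl2-triples\<close>

locale cartan_group = group_involution +
  assumes killing_neg: "X \<in> lie_algebra G \<Longrightarrow> X \<noteq> 0 \<Longrightarrow>
    killing_form (lie_algebra G) X (differential \<theta> X) < 0"
begin

abbreviation "K \<equiv> killing_form \<gg>"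

definition star :: "'a^'b^'b \<Rightarrow> 'a^'b^'b" where "star X = - sig X"

text \<open>The usual form -K(\<theta> X, Y): the invariance of K makes ad (star X) the adjoint of
  ad X, and positivity is the Cartan condition.\<close>

definition bt :: "'a^'b^'b \<Rightarrow> 'a^'b^'b \<Rightarrow> real" where "bt X Y = K (star X) Y"

lemmas lie_closed = lie_add lie_scaleR subspace_diff[OF subspace_lie] subspace_neg[OF subspace_lie]
  subspace_0[OF subspace_lie] bracket_in_lie

lemma star_in_lie: "star X \<in> \<gg>"
  by (simp add: star_def sig_in_lie lie_closed)

lemma linear_star: "linear star"
  unfolding star_def by (rule linear_compose_neg[OF linear_sig])

lemma star_star: "X \<in> \<gg> \<Longrightarrow> star (star X) = X"
  by (simp add: star_def linear_neg[OF linear_sig] sig_sig)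

lemma star_bracket: "X \<in> \<gg> \<Longrightarrow> Y \<in> \<gg> \<Longrightarrow> star (bracket X Y) = bracket (star Y) (star X)"
  by (simp add: star_def sig_bracket bracket_minus_left bracket_minus_right) (rule bracket_skew[symmetric])

lemma star_decomposition:
  assumes "X \<in> \<gg>"
  obtains a b where "a \<in> \<gg>" "star a = a" "b \<in> \<gg>" "star b = - b" "X = a + b" "star X = a - b"
proof
  show "X = (1/2) *\<^sub>R (X + star X) + (1/2) *\<^sub>R (X - star X)"
    "star X = (1/2) *\<^sub>R (X + star X) - (1/2) *\<^sub>R (X - star X)"
    by (simp_all add: scaleR_add_right scaleR_diff_right flip: scaleR_add_left)
qed (use assms in \<open>simp_all add: lie_closed star_in_lie linear_cmul[OF linear_star] linear_add[OF linear_star]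
    linear_diff[OF linear_star] star_star add.commute scaleR_diff_right\<close>)

lemma killing_eq: "K X Y = trace_on \<gg> (\<lambda>Z. bracket X (bracket Y Z))"
  by (simp add: killing_form_def)

lemma linear_bracket2: "linear (\<lambda>Z. bracket X (bracket Y (Z :: 'a^'b^'b)))"
  using linear_compose[OF linear_bracket linear_bracket] by (simp add: o_def)

lemma killing_sym: "X \<in> \<gg> \<Longrightarrow> Y \<in> \<gg> \<Longrightarrow> K X Y = K Y X"
  unfolding killing_eq
  by (intro trace_on_cyclic subspace_lie linear_bracket bracket_in_lie)

lemma killing_add_left: "X \<in> \<gg> \<Longrightarrow> Y \<in> \<gg> \<Longrightarrow> Z \<in> \<gg> \<Longrightarrow> K (X + Y) Z = K X Z + K Y Z"
  unfolding killing_eq bracket_add_left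
  by (intro trace_on_add subspace_lie linear_bracket2 bracket_in_lie)

lemma killing_scale_left: "X \<in> \<gg> \<Longrightarrow> Y \<in> \<gg> \<Longrightarrow> K (r *\<^sub>R X) Y = r * K X Y"
  unfolding killing_eq bracket_scale_left
  by (intro trace_on_scaleR subspace_lie linear_bracket2 bracket_in_lie)

text \<open>Both sides are differences of traces of triple products of \<open>ad\<close>; one term
  is common, the other is moved by cyclicity.\<close>

lemma killing_bracket:
  assumes "X \<in> \<gg>" "Y \<in> \<gg>" "Z \<in> \<gg>"
  shows "K (bracket X Y) Z = K X (bracket Y Z)"
proof -
  define T where "T = (\<lambda>X Y Z. trace_on \<gg> (\<lambda>W. bracket X (bracket Y (bracket Z W))))"
  have lin: "linear (\<lambda>W. bracket X (bracket Y (bracket Z W)))" for X Y Z :: "'a^'b^'b"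
    using linear_compose[OF linear_bracket2 linear_bracket] by (simp add: o_def)
  have diff: "trace_on \<gg> (\<lambda>W. f W - g W) = trace_on \<gg> f - trace_on \<gg> g"
    if "linear f" "linear g" "\<And>W. W \<in> \<gg> \<Longrightarrow> f W \<in> \<gg>" "\<And>W. W \<in> \<gg> \<Longrightarrow> g W \<in> \<gg>" for f g
    using trace_on_add[OF subspace_lie that(1) linear_compose_scale_right[OF that(2), of "-1"]]
      trace_on_scaleR[OF subspace_lie that(2,4), of "-1"] that by (simp add: lie_closed)
  have "K (bracket X Y) Z = T X Y Z - T Y X Z"
    unfolding killing_eq T_def jacobi using assms by (intro diff lin) (simp_all add: lie_closed)
  also have "T Y X Z = T X Z Y"
    unfolding T_def using assms
    by (intro trace_on_cyclic[of \<gg> "bracket Y"] subspace_lie linear_bracket linear_bracket2 bracket_in_lie)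
  also have "T X Y Z - T X Z Y = K X (bracket Y Z)"
    unfolding killing_eq T_def jacobi bracket_diff_right using assms
    by (intro diff[symmetric] lin) (simp_all add: lie_closed)
  finally show ?thesis .
qed

text \<open>The automorphism \<open>sig\<close> conjugates ad X into ad (sig X), and cyclicity of
  the trace removes the conjugation.\<close>

lemma killing_sig:
  assumes "X \<in> \<gg>" "Y \<in> \<gg>"
  shows "K (sig X) (sig Y) = K X Y"
proof -
  have "K (sig X) (sig Y) = trace_on \<gg> (\<lambda>Z. sig (bracket X (bracket Y (sig Z))))"
    unfolding killing_eq using assms
    by (intro trace_on_cong subspace_lie) (simp add: sig_bracket sig_sig sig_in_lie bracket_in_lie)
  also have "\<dots> = trace_on \<gg> (\<lambda>Z. bracket X (bracket Y (sig (sig Z))))"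
    using assms linear_compose[OF linear_sig linear_bracket2]
    by (intro trace_on_cyclic[of \<gg> sig] subspace_lie linear_sig) (simp_all add: o_def sig_in_lie bracket_in_lie)
  also have "\<dots> = K X Y"
    unfolding killing_eq by (intro trace_on_cong subspace_lie) (simp add: sig_sig)
  finally show ?thesis .
qed

lemma bt_adjoint:
  assumes "X \<in> \<gg>" "Y \<in> \<gg>" "Z \<in> \<gg>"
  shows "bt (bracket X Y) Z = bt Y (bracket (star X) Z)"
  using assms by (simp add: bt_def star_bracket killing_bracket star_in_lie)

sublocale bt: ip_space \<gg> bt
proof
  show "subspace \<gg>" by (rule subspace_lie)
  have sym: "bt X Y = bt Y X" if "X \<in> \<gg>" "Y \<in> \<gg>" for X Y
  proof -
    have "K (sig X) Y = K (sig X) (sig (sig Y))" using that by (simp add: sig_sig)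
    also have "\<dots> = K X (sig Y)" using that by (simp add: killing_sig sig_in_lie)
    also have "\<dots> = K (sig Y) X" using that by (simp add: killing_sym sig_in_lie)
    finally show ?thesis
      using that killing_scale_left[of "sig X" Y "-1"] killing_scale_left[of "sig Y" X "-1"]
      by (simp add: bt_def star_def sig_in_lie)
  qed
  show "inner_product_on \<gg> bt"
    unfolding inner_product_on_def
  proof (intro conjI ballI allI impI)
    fix X assume X: "X \<in> \<gg>" "X \<noteq> 0"
    have "K (sig X) X < 0"
      using killing_neg[OF X] X(1) by (simp add: sig_eq killing_sym differential_in_lie)
    then show "bt X X > 0"
      using X killing_scale_left[of "sig X" X "-1"] by (simp add: bt_def star_def sig_in_lie)
  qed (simp_all add: sym, simp_all add: bt_def linear_add[OF linear_star] linear_cmul[OF linear_star]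
      killing_add_left killing_scale_left star_in_lie)
qed

text \<open>The commutator ad [e, z] of ad e and ad z commutes with ad e; hence the product ad e ad
  z is nilpotent and its trace vanishes.\<close>

lemma killing_nilpotent_orthogonal:
  assumes e: "e \<in> \<gg>" and nil: "ad e ^ N = 0" and z: "z \<in> \<gg>" and ez: "bracket e (bracket e z) = 0"
  shows "K e z = 0"
proof -
  have "ad e * ad z = ad z * ad e + ad (bracket e z)" by (simp add: ad_bracket)
  moreover have "ad e * ad (bracket e z) - ad (bracket e z) * ad e = 0"
    unfolding ad_bracket[symmetric] ez by (rule endo_eqI) simp
  ultimately obtain m where m: "(ad e * ad z) ^ m = 0"
    using mult_nilpotent[of "ad e" "ad z" "ad (bracket e z)" N] nil by auto
  have app: "app (ad e * ad z) = (\<lambda>Z. bracket e (bracket z Z))" by (simp add: fun_eq_iff)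
  have "((\<lambda>Z. bracket e (bracket z Z)) ^^ m) x = 0" for x
    using arg_cong[OF m, of "\<lambda>a. app a x"] by (simp add: app_power app)
  then show ?thesis
    unfolding killing_eq using e z
    by (intro trace_on_nilpotent subspace_lie linear_bracket2 bracket_in_lie)
qed

text \<open>By the range criterion e must be orthogonal to the kernel of (ad (star e))^2, the
  adjoint of (ad e)^2. The map \<open>star\<close> carries this kernel to that of (ad e)^2, which is
  K-orthogonal to e.\<close>

lemma exists_square_preimage:
  assumes e: "e \<in> \<gg>" and nil: "ad e ^ N = 0"
  shows "\<exists>f\<in>\<gg>. bracket e (bracket e f) = e"
proof (rule endo_range_iff_adjoint[OF bt.ip_space_axioms])
  show "linear (\<lambda>f. bracket e (bracket e f))" by (rule linear_bracket2)
  show "bracket e (bracket e x) \<in> \<gg>" if "x \<in> \<gg>" for x using e that by (simp add: lie_closed)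
  show "bt (bracket e (bracket e x)) y = bt x (bracket (star e) (bracket (star e) y))"
    if "x \<in> \<gg>" "y \<in> \<gg>" for x y using e that by (simp add: bt_adjoint lie_closed star_in_lie)
  show "bracket (star e) (bracket (star e) x) \<in> \<gg>" if "x \<in> \<gg>" for x
    using that by (simp add: lie_closed star_in_lie)
  show "bt e z = 0" if z: "z \<in> \<gg>" and ez: "bracket (star e) (bracket (star e) z) = 0" for z
  proof -
    have "bracket e (bracket e (star z)) = star (bracket (star e) (bracket (star e) z))"
      using e z by (simp add: star_bracket star_star star_in_lie lie_closed bracket_minus_right)
        (metis bracket_minus_left bracket_minus_right bracket_skew)
    then have "K e (star z) = 0"
      using e nil star_in_lie by (intro killing_nilpotent_orthogonal) (simp_all add: ez linear_0[OF linear_star])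
    then show ?thesis
      using e z by (simp add: bt.ip_sym[of e z]) (simp add: bt_def killing_sym star_in_lie)
  qed
qed (rule e)

definition triple :: "'a^'b^'b \<Rightarrow> 'a^'b^'b \<Rightarrow> 'a^'b^'b \<Rightarrow> bool" where
  "triple h e f \<longleftrightarrow> h \<in> \<gg> \<and> e \<in> \<gg> \<and> f \<in> \<gg> \<and>
     bracket h e = 2 *\<^sub>R e \<and> bracket h f = - 2 *\<^sub>R f \<and> bracket e f = h"

theorem jacobson_morozov:
  assumes e: "e \<in> \<gg>" and nil: "ad e ^ N = 0"
  shows "\<exists>h f. triple h e f"
proof -
  obtain f0 where f0: "f0 \<in> \<gg>" "bracket e (bracket e f0) = e"
    using exists_square_preimage[OF assms] by blast
  \<comment> \<open>The factor -2 normalises h = [e, f1] to [h, e] = 2 e. Of the three relations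
    only [h, f] = -2 f is still missing.\<close>
  define f1 where "f1 = - 2 *\<^sub>R f0"
  define h where "h = bracket e f1"
  have f1: "f1 \<in> \<gg>" using f0 by (simp add: f1_def lie_closed)
  have h: "h \<in> \<gg>" using e f1 by (simp add: h_def lie_closed)
  have "bracket e h = - 2 *\<^sub>R e"
    using f0(2) by (simp add: h_def f1_def bracket_minus_right bracket_scale_right)
  then have he: "bracket h e = 2 *\<^sub>R e" using bracket_skew[of h e] by simp
  define E F H where "E = ad e" and "F = ad f1" and "H = ad h"
  have HE: "H * E = E * H + 2 *\<^sub>R E"
    using ad_bracket[of h e] by (simp add: he ad_scaleR E_def H_def)
  have EF: "E * F = F * E + H"
    using ad_bracket[of e f1] by (simp add: E_def F_def H_def h_def)
  define W where "W = {z \<in> \<gg>. bracket e z = 0}"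
  have W: "subspace W"
    using subspace_lie by (auto simp: W_def subspace_def bracket_add_right bracket_scale_right)
  let ?T = "\<lambda>z. bracket h z + 2 *\<^sub>R z"
  have lin: "linear ?T"
    by (rule linearI) (simp_all add: bracket_add_right bracket_scale_right scaleR_add_right)
  have TW: "?T z \<in> W" if "z \<in> W" for z
  proof -
    have "bracket e (bracket h z) = bracket (bracket e h) z + bracket h (bracket e z)"
      by (simp add: jacobi)
    then show ?thesis using that h e \<open>bracket e h = - 2 *\<^sub>R e\<close>
      by (simp add: W_def lie_closed bracket_add_right bracket_scale_right bracket_minus_left bracket_scale_left)
  qed
  \<comment> \<open>On the centraliser of e, -2 is not an eigenvalue of ad h: an eigenvector z would
    lie in the range of E^k for every k, by the lowering identity, while E^N = 0.\<close>
  have inj: "z = 0" if z: "z \<in> W" "?T z = 0" for z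
  proof -
    have ez: "app E z = 0" using z by (simp add: W_def E_def)
    have hz: "app H z = - 2 *\<^sub>R z" using z by (simp add: H_def eq_neg_iff_add_eq_0)
    have comm: "E ^ Suc k * F = F * E ^ Suc k + real (Suc k) *\<^sub>R ((H - real k *\<^sub>R 1) * E ^ k)" for k
    proof -
      have "E ^ k * (H + real k *\<^sub>R 1) = (H - real k *\<^sub>R 1) * E ^ k"
        using power_mult_neutral[OF HE, of k] by (simp add: algebra_simps flip: scaleR_add_left)
      then show ?thesis by (simp only: power_mult_lowering[OF HE EF])
    qed
    have "\<exists>y. z = app (E ^ k) y" for k
    proof (induction k)
      case 0
      then show ?case by (intro exI[of _ z]) simp
    next
      case (Suc k)
      then obtain y where y: "z = app (E ^ k) y" by blast
      \<comment> \<open>Up to sign, the factor produced by k+1 and (H - k) z = -(2 + k) z; being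
        nonzero, it can be divided out.\<close>
      define c where "c = real (Suc k) * (2 + real k)"
      have "app (E ^ Suc k) y = 0" using ez y by simp
      then have "app (E ^ Suc k * F) y = real (Suc k) *\<^sub>R (app H z - real k *\<^sub>R z)"
        unfolding comm by (simp add: linear_0[OF linear_app] del: power_Suc of_nat_Suc flip: y)
      also have "\<dots> = (- (real (Suc k) * (2 + real k))) *\<^sub>R z"
      proof -
        have "app H z - real k *\<^sub>R z = (- 2 - real k) *\<^sub>R z" by (simp only: hz scaleR_diff_left)
        moreover have "real (Suc k) * (- 2 - real k) = - (real (Suc k) * (2 + real k))" by (simp add: algebra_simps)
        ultimately show ?thesis by (simp only: scaleR_scaleR)
      qed
      finally have eq: "app (E ^ Suc k) (app F y) = (- c) *\<^sub>R z" by (simp only: app_mult c_def)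
      have "c > 0" by (simp add: c_def add_pos_nonneg)
      then have "app (E ^ Suc k) ((- 1 / c) *\<^sub>R app F y) = z"
        by (simp only: linear_cmul[OF linear_app] eq scaleR_scaleR) simp
      then have "z = app (E ^ Suc k) ((- 1 / c) *\<^sub>R app F y)" by (rule sym)
      then show ?case by blast
    qed
    from this[of N] show "z = 0" using nil by (auto simp: E_def)
  qed
  have "?T ` W \<subseteq> W" using TW by auto
  moreover have "dim (?T ` W) = dim W"
    using W inj lin by (intro dim_image_eq) (auto simp: linear_injective_on_subspace_0 span_eq_iff[THEN iffD2])
  ultimately have surj: "?T ` W = W"
    by (intro subspace_dim_equal linear_subspace_image[OF lin W] W) simp_all
  \<comment> \<open>The defect of f1 in the last relation centralises e. Subtracting its preimage g
    under ad h + 2, also in the centraliser, repairs the relation without changing [e, f1] =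
    h.\<close>
  have "bracket h f1 + 2 *\<^sub>R f1 \<in> W"
  proof -
    have "bracket e (bracket h f1) = bracket (bracket e h) f1 + bracket h (bracket e f1)"
      by (simp add: jacobi)
    also have "\<dots> = - 2 *\<^sub>R h"
      using \<open>bracket e h = - 2 *\<^sub>R e\<close> by (simp add: h_def bracket_scale_left bracket_minus_left)
    finally show ?thesis
      using h f1 by (simp add: W_def lie_closed bracket_add_right bracket_scale_right h_def)
  qed
  then have "bracket h f1 + 2 *\<^sub>R f1 \<in> ?T ` W" by (simp only: surj)
  then obtain g where g': "bracket h f1 + 2 *\<^sub>R f1 = ?T g" and g: "g \<in> W" by (rule imageE)
  have "bracket h (f1 - g) = - 2 *\<^sub>R (f1 - g)"
    using g' by (simp add: bracket_diff_right algebra_simps)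
  then have "triple h e (f1 - g)"
    unfolding triple_def
    using h e f1 g he by (simp add: W_def lie_closed bracket_diff_right flip: h_def)
  then show ?thesis by blast
qed

end

section \<open>Conjugating the neutral element into p\<close>

text \<open>All terms of the exponential series of degree at least 2 lie in W, and W is
  closed.\<close>

lemma exp_mod_subspace:
  fixes D :: "'a::euclidean_space endo"
  assumes W: "subspace W" and DW: "\<And>x. x \<in> W \<Longrightarrow> app D x \<in> W" and DD: "app D (app D v) \<in> W"
  shows "app (exp D) v - v - app D v \<in> W"
proof -
  let ?f = "\<lambda>k. (app D ^^ k) v /\<^sub>R fact k"
  have mem: "(app D ^^ (k + 2)) v \<in> W" for k
    using DD DW by (induction k) auto
  have "(\<lambda>k. ?f (k + 2)) sums (app (exp D) v - (\<Sum>i<2. ?f i))"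
    using app_exp[of D v] by (rule sums_split_initial_segment)
  then have lim: "(\<lambda>n. \<Sum>k<n. ?f (k + 2)) \<longlonglongrightarrow> app (exp D) v - v - app D v"
    by (simp add: sums_def numeral_2_eq_2 diff_diff_eq)
  have "(\<Sum>k<n. ?f (k + 2)) \<in> W" for n
    by (intro subspace_sum[OF W] subspace_scale[OF W] mem)
  then show ?thesis
    using closed_subspace[OF W] lim by (meson closed_sequentially)
qed

context cartan_group
begin

text \<open>A central w is K-orthogonal to everything, in particular to
  \<open>star w\<close>.\<close>

lemma center_trivial:
  assumes w: "w \<in> \<gg>" and z: "\<And>x. x \<in> \<gg> \<Longrightarrow> bracket w x = 0"
  shows "w = 0"
proof -
  have "K w (star w) = 0"
    unfolding killing_eq
    by (rule trace_on_nilpotent[OF subspace_lie linear_bracket2, of _ _ 1])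
      (use w z star_in_lie in \<open>simp_all add: lie_closed\<close>)
  then have "bt w w = 0" by (simp only: bt_def killing_sym[OF star_in_lie w])
  then show ?thesis using bt.ip_eq_zero w by blast
qed

definition gr :: "'a^'b^'b \<Rightarrow> int \<Rightarrow> ('a^'b^'b) set" where
  "gr h i = {x \<in> \<gg>. bracket h x = of_int i *\<^sub>R x}"

lemma gr_bracket: "h \<in> \<gg> \<Longrightarrow> x \<in> gr h i \<Longrightarrow> y \<in> gr h j \<Longrightarrow> bracket x y \<in> gr h (i + j)"
proof -
  assume h: "h \<in> \<gg>" and x: "x \<in> gr h i" and y: "y \<in> gr h j"
  have "bracket h (bracket x y) = bracket (bracket h x) y + bracket x (bracket h y)"
    by (simp add: jacobi)
  then show ?thesis
    using x y by (simp add: gr_def lie_closed bracket_scale_left bracket_scale_right scaleR_add_left)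
qed

lemma subspace_gr: "subspace (gr h i)"
  using subspace_lie by (auto simp: gr_def subspace_def bracket_add_right bracket_scale_right scaleR_add_right)

text \<open>The filtration by weights of ad h: for graded h, \<open>fil h 0\<close> is the parabolic
  subalgebra attached to h and \<open>fil h 1\<close> its nilradical.\<close>

definition fil :: "'a^'b^'b \<Rightarrow> int \<Rightarrow> ('a^'b^'b) set" where
  "fil h i = span (\<Union>j\<in>{i..}. gr h j)"

lemma fil_subspace: "subspace (fil h i)" by (simp add: fil_def)

lemma fil_in_lie: "x \<in> fil h i \<Longrightarrow> x \<in> \<gg>"
  unfolding fil_def using span_minimal[of "\<Union>j\<in>{i..}. gr h j" \<gg>] subspace_lie by (auto simp: gr_def)

lemma gr_fil: "x \<in> gr h j \<Longrightarrow> i \<le> j \<Longrightarrow> x \<in> fil h i"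
  unfolding fil_def by (rule span_base) auto

lemma fil_mono: "i \<le> j \<Longrightarrow> x \<in> fil h j \<Longrightarrow> x \<in> fil h i"
  unfolding fil_def using span_mono[of "\<Union>k\<in>{j..}. gr h k" "\<Union>k\<in>{i..}. gr h k"] by force

lemma fil_minimal:
  assumes "x \<in> fil h i" "subspace W" "\<And>j y. i \<le> j \<Longrightarrow> y \<in> gr h j \<Longrightarrow> y \<in> W"
  shows "x \<in> W"
  using assms span_minimal[of "\<Union>j\<in>{i..}. gr h j" W] unfolding fil_def by auto

lemma fil_bracket:
  assumes h: "h \<in> \<gg>" and x: "x \<in> fil h i" and y: "y \<in> fil h j"
  shows "bracket x y \<in> fil h (i + j)"
proof -
  have gen: "bracket x y \<in> fil h (i + j)" if x: "x \<in> gr h k" "i \<le> k" for x k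
  proof (rule fil_minimal[OF y, of "{y. bracket x y \<in> fil h (i + j)}", simplified])
    show "subspace {y. bracket x y \<in> fil h (i + j)}"
      using fil_subspace[of h "i + j"] by (auto simp: subspace_def bracket_add_right bracket_scale_right)
    show "bracket x z \<in> fil h (i + j)" if "j \<le> m" "z \<in> gr h m" for m z
      using gr_bracket[OF h x(1) that(2)] x(2) that(1) by (intro gr_fil) auto
  qed
  show ?thesis
  proof (rule fil_minimal[OF x, of "{x. bracket x y \<in> fil h (i + j)}", simplified])
    show "subspace {x. bracket x y \<in> fil h (i + j)}"
      using fil_subspace[of h "i + j"] by (auto simp: subspace_def bracket_add_left bracket_scale_left)
  qed (use gen in blast)
qed

lemma fil_h_action:
  assumes "x \<in> fil h i"
  shows "bracket h x - of_int i *\<^sub>R x \<in> fil h (i + 1)"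
proof (rule fil_minimal[OF assms, of "{x. bracket h x - of_int i *\<^sub>R x \<in> fil h (i + 1)}", simplified])
  have lin: "linear (\<lambda>x. bracket h x - of_int i *\<^sub>R x)"
    by (rule linearI) (simp_all add: bracket_add_right bracket_scale_right algebra_simps)
  show "subspace {x. bracket h x - of_int i *\<^sub>R x \<in> fil h (i + 1)}"
    using linear_subspace_vimage[OF lin fil_subspace] by (simp add: vimage_def)
  fix j y assume j: "i \<le> j" "y \<in> gr h j"
  show "bracket h y - of_int i *\<^sub>R y \<in> fil h (i + 1)"
  proof (cases "i = j")
    case True
    then show ?thesis using j subspace_0[OF fil_subspace] by (simp add: gr_def)
  next
    case False
    then have "y \<in> fil h (i + 1)" using j by (intro gr_fil[OF j(2)]) auto
    then show ?thesis using j by (simp add: gr_def subspace_scale fil_subspace flip: scaleR_diff_left)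
  qed
qed

lemma killing_gr:
  assumes h: "h \<in> \<gg>" and x: "x \<in> gr h i" and y: "y \<in> gr h j" and ij: "i + j \<noteq> 0"
  shows "K x y = 0"
proof -
  have xy: "x \<in> \<gg>" "y \<in> \<gg>" using x y by (simp_all add: gr_def)
  have "K (bracket x h) y = K x (bracket h y)" using xy h by (intro killing_bracket)
  moreover have "bracket x h = (- of_int i) *\<^sub>R x" using x bracket_skew[of x h] by (simp add: gr_def)
  moreover have "bracket h y = of_int j *\<^sub>R y" using y by (simp add: gr_def)
  ultimately have "K ((- of_int i) *\<^sub>R x) y = K x (of_int j *\<^sub>R y)" by simp
  also have "\<dots> = of_int j * K x y"
    using killing_scale_left[OF xy(2,1)] killing_sym[OF xy] killing_sym[OF xy(1) lie_scaleR[OF xy(2)]] by simp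
  finally have "(- of_int i) * K x y = of_int j * K x y"
    by (simp only: killing_scale_left[OF xy])
  then have "of_int (i + j) * K x y = 0" by (simp add: algebra_simps)
  then show ?thesis using ij by (metis mult_eq_0_iff of_int_eq_0_iff)
qed

lemma killing_zero_subspace: "y \<in> \<gg> \<Longrightarrow> subspace {x \<in> \<gg>. K x y = 0}"
  using subspace_lie killing_scale_left[of 0 y 0] by (auto simp: subspace_def killing_add_left killing_scale_left)

definition graded :: "'a^'b^'b \<Rightarrow> bool" where
  "graded h \<longleftrightarrow> h \<in> \<gg> \<and> \<gg> = span (\<Union>i. gr h i)"

lemma graded_minimal:
  assumes "graded h" "(\<Union>i. gr h i) \<subseteq> W" "subspace W"
  shows "\<gg> \<subseteq> W"
proof -
  have "\<gg> = span (\<Union>i. gr h i)" using assms(1) unfolding graded_def by (rule conjunct2)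
  then show ?thesis using span_minimal[OF assms(2,3)] by (rule ord_eq_le_trans)
qed

text \<open>Eigenvalues of ad h are bounded by its operator norm, so only finitely many weights
  occur.\<close>

lemma fil_bounds:
  assumes h: "graded h"
  shows "\<exists>M::nat. fil h (- int M) = \<gg> \<and> fil h (int M + 1) = {0}"
proof -
  define M where "M = nat \<lceil>norm (ad h)\<rceil>"
  have bound: "x = 0" if x: "x \<in> gr h i" and i: "\<bar>i\<bar> > int M" for x i
  proof (rule ccontr)
    assume "x \<noteq> 0"
    have "\<bar>of_int i\<bar> * norm x = norm (app (ad h) x)" using x by (simp add: gr_def)
    also have "\<dots> \<le> norm (ad h) * norm x" by (rule norm_app_le)
    finally have "real_of_int \<bar>i\<bar> \<le> norm (ad h)" using \<open>x \<noteq> 0\<close> by simp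
    also have "\<dots> \<le> real M" unfolding M_def by (rule real_nat_ceiling_ge)
    finally have "real_of_int \<bar>i\<bar> \<le> real M" by simp
    then show False using i by linarith
  qed
  have "\<gg> \<subseteq> fil h (- int M)"
  proof -
    have "(\<Union>i. gr h i) \<subseteq> fil h (- int M)"
    proof safe
      fix x i assume x: "x \<in> gr h i"
      show "x \<in> fil h (- int M)"
      proof (cases "- int M \<le> i")
        case False
        then show ?thesis using bound[OF x] subspace_0[OF fil_subspace] by auto
      qed (use x in \<open>rule gr_fil\<close>)
    qed
    then show ?thesis using fil_subspace by (rule graded_minimal[OF h])
  qed
  moreover have "fil h (int M + 1) \<subseteq> {0}"
  proof
    fix x assume "x \<in> fil h (int M + 1)"
    then show "x \<in> {0}" by (rule fil_minimal) (use bound subspace_single_0 in auto)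
  qed
  ultimately show ?thesis using fil_in_lie subspace_0[OF fil_subspace] by (intro exI[of _ M]) blast
qed

text \<open>K pairs weight i only with weight -i. So the negative part y1 of y is orthogonal to all
  weights \<le> 0, and by assumption to the positive ones as well; hence bt y1 y1 = 0.\<close>

lemma fil_zero_killing:
  assumes h: "graded h" and y: "y \<in> \<gg>" and orth: "\<And>z. z \<in> fil h 1 \<Longrightarrow> K y z = 0"
  shows "y \<in> fil h 0"
proof -
  have hg: "h \<in> \<gg>" using h unfolding graded_def by (rule conjunct1)
  define Neg where "Neg = span (\<Union>i\<in>{..<0}. gr h i)"
  have "\<gg> \<subseteq> span ((\<Union>i\<in>{0..}. gr h i) \<union> (\<Union>i\<in>{..<0}. gr h i))"
  proof (rule graded_minimal[OF h _ subspace_span])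
    show "(\<Union>i. gr h i) \<subseteq> span ((\<Union>i\<in>{0..}. gr h i) \<union> (\<Union>i\<in>{..<0}. gr h i))"
    proof safe
      fix x i assume "x \<in> gr h i"
      then show "x \<in> span ((\<Union>i\<in>{0..}. gr h i) \<union> (\<Union>i\<in>{..<0}. gr h i))"
        by (intro span_base, cases "0 \<le> i") auto
    qed
  qed
  then obtain y0 y1 where y01: "y = y0 + y1" "y0 \<in> fil h 0" "y1 \<in> Neg"
    using y unfolding span_Un fil_def Neg_def by blast
  have NegL: "Neg \<subseteq> \<gg>" unfolding Neg_def using subspace_lie by (intro span_minimal) (auto simp: gr_def)
  have neg: "K x z = 0" if "x \<in> Neg" "z \<in> gr h j" "j \<le> 0" for x z j
  proof -
    have z: "z \<in> \<gg>" using that by (simp add: gr_def)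
    have "Neg \<subseteq> {x \<in> \<gg>. K x z = 0}" unfolding Neg_def
    proof (rule span_minimal[OF _ killing_zero_subspace[OF z]])
      show "(\<Union>i\<in>{..<0}. gr h i) \<subseteq> {x \<in> \<gg>. K x z = 0}"
        using killing_gr[OF hg _ that(2)] that(3) by (force simp: gr_def)
    qed
    then show ?thesis using that(1) by auto
  qed
  have pos: "K x z = 0" if "x \<in> fil h 0" "z \<in> gr h j" "1 \<le> j" for x z j
  proof -
    have z: "z \<in> \<gg>" using that by (simp add: gr_def)
    have "x \<in> {x \<in> \<gg>. K x z = 0}"
      by (rule fil_minimal[OF that(1) killing_zero_subspace[OF z]])
        (use killing_gr[OF hg _ that(2)] that(3) in \<open>force simp: gr_def\<close>)
    then show ?thesis by simp
  qed
  have y1: "y1 \<in> \<gg>" and y0: "y0 \<in> \<gg>" using y01 NegL fil_in_lie by auto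
  have "K z y1 = 0" if "z \<in> gr h j" for z j
  proof (cases "j \<le> 0")
    case True
    then show ?thesis using neg[OF y01(3) that] y1 that by (simp add: killing_sym gr_def)
  next
    case False
    have z: "z \<in> \<gg>" using that by (simp add: gr_def)
    have "z \<in> fil h 1" using False that by (intro gr_fil[OF that]) auto
    then have "K y0 z + K y1 z = 0" using orth[of z] killing_add_left[OF y0 y1 z] by (simp add: y01(1))
    moreover have "K y0 z = 0" using pos[OF y01(2) that] False by simp
    ultimately show ?thesis using y1 z by (simp add: killing_sym)
  qed
  then have "(\<Union>i. gr h i) \<subseteq> {x \<in> \<gg>. K x y1 = 0}" by (auto simp: gr_def)
  then have "\<gg> \<subseteq> {x \<in> \<gg>. K x y1 = 0}"
    using killing_zero_subspace[OF y1] by (rule graded_minimal[OF h])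
  then have "bt y1 y1 = 0" using star_in_lie[of y1] by (auto simp: bt_def)
  then show ?thesis using bt.ip_eq_zero[OF y1] y01 by simp
qed

text \<open>Removing from h its component along the nilradical of the parabolic subalgebra attached to h
  yields an element of p: both l and its adjoint preserve the filtration, so l acts on the successive
  orthogonal complements as h does on the graded pieces.\<close>

theorem conjugate_into_p:
  assumes h: "graded h"
  shows "\<exists>A\<in>G. star (Ad A h) = Ad A h"
proof -
  have hg: "h \<in> \<gg>" using h unfolding graded_def by (rule conjunct1)
  obtain M :: nat where M: "fil h (- int M) = \<gg>" "fil h (int M + 1) = {0}"
    using fil_bounds[OF h] by blast
  have fil_sub: "fil h i \<subseteq> \<gg>" for i using fil_in_lie by auto
  \<comment> \<open>The component of h along the nilradical, taken orthogonally for
    \<open>bt\<close>; h - x0 equals h modulo the nilradical.\<close>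
  obtain x0 where x0: "x0 \<in> fil h 1" "\<And>z. z \<in> fil h 1 \<Longrightarrow> bt (h - x0) z = 0"
    using bt.projection[OF fil_subspace fil_sub hg] by blast
  define l where "l = h - x0"
  have lg: "l \<in> \<gg>" using hg x0 fil_in_lie by (simp add: l_def lie_closed)
  have "h \<in> gr h 0" using hg by (simp add: gr_def)
  then have l0: "l \<in> fil h 0"
    unfolding l_def using gr_fil[of h h 0 0] fil_mono[of 0 1 x0 h] x0(1) by (intro subspace_diff fil_subspace) auto
  \<comment> \<open>The choice of x0 says exactly that \<open>star l\<close> is Killing-orthogonal
    to the nilradical.\<close>
  have sl0: "star l \<in> fil h 0"
  proof (rule fil_zero_killing[OF h star_in_lie])
    show "K (star l) z = 0" if "z \<in> fil h 1" for z using x0(2)[OF that] by (simp add: l_def bt_def)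
  qed
  \<comment> \<open>Orthogonal complements of consecutive filtration steps. They replace the weight
    spaces of h, which need not be orthogonal for \<open>bt\<close>.\<close>
  define U where "U = (\<lambda>i. {x \<in> fil h i. \<forall>z\<in>fil h (i + 1). bt x z = 0})"
  have lU: "bracket l x = of_int i *\<^sub>R x" if x: "x \<in> U i" for x i
  proof -
    have xf: "x \<in> fil h i" and xo: "\<And>z. z \<in> fil h (i + 1) \<Longrightarrow> bt x z = 0" using x by (auto simp: U_def)
    let ?d = "bracket l x - of_int i *\<^sub>R x"
    have xg: "x \<in> \<gg>" using xf fil_in_lie by blast
    have "?d = (bracket h x - of_int i *\<^sub>R x) - bracket x0 x" by (simp add: l_def bracket_diff_left)
    also have "\<dots> \<in> fil h (i + 1)"
      using fil_bracket[OF hg x0(1) xf]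
      by (intro subspace_diff[OF fil_subspace fil_h_action[OF xf]]) (simp add: add.commute)
    finally have d: "?d \<in> fil h (i + 1)" .
    have dg: "?d \<in> \<gg>" using d fil_in_lie by blast
    have "bt ?d ?d = bt (bracket l x) ?d - of_int i * bt x ?d"
      using xg lg dg by (simp add: bt.ip_diff_left bt.ip_scale_left lie_closed)
    also have "bt (bracket l x) ?d = bt x (bracket (star l) ?d)" using xg lg dg by (simp add: bt_adjoint)
    also have "\<dots> = 0" using fil_bracket[OF hg sl0 d] xo by simp
    also have "bt x ?d = 0" using xo d by simp
    finally have "?d = 0" using bt.ip_eq_zero[OF dg] by simp
    then show ?thesis by simp
  qed
  have dec: "\<exists>y\<in>U i. x - y \<in> fil h (i + 1)" if x: "x \<in> fil h i" for x i
  proof -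
    obtain p where p: "p \<in> fil h (i + 1)" "\<And>z. z \<in> fil h (i + 1) \<Longrightarrow> bt (x - p) z = 0"
      using bt.projection[OF fil_subspace fil_sub fil_in_lie[OF x], of "i + 1"] by blast
    have "x - p \<in> fil h i" using x p fil_mono[of i "i + 1" p h] by (intro subspace_diff fil_subspace) auto
    then show ?thesis using p by (intro bexI[of _ "x - p"]) (auto simp: U_def)
  qed
  have Ug: "U i \<subseteq> \<gg>" for i using fil_in_lie by (auto simp: U_def)
  \<comment> \<open>Here k counts the steps down from the zero space
    \<open>fil h (int M + 1)\<close>; 2 M + 1 of them reach the whole Lie algebra.\<close>
  have span: "x \<in> fil h (int M + 1 - int k) \<Longrightarrow> x \<in> span (\<Union>i. U i)" for k x
  proof (induction k arbitrary: x)
    case 0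
    then show ?case using M by (simp add: span_zero)
  next
    case (Suc k)
    obtain y where y: "y \<in> U (int M + 1 - int (Suc k))" "x - y \<in> fil h (int M + 1 - int (Suc k) + 1)"
      using dec[OF Suc.prems] by blast
    have "x - y \<in> span (\<Union>i. U i)" using y(2) by (intro Suc.IH) (simp add: algebra_simps)
    moreover have "y \<in> span (\<Union>i. U i)" using y(1) by (intro span_base) auto
    ultimately show ?case using span_add by fastforce
  qed
  have gU: "\<gg> \<subseteq> span (\<Union>i. U i)"
  proof
    fix x assume "x \<in> \<gg>"
    then show "x \<in> span (\<Union>i. U i)" using span[of x "2 * M + 1"] M(1) by simp
  qed
  have symU: "bt (bracket l x) y = bt x (bracket l y)" if x: "x \<in> U i" and y: "y \<in> U j" for x y i j
  proof -
    have xg: "x \<in> \<gg>" and yg: "y \<in> \<gg>" using x y Ug by auto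
    consider "i = j" | "i < j" | "j < i" by linarith
    then have "i = j \<or> bt x y = 0"
    proof cases
      case 2
      then have "y \<in> fil h (i + 1)" using y fil_mono[of "i + 1" j y h] by (simp add: U_def)
      then show ?thesis using x by (simp add: U_def)
    next
      case 3
      then have "x \<in> fil h (j + 1)" using x fil_mono[of "j + 1" i x h] by (simp add: U_def)
      then have "bt y x = 0" using y by (simp add: U_def)
      then show ?thesis using bt.ip_sym[OF xg yg] by simp
    qed simp
    then show ?thesis
      using xg yg by (auto simp: lU[OF x] lU[OF y] bt.ip_scale_left bt.ip_scale_right)
  qed
  have sym: "bt (bracket l x) y = bt x (bracket l y)" if "x \<in> \<gg>" "y \<in> \<gg>" for x y
  proof -
    have 1: "subspace {y \<in> \<gg>. bt (bracket l x) y = bt x (bracket l y)}" if "x \<in> \<gg>" for x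
      using that lg subspace_lie
      by (auto simp: subspace_def bt.ip_add_right bt.ip_scale_right bt.ip_zero_right bracket_add_right
          bracket_scale_right lie_closed)
    have 2: "subspace {x \<in> \<gg>. bt (bracket l x) y = bt x (bracket l y)}" if "y \<in> \<gg>" for y
      using that lg subspace_lie
      by (auto simp: subspace_def bt.ip_add_left bt.ip_scale_left bt.ip_zero_left bracket_add_right
          bracket_scale_right lie_closed)
    have "bt (bracket l x) y = bt x (bracket l y)" if x: "x \<in> U i" and y: "y \<in> \<gg>" for x y i
    proof -
      have xg: "x \<in> \<gg>" using x Ug by auto
      have "(\<Union>i. U i) \<subseteq> {y \<in> \<gg>. bt (bracket l x) y = bt x (bracket l y)}" using symU[OF x] Ug by blast
      then have "span (\<Union>i. U i) \<subseteq> {y \<in> \<gg>. bt (bracket l x) y = bt x (bracket l y)}"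
        using 1[OF xg] by (rule span_minimal)
      then show ?thesis using gU y by auto
    qed
    then have "(\<Union>i. U i) \<subseteq> {x \<in> \<gg>. bt (bracket l x) y = bt x (bracket l y)}" using Ug that(2) by blast
    then have "span (\<Union>i. U i) \<subseteq> {x \<in> \<gg>. bt (bracket l x) y = bt x (bracket l y)}"
      using 2[OF that(2)] by (rule span_minimal)
    then show ?thesis using gU that(1) by auto
  qed
  \<comment> \<open>Since ad l is symmetric for \<open>bt\<close>, it equals its adjoint ad (star
    l); the difference is central.\<close>
  have "star l - l = 0"
  proof (rule center_trivial)
    show "star l - l \<in> \<gg>" using lg star_in_lie by (simp add: lie_closed)
    fix y assume y: "y \<in> \<gg>"
    have "bracket (star l) y = bracket l y"
    proof (rule bt.ip_eqI)
      fix z assume z: "z \<in> \<gg>"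
      have "bt z (bracket (star l) y) = bt z (bracket l y)"
        using sym[OF z y] bt_adjoint[OF lg z y] by simp
      then show "bt (bracket (star l) y) z = bt (bracket l y) z"
        using y z lg star_in_lie by (simp add: bt.ip_sym lie_closed)
    qed (use y lg star_in_lie in \<open>simp_all add: lie_closed\<close>)
    then show "bracket (star l - l) y = 0" by (simp add: bracket_diff_left)
  qed
  then have sl: "star l = l" by simp
  \<comment> \<open>The difference between the conjugate of h and l is pushed up the filtration, one
    step per conjugation, until it falls into the zero space.\<close>
  have conj: "\<exists>A\<in>G. \<exists>x\<in>fil h (int k + 1). Ad A h = l + x" for k
  proof (induction k)
    case 0
    show ?case using x0 G_one by (intro bexI[of _ "mat 1"] bexI[of _ x0]) (simp_all add: l_def)
  next
    case (Suc k)
    then obtain A x where A: "A \<in> G" "x \<in> fil h (int k + 1)" "Ad A h = l + x" by blast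
    obtain y where y: "y \<in> U (int k + 1)" "x - y \<in> fil h (int k + 1 + 1)" using dec[OF A(2)] by blast
    let ?k = "int k + 1" let ?W = "fil h (?k + 1)"
    have yf: "y \<in> fil h ?k" using y(1) by (simp add: U_def)
    \<comment> \<open>Dividing by the eigenvalue k + 1 of ad l on y gives [u, l] = -y, which cancels
      the leading part y of x.\<close>
    define u where "u = (1 / of_int ?k) *\<^sub>R y"
    have uf: "u \<in> fil h ?k" unfolding u_def using yf by (intro subspace_scale fil_subspace)
    have ug: "u \<in> \<gg>" using uf fil_in_lie by blast
    have "bracket u l = (- 1 / of_int ?k) *\<^sub>R bracket l y"
      using bracket_skew[of y l] by (simp add: u_def bracket_scale_left)
    also have "\<dots> = - y" by (simp add: lU[OF y(1)])
    finally have ul: "bracket u l = - y" .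
    have pos: "bracket u z \<in> ?W" if "z \<in> fil h m" "1 \<le> m" for z m
      by (rule fil_mono[OF _ fil_bracket[OF hg uf that(1)]]) (use that in simp)
    have a1: "bracket u (l + x) + y \<in> ?W"
      using pos[OF A(2)] by (simp add: bracket_add_right ul)
    have a2: "app (exp (ad u)) (l + x) - (l + x) - app (ad u) (l + x) \<in> ?W"
    proof (rule exp_mod_subspace[OF fil_subspace])
      show "app (ad u) z \<in> ?W" if "z \<in> ?W" for z using pos[OF that] by simp
      have "bracket u (l + x) \<in> fil h ?k"
        using pos[OF A(2)] yf fil_mono[of ?k "?k + 1" "bracket u x" h]
        by (simp add: bracket_add_right ul subspace_add subspace_neg subspace_diff fil_subspace)
      then show "app (ad u) (app (ad u) (l + x)) \<in> ?W" using pos[of "bracket u (l + x)" ?k] by simp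
    qed
    have "(bracket u (l + x) + y) + (Ad (mexp u) (l + x) - (l + x) - bracket u (l + x)) + (x - y) \<in> ?W"
      using subspace_add[OF fil_subspace subspace_add[OF fil_subspace a1 a2] y(2)] by (simp only: Ad_mexp app_ad)
    then have "Ad (mexp u) (l + x) - l \<in> ?W" by (simp add: algebra_simps)
    moreover have "Ad (mexp u ** A) h = Ad (mexp u) (l + x)"
      using A ug by (simp add: Ad_mult invertible_mexp G_invertible)
    ultimately show ?case
      using A(1) ug by (intro bexI[of _ "mexp u ** A"] bexI[of _ "Ad (mexp u) (l + x) - l"])
        (simp_all add: G_mult mexp_in_G' algebra_simps)
  qed
  from conj[of M] M(2) sl show ?thesis by auto
qed

end

section \<open>The exponential function near zero\<close>

text \<open>The remainder after the linear term is at most |a|^2 exp |a|.\<close>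

lemma exp_has_derivative_at_0:
  "(exp has_derivative (\<lambda>h. h)) (at (0 :: 'a::{real_normed_algebra_1,banach}))"
proof -
  have bound: "norm (exp a - 1 - a) \<le> (norm a)\<^sup>2 * exp (norm a)" for a :: 'a
  proof -
    let ?f = "\<lambda>k. a ^ k /\<^sub>R fact k"
    let ?g = "\<lambda>k. norm a ^ k /\<^sub>R fact k"
    have "(\<lambda>k. ?f (k + 2)) sums (exp a - (\<Sum>i<2. ?f i))"
      using exp_converges by (rule sums_split_initial_segment)
    then have s: "(\<lambda>k. ?f (k + 2)) sums (exp a - 1 - a)"
      by (simp add: numeral_2_eq_2 diff_diff_eq)
    have g: "(\<lambda>k. (norm a)\<^sup>2 * ?g k) sums ((norm a)\<^sup>2 * exp (norm a))"
      using exp_converges by (rule sums_mult)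
    have le: "norm (?f (k + 2)) \<le> (norm a)\<^sup>2 * ?g k" for k
    proof -
      have "norm (?f (k + 2)) = norm (a ^ (k + 2)) / fact (k + 2)" by (simp add: divide_inverse mult.commute)
      also have "\<dots> \<le> norm a ^ (k + 2) / fact k"
        by (intro frac_le norm_power_ineq fact_mono) auto
      also have "\<dots> = (norm a)\<^sup>2 * ?g k" by (simp add: power_add divide_inverse power2_eq_square)
      finally show ?thesis .
    qed
    have "norm (suminf (\<lambda>k. ?f (k + 2))) \<le> suminf (\<lambda>k. (norm a)\<^sup>2 * ?g k)"
      using le sums_summable[OF g] by (rule norm_suminf_le)
    then show ?thesis using sums_unique[OF s] sums_unique[OF g] by simp
  qed
  have "((\<lambda>a::'a. norm (exp (0 + a) - exp 0 - a) / norm a) \<longlongrightarrow> 0) (at 0)"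
  proof (rule Lim_null_comparison)
    show "\<forall>\<^sub>F a in at 0. norm (norm (exp (0 + a) - exp 0 - a) / norm a) \<le> norm (a :: 'a) * exp (norm a)"
    proof (rule always_eventually, rule allI)
      fix a :: 'a
      have "norm (exp a - 1 - a) / norm a \<le> ((norm a)\<^sup>2 * exp (norm a)) / norm a"
        by (intro divide_right_mono bound) auto
      then show "norm (norm (exp (0 + a) - exp 0 - a) / norm a) \<le> norm a * exp (norm a)"
        by (cases "a = 0") (auto simp: power2_eq_square)
    qed
    have "((\<lambda>a::'a. norm a * exp (norm a)) \<longlongrightarrow> norm (0::'a) * exp (norm (0::'a))) (at 0)"
      by (intro tendsto_intros)
    then show "((\<lambda>a::'a. norm a * exp (norm a)) \<longlongrightarrow> 0) (at 0)" by simp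
  qed
  then show ?thesis by (simp add: has_derivative_at)
qed

text \<open>Termwise |b^k - a^k| \<le> k M^k |b - a| with M = |a| + 1, and k \<le> 2^k bounds the
  sum by the exponential series at 2 M.\<close>

lemma isCont_exp_algebra: "isCont exp (a :: 'a::{real_normed_algebra_1,banach})"
proof -
  define M where "M = norm a + 1"
  define C where "C = (\<Sum>k. (2 * M) ^ k /\<^sub>R fact k)"
  have bound: "norm (exp b - exp a) \<le> C * norm (b - a)" if b: "norm (b - a) < 1" for b
  proof -
    have nb: "norm b \<le> M" using b norm_triangle_ineq[of a "b - a"] by (simp add: M_def)
    have M1: "1 \<le> M" "norm a \<le> M" by (auto simp: M_def)
    have "(\<lambda>k. b ^ k /\<^sub>R fact k - a ^ k /\<^sub>R fact k) sums (exp b - exp a)"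
      by (intro sums_diff exp_converges)
    then have s: "(\<lambda>k. (b ^ k - a ^ k) /\<^sub>R fact k) sums (exp b - exp a)"
      by (simp add: scaleR_diff_right)
    have su: "summable (\<lambda>k. (2 * M) ^ k /\<^sub>R fact k)" using summable_exp_generic .
    have le: "norm ((b ^ k - a ^ k) /\<^sub>R fact k) \<le> ((2 * M) ^ k /\<^sub>R fact k) * norm (b - a)" for k
    proof -
      have "norm (b ^ k - a ^ k) \<le> real k * M ^ k * norm (b - a)"
        by (rule norm_power_diff_le[OF nb M1(2,1)])
      also have "\<dots> \<le> 2 ^ k * M ^ k * norm (b - a)"
        using M1 by (intro mult_right_mono) (simp_all add: less_imp_le)
      finally show ?thesis by (simp add: power_mult_distrib divide_right_mono divide_inverse mult.commute mult_left_mono mult.left_commute)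
    qed
    have "norm (suminf (\<lambda>k. (b ^ k - a ^ k) /\<^sub>R fact k)) \<le> suminf (\<lambda>k. ((2 * M) ^ k /\<^sub>R fact k) * norm (b - a))"
      using le summable_mult2[OF su] by (rule norm_suminf_le)
    then show ?thesis using sums_unique[OF s] suminf_mult2[OF su, of "norm (b - a)"] by (simp add: C_def)
  qed
  have "((\<lambda>b. exp b - exp a) \<longlongrightarrow> 0) (at a)"
  proof (rule Lim_null_comparison)
    show "\<forall>\<^sub>F b in at a. norm (exp b - exp a) \<le> C * norm (b - a)"
      unfolding eventually_at using bound by (intro exI[of _ 1]) (auto simp: dist_norm)
    have "((\<lambda>b. C * norm (b - a)) \<longlongrightarrow> C * norm (a - a)) (at a)" by (intro tendsto_intros)
    then show "((\<lambda>b. C * norm (b - a)) \<longlongrightarrow> 0) (at a)" by simp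
  qed
  then show ?thesis by (simp add: isCont_def LIM_zero_iff)
qed

section \<open>Minimal triples\<close>

text \<open>Skewness under k and symmetry under p merge into one rule: ad (star X) is the adjoint of
  ad X, the same rule that \<open>bt\<close> satisfies.\<close>

locale compatible_ip = cartan_group +
  fixes ip :: "'a^'b^'b \<Rightarrow> 'a^'b^'b \<Rightarrow> real"
  assumes ip_inner: "inner_product_on (lie_algebra G) ip"
    and ip_adjoint: "X \<in> lie_algebra G \<Longrightarrow> Y \<in> lie_algebra G \<Longrightarrow> Z \<in> lie_algebra G \<Longrightarrow>
      ip (bracket X Y) Z = ip Y (bracket (star X) Z)"
begin

sublocale ip: ip_space \<gg> ip
  by unfold_locales (rule subspace_lie, rule ip_inner)

lemma star_Ad: "A \<in> G \<Longrightarrow> X \<in> \<gg> \<Longrightarrow> star (Ad A X) = Ad (\<theta> A) (star X)"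
  by (simp add: star_def sig_Ad linear_neg[OF linear_Ad])

lemma theta_mexp_p: "Y \<in> \<gg> \<Longrightarrow> star Y = Y \<Longrightarrow> \<theta> (mexp (t *\<^sub>R Y)) = mexp (- t *\<^sub>R Y)"
proof -
  assume Y: "Y \<in> \<gg>" "star Y = Y"
  then have "differential \<theta> Y = - Y" by (simp add: star_def sig_eq) (metis minus_minus)
  then show ?thesis using theta_mexp[OF Y(1), of t] by simp
qed

lemma Ad_mexp_fixed:
  fixes X Y :: "'a^'b^'b"
  assumes "bracket Y X = 0"
  shows "Ad (mexp (t *\<^sub>R Y)) X = X"
proof -
  from assms have "app (exp (ad (t *\<^sub>R Y))) X - X - app (ad (t *\<^sub>R Y)) X \<in> {0}"
    by (intro exp_mod_subspace subspace_single_0) (simp_all add: bracket_scale_left)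
  then show ?thesis using assms by (simp add: Ad_mexp bracket_scale_left)
qed

text \<open>A triple whose neutral element lies in p and which minimises the sum of the squared norms of the
  two nilpotent elements among its conjugates under the centraliser of h is adapted to the
  Cartan involution: equality holds throughout in 2|v|^2 = <m, h> <= |m| |h| <= |h|^2 = 2<v, w>.\<close>

lemma minimal_pair_diagonal:
  assumes h: "h \<in> \<gg>" "star h = h" and v: "v \<in> \<gg>" "bracket h v = 2 *\<^sub>R v"
    and w: "w \<in> \<gg>" "bracket h w = 2 *\<^sub>R w" and vw: "bracket v (star w) = h"
    and crit: "\<And>Y. Y \<in> \<gg> \<Longrightarrow> star Y = Y \<Longrightarrow> bracket h Y = 0 \<Longrightarrow> ip (bracket Y v) v = ip (bracket Y w) w"
  shows "v = w"
proof -
  note cl = lie_closed star_in_lie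
  define M1 M2 where "M1 = bracket v (star v)" and "M2 = bracket w (star w)"
  have M: "M1 \<in> \<gg>" "M2 \<in> \<gg>" using v w by (simp_all add: M1_def M2_def cl)
  have starM: "star M1 = M1" "star M2 = M2"
    using v w by (simp_all add: M1_def M2_def star_bracket star_star star_in_lie)
  have hstar: "bracket h (star x) = - 2 *\<^sub>R star x" if "x \<in> \<gg>" "bracket h x = 2 *\<^sub>R x" for x
  proof -
    have "star (bracket h x) = bracket (star x) h" by (simp only: star_bracket[OF h(1) that(1)] h(2))
    then show ?thesis using that bracket_skew[of h "star x"] by (simp add: linear_cmul[OF linear_star])
  qed
  have hM: "bracket h (bracket x (star x)) = 0" if "x \<in> \<gg>" "bracket h x = 2 *\<^sub>R x" for x
  proof -
    have "bracket h (bracket x (star x)) = bracket (bracket h x) (star x) + bracket x (bracket h (star x))"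
      by (simp add: jacobi)
    then show ?thesis using hstar[OF that] that by (simp add: bracket_scale_left bracket_scale_right bracket_minus_right)
  qed
  have mom: "ip (bracket Y x) x = ip Y (bracket x (star x))" if "Y \<in> \<gg>" "x \<in> \<gg>" for Y x
  proof -
    have "ip (bracket Y x) x = ip (- bracket x Y) x" by (simp only: bracket_skew[of Y x])
    also have "\<dots> = - ip Y (bracket (star x) x)"
      using that by (simp add: ip.ip_minus_left ip_adjoint cl)
    also have "\<dots> = ip Y (- bracket (star x) x)" using that by (simp add: ip.ip_minus_right cl)
    finally show ?thesis by (simp only: bracket_skew[of x "star x"])
  qed
  \<comment> \<open>M1 - M2 lies in p and commutes with h, so it is itself an admissible direction
    Y; criticality in this direction says that its square norm is 0.\<close>
  have MM: "M1 = M2"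
  proof -
    let ?Y = "M1 - M2"
    have "ip ?Y M1 = ip ?Y M2"
      unfolding M1_def M2_def using crit[of ?Y] mom[of ?Y v] mom[of ?Y w] M v w starM hM[OF v] hM[OF w]
      by (simp add: cl linear_diff[OF linear_star] bracket_diff_right flip: M1_def M2_def)
    then have "ip ?Y ?Y = 0" using M by (simp add: ip.ip_diff_right cl)
    then show ?thesis using ip.ip_eq_zero[of ?Y] M by (simp add: cl)
  qed
  have Mh: "ip (bracket x (star x)) h = 2 * ip x x" if "x \<in> \<gg>" "bracket h x = 2 *\<^sub>R x" for x
  proof -
    have "ip (bracket x (star x)) h = ip h (bracket x (star x))" using that h by (simp add: ip.ip_sym cl)
    also have "\<dots> = ip (bracket h x) x" using mom[OF h(1) that(1)] by simp
    finally show ?thesis using that by (simp add: ip.ip_scale_left)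
  qed
  define a where "a = ip v v"
  have av: "ip M1 h = 2 * a" using Mh[OF v] by (simp add: M1_def a_def)
  have aw: "ip w w = a" using Mh[OF w] av by (simp add: MM M2_def)
  have hh: "ip h h = 2 * ip v w"
  proof -
    have "ip h h = ip (- bracket (star w) v) h" by (simp only: vw[symmetric] bracket_skew[of v "star w"] minus_minus)
    also have "\<dots> = - ip v (bracket w h)" using h v w by (simp add: ip.ip_minus_left ip_adjoint cl star_star)
    also have "bracket w h = - 2 *\<^sub>R w" using w bracket_skew[of w h] by simp
    finally show ?thesis using v w by (simp add: ip.ip_minus_right ip.ip_scale_right cl)
  qed
  \<comment> \<open>By the Jacobi identity <M1, M2> = |h|^2 - |[v, w]|^2.\<close>
  have M1M1: "ip M1 M1 \<le> ip h h"
  proof -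
    have "ip M1 M1 = ip M1 M2" by (simp add: MM)
    also have "\<dots> = ip (- bracket (star v) v) M2" by (simp only: M1_def bracket_skew[of v "star v"])
    also have "\<dots> = - ip v (bracket v M2)" using M v by (simp add: ip.ip_minus_left ip_adjoint cl star_star)
    also have "bracket v M2 = bracket w h - bracket (star w) (bracket v w)"
    proof -
      have "bracket v M2 = bracket (bracket v w) (star w) + bracket w (bracket v (star w))"
        by (simp add: M2_def jacobi)
      then show ?thesis using bracket_skew[of "bracket v w" "star w"] by (simp add: vw)
    qed
    also have "bracket w h = - 2 *\<^sub>R w" using w bracket_skew[of w h] by simp
    also have "- ip v (- 2 *\<^sub>R w - bracket (star w) (bracket v w)) = 2 * ip v w + ip v (bracket (star w) (bracket v w))"
      using v w by (simp add: ip.ip_diff_right ip.ip_minus_right ip.ip_scale_right cl)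
    also have "ip v (bracket (star w) (bracket v w)) = ip (bracket w v) (bracket v w)"
      using v w by (simp add: ip_adjoint cl)
    also have "\<dots> = - ip (bracket v w) (bracket v w)"
      using v w by (simp only: bracket_skew[of w v] ip.ip_minus_left cl)
    finally show ?thesis using hh ip.ip_nonneg[of "bracket v w"] v w by (simp add: cl)
  qed
  have "2 * a \<le> ip h h"
  proof -
    have "(2 * a)\<^sup>2 \<le> ip M1 M1 * ip h h" using ip.ip_cauchy_schwarz[OF M(1) h(1)] by (simp add: av)
    also have "\<dots> \<le> ip h h * ip h h" using M1M1 ip.ip_nonneg[OF h(1)] by (rule mult_right_mono)
    finally show ?thesis
      using ip.ip_nonneg[OF h(1)] power2_le_imp_le[of "2 * a" "ip h h"] by (simp add: power2_eq_square)
  qed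
  \<comment> \<open>Here |v - w|^2 = 2 a - 2 <v, w> = 2 a - |h|^2.\<close>
  then have "ip (v - w) (v - w) \<le> 0"
    using v w aw hh by (simp add: ip.ip_diff_left ip.ip_diff_right cl ip.ip_sym[of w v] flip: a_def)
  then have "ip (v - w) (v - w) = 0" using ip.ip_nonneg[of "v - w"] v w by (simp add: cl)
  then show ?thesis using ip.ip_eq_zero[of "v - w"] v w by (simp add: cl)
qed

text \<open>The conditions in \<open>T\<close> are closed and hold on the orbit of pairs
  \<open>S\<close>, so they survive in its closure. Sublevel sets of the norm are compact there, and
  a minimum is diagonal.\<close>

lemma critical_in_closure:
  assumes tr: "triple h e f" and sh: "star h = h"
  shows "\<exists>v. v \<in> closure {Ad A e |A. A \<in> G \<and> Ad A h = h} \<and> v \<in> \<gg> \<and> bracket h v = 2 *\<^sub>R v \<and> bracket v (star v) = h"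
proof -
  note cl = lie_closed star_in_lie
  have h: "h \<in> \<gg>" and e: "e \<in> \<gg>" and f: "f \<in> \<gg>" and he: "bracket h e = 2 *\<^sub>R e"
    and hf: "bracket h f = - 2 *\<^sub>R f" and ef: "bracket e f = h"
    using tr by (auto simp: triple_def)
  \<comment> \<open>With \<open>star\<close> on the second component, exp(t Y) for Y in p acts on a
    pair by exp(t Y) and exp(-t Y). The derivative of the norm then yields the difference <[Y, v],
    v> - <[Y, w], w>.\<close>
  define S where "S = {(Ad A e, star (Ad A f)) |A. A \<in> G \<and> Ad A h = h}"
  define T where "T = {(v, w). v \<in> \<gg> \<and> w \<in> \<gg> \<and> bracket h v = 2 *\<^sub>R v \<and> bracket h w = 2 *\<^sub>R w \<and> bracket v (star w) = h}"
  have ST: "S \<subseteq> T"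
  proof
    fix x assume "x \<in> S"
    then obtain A where x: "x = (Ad A e, star (Ad A f))" and A: "A \<in> G" "Ad A h = h" by (auto simp: S_def)
    have inv: "invertible A" using A G_invertible by blast
    have 1: "bracket h (Ad A e) = 2 *\<^sub>R Ad A e"
      using Ad_bracket[OF inv, of h e] by (simp add: he A linear_cmul[OF linear_Ad])
    have 2: "bracket h (Ad A f) = - 2 *\<^sub>R Ad A f"
      using Ad_bracket[OF inv, of h f] by (simp add: hf A linear_cmul[OF linear_Ad] linear_neg[OF linear_Ad])
    have "bracket h (star (Ad A f)) = - star (bracket h (Ad A f))"
      using A f h bracket_skew[of h "star (Ad A f)"] by (simp add: star_bracket sh Ad_in_lie)
    then have 3: "bracket h (star (Ad A f)) = 2 *\<^sub>R star (Ad A f)"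
      by (simp add: 2 linear_cmul[OF linear_star] linear_neg[OF linear_star])
    have 4: "bracket (Ad A e) (star (star (Ad A f))) = h"
      using Ad_bracket[OF inv, of e f] A f by (simp add: ef star_star Ad_in_lie)
    show "x \<in> T" using 1 3 4 A e f by (simp add: T_def x Ad_in_lie star_in_lie)
  qed
  have cb: "continuous_on UNIV (\<lambda>x. bracket (p x) (q x))"
    if "continuous_on UNIV p" "continuous_on UNIV q" for p q :: "('a^'b^'b) \<times> ('a^'b^'b) \<Rightarrow> 'a^'b^'b"
    unfolding bracket_def using that
    by (intro continuous_intros bounded_bilinear.continuous_on[OF bounded_bilinear_matrix_mult])
  have cs: "continuous_on UNIV (\<lambda>x. star (p x))" if "continuous_on UNIV p" for p :: "('a^'b^'b) \<times> ('a^'b^'b) \<Rightarrow> 'a^'b^'b"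
    using linear_continuous_on_compose[OF that linear_star] .
  have closedT: "closed T"
  proof -
    have "T = {x. fst x \<in> \<gg>} \<inter> {x. snd x \<in> \<gg>} \<inter> {x. bracket h (fst x) = 2 *\<^sub>R fst x} \<inter>
        {x. bracket h (snd x) = 2 *\<^sub>R snd x} \<inter> {x. bracket (fst x) (star (snd x)) = h}"
      by (auto simp: T_def)
    moreover have "closed {x::('a^'b^'b) \<times> ('a^'b^'b). fst x \<in> \<gg>}" "closed {x::('a^'b^'b) \<times> ('a^'b^'b). snd x \<in> \<gg>}"
      using closed_subspace[OF subspace_lie] continuous_closed_vimage[of \<gg> fst] continuous_closed_vimage[of \<gg> snd]
      by (auto simp: vimage_def)
    moreover have "closed {x::('a^'b^'b) \<times> ('a^'b^'b). bracket h (fst x) = 2 *\<^sub>R fst x}"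
      "closed {x::('a^'b^'b) \<times> ('a^'b^'b). bracket h (snd x) = 2 *\<^sub>R snd x}"
      "closed {x. bracket (fst x) (star (snd x)) = h}"
      by (intro closed_Collect_eq cb cs continuous_intros)+
    ultimately show ?thesis by (simp add: closed_Int)
  qed
  define C where "C = closure S"
  have CT: "C \<subseteq> T" unfolding C_def using ST closedT by (rule closure_minimal)
  define N where "N = (\<lambda>x. ip (fst x) (fst x) + ip (snd x) (snd x))"
  have s0: "(e, star f) \<in> S" unfolding S_def using G_one by (intro CollectI exI[of _ "mat 1"]) simp
  have s0C: "(e, star f) \<in> C" unfolding C_def using s0 closure_subset by blast
  obtain c where c: "c > 0" "\<And>x. x \<in> \<gg> \<Longrightarrow> c * (norm x)\<^sup>2 \<le> ip x x" using ip.ip_coercive by blast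
  have Nge: "c * (norm x)\<^sup>2 \<le> N x" if "x \<in> T" for x
  proof -
    obtain v w where x: "x = (v, w)" by fastforce
    have "c * (norm x)\<^sup>2 = c * (norm v)\<^sup>2 + c * (norm w)\<^sup>2" by (simp add: x norm_Pair algebra_simps)
    also have "\<dots> \<le> N x" using that by (auto simp: N_def x T_def intro!: add_mono c)
    finally show ?thesis .
  qed
  \<comment> \<open>Outside this radius the norm exceeds its value at (e, star f), so the minimum
    over the compact \<open>D\<close> is the minimum over the whole closure.\<close>
  define R where "R = sqrt (N (e, star f) / c)"
  define D where "D = C \<inter> cball 0 R"
  have bd: "x \<in> D" if "x \<in> C" "N x \<le> N (e, star f)" for x
  proof -
    have "c * (norm x)\<^sup>2 \<le> N (e, star f)" using Nge[of x] that CT by force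
    then have "(norm x)\<^sup>2 \<le> N (e, star f) / c" using c(1) by (simp add: field_simps)
    then have "norm x \<le> R" unfolding R_def by (rule real_le_rsqrt)
    then show ?thesis using that by (simp add: D_def)
  qed
  have "compact D" unfolding D_def C_def by (intro closed_Int_compact) auto
  moreover have "D \<noteq> {}" using bd[OF s0C] by auto
  moreover have "continuous_on D N"
    unfolding N_def using CT
    by (intro continuous_on_add ip.continuous_on_ip continuous_intros) (auto simp: D_def T_def)
  ultimately obtain x where x: "x \<in> D" "\<And>y. y \<in> D \<Longrightarrow> N x \<le> N y"
    using continuous_attains_inf[of D N] by blast
  have min: "N x \<le> N y" if "y \<in> C" for y
  proof (cases "N y \<le> N (e, star f)")
    case True
    then show ?thesis using bd that x by blast
  next
    case False
    then show ?thesis using x(2)[OF bd[OF s0C]] by simp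
  qed
  obtain v w where xvw: "x = (v, w)" by fastforce
  have xC: "(v, w) \<in> C" using x xvw by (simp add: D_def)
  then have v: "v \<in> \<gg>" "bracket h v = 2 *\<^sub>R v" and w: "w \<in> \<gg>" "bracket h w = 2 *\<^sub>R w"
    and vw: "bracket v (star w) = h" using CT by (auto simp: T_def)
  have "v = w"
  proof (rule minimal_pair_diagonal[OF h sh v w vw])
    fix Y assume Y: "Y \<in> \<gg>" "star Y = Y" "bracket h Y = 0"
    then have Yh: "bracket Y h = 0" using bracket_skew[of Y h] by simp
    let ?\<phi> = "\<lambda>t x. (Ad (mexp (t *\<^sub>R Y)) (fst x), Ad (mexp (- t *\<^sub>R Y)) (snd x))"
    have \<phi>S: "?\<phi> t x \<in> S" if xS: "x \<in> S" for t x
    proof -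
      obtain A where x: "x = (Ad A e, star (Ad A f))" and A: "A \<in> G" "Ad A h = h" using xS unfolding S_def by blast
      let ?B = "mexp (t *\<^sub>R Y)"
      have B: "?B \<in> G" using Y mexp_in_G by blast
      have "star (Ad (?B ** A) f) = Ad (mexp (- t *\<^sub>R Y)) (star (Ad A f))"
        using A B Y f by (simp add: Ad_mult G_invertible star_Ad Ad_in_lie theta_mexp_p)
      moreover have "Ad (?B ** A) e = Ad ?B (Ad A e)" "Ad (?B ** A) h = h"
        using A B Ad_mexp_fixed[OF Yh, of t] by (simp_all add: Ad_mult G_invertible)
      ultimately show ?thesis
        unfolding S_def x using A B by (intro CollectI exI[of _ "?B ** A"]) (simp add: G_mult)
    qed
    \<comment> \<open>The minimiser need not belong to \<open>S\<close>; the action, being linear,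
      extends from \<open>S\<close> to the closure.\<close>
    have \<phi>C: "?\<phi> t x \<in> C" if "x \<in> C" for t x
    proof -
      have "linear (?\<phi> t)"
        by (rule linearI) (simp_all add: linear_add[OF linear_Ad] linear_cmul[OF linear_Ad])
      then have "bounded_linear (?\<phi> t)" by (simp add: linear_conv_bounded_linear)
      then have "?\<phi> t ` closure S \<subseteq> closure (?\<phi> t ` S)" by (rule closure_bounded_linear_image_subset)
      also have "\<dots> \<subseteq> closure S" using \<phi>S by (intro closure_mono) auto
      finally show ?thesis using that unfolding C_def by blast
    qed
    obtain b where b: "bounded_bilinear b" "\<And>x y. x \<in> \<gg> \<Longrightarrow> y \<in> \<gg> \<Longrightarrow> b x y = ip x y"
      using ip.bounded_bilinear_extension by blast
    let ?v = "\<lambda>t. Ad (mexp (t *\<^sub>R Y)) v" let ?w = "\<lambda>t. Ad (mexp (t *\<^sub>R (- Y))) w"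
    have gl: "?v t \<in> \<gg>" "?w t \<in> \<gg>" for t
      using v w Y mexp_in_G[of "- Y"] by (simp_all add: Ad_in_lie mexp_in_G lie_closed)
    let ?g = "\<lambda>t. b (?v t) (?v t) + b (?w t) (?w t)"
    have "(?g has_vector_derivative ((b (?v 0) (bracket Y (?v 0)) + b (bracket Y (?v 0)) (?v 0)) +
        (b (?w 0) (bracket (- Y) (?w 0)) + b (bracket (- Y) (?w 0)) (?w 0)))) (at 0)"
      by (intro has_vector_derivative_add bounded_bilinear.has_vector_derivative[OF b(1)] Ad_mexp_has_vector_derivative)
    then have D: "DERIV ?g 0 :> (2 * ip (bracket Y v) v - 2 * ip (bracket Y w) w)"
      using v w Y by (simp add: has_real_derivative_iff_has_vector_derivative b(2) lie_closed ip.ip_sym[of _ "bracket Y _"]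
          bracket_minus_left ip.ip_minus_left ip.ip_minus_right)
    have Min: "?g 0 \<le> ?g t" for t
    proof -
      have "N x \<le> N (?\<phi> t x)" using \<phi>C[OF xC, of t] min xvw by simp
      then show ?thesis using gl[of t] v w by (simp add: N_def xvw b(2))
    qed
    have "2 * ip (bracket Y v) v - 2 * ip (bracket Y w) w = 0"
      by (rule DERIV_local_min[OF D zero_less_one]) (use Min in blast)
    then show "ip (bracket Y v) v = ip (bracket Y w) w" by simp
  qed
  moreover have "v \<in> closure {Ad A e |A. A \<in> G \<and> Ad A h = h}"
  proof -
    have "fst ` closure S \<subseteq> closure (fst ` S)" by (rule closure_bounded_linear_image_subset[OF bounded_linear_fst])
    also have "\<dots> \<subseteq> closure {Ad A e |A. A \<in> G \<and> Ad A h = h}"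
      by (rule closure_mono) (auto simp: S_def)
    finally show ?thesis using imageI[OF xC, of fst] unfolding C_def by auto
  qed
  ultimately show ?thesis using v vw by blast
qed

text \<open>Exponentials of elements commuting with h move v in every direction of the 2-eigenspace
  of ad h, so near v that eigenspace consists of conjugates of v. The conjugates of e under the
  centraliser of h lie in it and come arbitrarily close to v.\<close>

lemma critical_in_orbit:
  assumes tr: "triple h e f" and sh: "star h = h"
  shows "\<exists>A\<in>G. bracket h (Ad A e) = 2 *\<^sub>R Ad A e \<and> bracket (Ad A e) (star (Ad A e)) = h"
proof -
  note cl = lie_closed star_in_lie
  have h: "h \<in> \<gg>" and e: "e \<in> \<gg>" and he: "bracket h e = 2 *\<^sub>R e" using tr by (auto simp: triple_def)
  obtain v where vcl: "v \<in> closure {Ad A e |A. A \<in> G \<and> Ad A h = h}" and v: "v \<in> \<gg>" "bracket h v = 2 *\<^sub>R v" "bracket v (star v) = h"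
    using critical_in_closure[OF assms] by blast
  have hsv: "bracket h (star v) = - 2 *\<^sub>R star v"
  proof -
    have "star (bracket h v) = bracket (star v) h" by (simp only: star_bracket[OF h v(1)] sh)
    then show ?thesis using v bracket_skew[of h "star v"] by (simp add: linear_cmul[OF linear_star])
  qed
  have g2: "x \<in> gr h 2 \<longleftrightarrow> x \<in> \<gg> \<and> bracket h x = 2 *\<^sub>R x" for x by (simp add: gr_def)
  have v2: "v \<in> gr h 2" using v by (simp add: g2)
  have sv2: "star v \<in> gr h (- 2)" using hsv by (simp add: gr_def star_in_lie)
  \<comment> \<open>T is injective on the 2-eigenspace: T z = 0 gives [star v, z] = 0, and then
    [v, star v] = h gives |[v, z]|^2 = -2 |z|^2. So T is onto, and the elements of weight 0 already
    move v everywhere.\<close>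
  define T where "T = (\<lambda>z. bracket v (bracket (star v) z))"
  have linT: "linear T" unfolding T_def by (rule linear_bracket2)
  have T2: "T z \<in> gr h 2" if "z \<in> gr h 2" for z
    using gr_bracket[OF h v2 gr_bracket[OF h sv2 that]] by (simp add: T_def)
  have inj: "z = 0" if z: "z \<in> gr h 2" "T z = 0" for z
  proof -
    have zg: "z \<in> \<gg>" "bracket h z = 2 *\<^sub>R z" using z by (simp_all add: g2)
    have "ip (bracket (star v) z) (bracket (star v) z) = ip (T z) z"
      using v zg by (simp add: T_def ip_adjoint cl ip.ip_sym[of _ z] star_star)
    also have "\<dots> = 0" using z zg by (simp add: ip.ip_zero_left)
    finally have 0: "bracket (star v) z = 0" using ip.ip_eq_zero v zg by (simp add: cl)
    have "bracket (star v) (bracket v z) = bracket (bracket (star v) v) z + bracket v (bracket (star v) z)"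
      by (simp add: jacobi)
    also have "\<dots> = - bracket h z" using v(3) bracket_skew[of "star v" v] by (simp add: 0 bracket_minus_left)
    finally have 1: "bracket (star v) (bracket v z) = - 2 *\<^sub>R z" using zg by simp
    have "ip (bracket v z) (bracket v z) = ip z (bracket (star v) (bracket v z))"
      using v zg by (simp add: ip_adjoint cl)
    then have "ip (bracket v z) (bracket v z) = - 2 * ip z z"
      using zg by (simp add: 1 ip.ip_minus_right ip.ip_scale_right cl)
    then have "ip z z = 0" using ip.ip_nonneg[OF zg(1)] ip.ip_nonneg[of "bracket v z"] v zg by (simp add: cl)
    then show ?thesis using ip.ip_eq_zero zg by blast
  qed
  have injT: "inj_on T (gr h 2)"
    using linear_injective_on_subspace_0[OF linT subspace_gr] inj by blast
  have "dim (T ` gr h 2) = dim (gr h 2)"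
    using injT by (intro dim_image_eq[OF linT]) (simp add: span_eq_iff[THEN iffD2, OF subspace_gr])
  then have surjT: "T ` gr h 2 = gr h 2"
    using T2 by (intro subspace_dim_equal linear_subspace_image[OF linT] subspace_gr) auto
  obtain T' where T': "range T' \<subseteq> gr h 2" "linear T'" "\<And>z. z \<in> gr h 2 \<Longrightarrow> T' (T z) = z"
    using linear_exists_left_inverse_on[OF linT subspace_gr injT] by blast
  have TT': "T (T' u) = u" if "u \<in> gr h 2" for u
  proof -
    have "u \<in> T ` gr h 2" using that by (simp only: surjT)
    then obtain z where "u = T z" "z \<in> gr h 2" by (rule imageE)
    then show ?thesis using T'(3) by simp
  qed
  \<comment> \<open>A linear choice of an element of weight 0 whose bracket with v is u.\<close>
  define L where "L = (\<lambda>u. - bracket (star v) (T' u))"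
  have linL: "linear L"
    unfolding L_def by (rule linearI) (simp_all add: linear_add[OF T'(2)] linear_cmul[OF T'(2)] bracket_add_right bracket_scale_right)
  have L0: "L u \<in> gr h 0" for u
  proof -
    have "bracket (star v) (T' u) \<in> gr h (- 2 + 2)" using T'(1) by (intro gr_bracket[OF h sv2]) auto
    then show ?thesis unfolding L_def using subspace_neg[OF subspace_gr] by simp
  qed
  have Lv: "bracket (L u) v = u" if "u \<in> gr h 2" for u
  proof -
    have "bracket (L u) v = T (T' u)"
      using bracket_skew[of "L u" v] by (simp add: L_def T_def bracket_minus_right)
    then show ?thesis using TT' that by simp
  qed
  obtain p where p: "linear p" "range p \<subseteq> gr h 2" "\<And>x. x \<in> gr h 2 \<Longrightarrow> p x = x"
    using linear_exists_left_inverse_on[of "\<lambda>x. x" "gr h 2"] subspace_gr by (auto simp: linear_id[unfolded id_def])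
  \<comment> \<open>The summand x - p x extends the orbit map from the 2-eigenspace to all matrices
    with derivative the identity at 0, as the open mapping theorem for the whole space
    requires.\<close>
  define F where "F = (\<lambda>x. Ad (mexp (L (p x))) v + (x - p x))"
  have bl: "bounded_linear (\<lambda>x. ad (L (p x)))"
  proof -
    have "linear (\<lambda>x. ad (L (p x)))"
      by (rule linearI; rule endo_eqI)
        (simp_all add: linear_add[OF p(1)] linear_add[OF linL] linear_cmul[OF p(1)] linear_cmul[OF linL]
          bracket_add_left bracket_scale_left)
    then show ?thesis by (simp add: linear_conv_bounded_linear)
  qed
  have blp: "bounded_linear p" using p(1) by (simp add: linear_conv_bounded_linear)
  have contF: "continuous_on UNIV F"
  proof -
    have "continuous_on UNIV (\<lambda>x. exp (ad (L (p x))))"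
      by (rule continuous_on_compose2[of UNIV exp])
        (auto simp: continuous_on_eq_continuous_at isCont_exp_algebra intro: linear_continuous_at[OF bl])
    then show ?thesis
      unfolding F_def Ad_mexp
      by (intro continuous_intros bounded_linear.continuous_on[OF blp]
          bounded_linear.continuous_on[OF bounded_bilinear.bounded_linear_left[OF bounded_bilinear_app]])
  qed
  have derF: "(F has_derivative (\<lambda>x. x)) (at 0)"
  proof -
    have z: "ad (L (p 0)) = 0" using linear_0[OF bounded_linear.linear[OF bl]] .
    have "((\<lambda>x. exp (ad (L (p x)))) has_derivative (\<lambda>x. ad (L (p x)))) (at 0)"
      using exp_has_derivative_at_0
      by (intro has_derivative_compose[OF bounded_linear_imp_has_derivative[OF bl], of exp "\<lambda>h. h"]) (simp only: z)
    then have "((\<lambda>x. app (exp (ad (L (p x)))) v) has_derivative (\<lambda>x. app (ad (L (p x))) v)) (at 0)"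
      by (rule bounded_linear.has_derivative[OF bounded_bilinear.bounded_linear_left[OF bounded_bilinear_app]])
    then have "(F has_derivative (\<lambda>x. app (ad (L (p x))) v + (x - p x))) (at 0)"
      unfolding F_def Ad_mexp
      by (intro has_derivative_add has_derivative_diff has_derivative_ident bounded_linear_imp_has_derivative[OF blp])
    moreover have "app (ad (L (p x))) v + (x - p x) = x" for x
      using Lv[of "p x"] p(2) by auto
    ultimately show ?thesis by simp
  qed
  have F0: "F 0 = v"
    by (simp add: F_def linear_0[OF p(1)] linear_0[OF linL])
  have "F 0 \<in> interior (F ` UNIV)"
    by (rule sussmann_open_mapping[OF open_UNIV contF _ derF bounded_linear_ident]) (auto simp: o_def id_def)
  then obtain \<epsilon> where eps: "\<epsilon> > 0" "ball v \<epsilon> \<subseteq> range F" by (auto simp: F0 mem_interior)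
  obtain u where u: "u \<in> {Ad A e |A. A \<in> G \<and> Ad A h = h}" "dist u v < \<epsilon>"
    using vcl eps(1) unfolding closure_approachable by blast
  then obtain A where A: "A \<in> G" "Ad A h = h" "u = Ad A e" by blast
  have u2: "u \<in> gr h 2"
    using Ad_bracket[OF G_invertible[OF A(1)], of h e] A e by (simp add: g2 he linear_cmul[OF linear_Ad] Ad_in_lie)
  have "u \<in> range F" using u(2) eps(2) by (auto simp: dist_commute)
  then obtain x where x: "u = F x" by (rule rangeE)
  let ?Y = "L (p x)"
  have Y: "?Y \<in> \<gg>" "bracket h ?Y = 0" using L0[of "p x"] by (auto simp: gr_def)
  then have Yh: "bracket ?Y h = 0" using bracket_skew[of ?Y h] by simp
  have Adh: "Ad (mexp ?Y) h = h" using Ad_mexp_fixed[OF Yh, of 1] by simp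
  have "Ad (mexp ?Y) v \<in> gr h 2"
    using Ad_bracket[OF invertible_mexp, of ?Y h v] Adh v Y by (simp add: g2 linear_cmul[OF linear_Ad] Ad_in_lie mexp_in_G')
  then have "u - Ad (mexp ?Y) v \<in> gr h 2" using u2 by (intro subspace_diff[OF subspace_gr])
  \<comment> \<open>Both u and the conjugate of v have weight 2, hence so has the artificial
    summand; this forces x = p x, and u is a genuine conjugate of v.\<close>
  then have "x - p x \<in> gr h 2" by (simp add: x F_def)
  then have "(x - p x) + p x \<in> gr h 2" using p(2) by (intro subspace_add[OF subspace_gr]) auto
  then have "p x = x" using p(3) by simp
  then have "u = Ad (mexp ?Y) v" by (simp add: x F_def)
  then have "Ad (mexp (- ?Y)) u = v"
    using Ad_mult[OF invertible_mexp invertible_mexp, of "- ?Y" ?Y v] by (simp add: mexp_minus)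
  then have "Ad (mexp (- ?Y) ** A) e = v"
    using A by (simp add: Ad_mult invertible_mexp G_invertible)
  moreover have "mexp (- ?Y) ** A \<in> G"
    using A Y by (intro G_mult mexp_in_G') (simp_all add: lie_closed)
  ultimately show ?thesis using v by (intro bexI[of _ "mexp (- ?Y) ** A"]) simp_all
qed

end

section \<open>Simultaneous diagonalisation of the two inner products on p\<close>

lemma quadratic_nonneg_linear_zero:
  assumes "\<And>t::real. 0 \<le> t * a + t\<^sup>2 * b"
  shows "a = 0"
proof (rule ccontr)
  assume a: "a \<noteq> 0"
  define c where "c = \<bar>b\<bar> + 1"
  \<comment> \<open>A step against the sign of a, short enough for the linear term to outweigh the
    quadratic one.\<close>
  define t where "t = - a / c"
  have c: "c > 0" "b < c" by (auto simp: c_def)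
  have "t * a + t\<^sup>2 * b = a\<^sup>2 * (b - c) / c\<^sup>2"
    using c by (simp add: t_def field_simps power2_eq_square)
  also have "\<dots> < 0"
    using a c by (intro divide_neg_pos mult_pos_neg) auto
  finally show False using assms[of t] by simp
qed

lemma span_Union_sum:
  assumes V: "\<And>r::'r. subspace (V r)" and x: "x \<in> span (\<Union>r. V r)"
  shows "\<exists>I f. finite I \<and> (\<forall>r. f r \<in> V r) \<and> x = (\<Sum>r\<in>I. f r)"
  using x
proof (induction rule: span_induct_alt)
  case base
  show ?case using V by (intro exI[of _ "{}"] exI[of _ "\<lambda>_. 0"]) (simp add: subspace_0)
next
  case (step c x y)
  then obtain I f where f: "finite I" "\<And>r. f r \<in> V r" "y = (\<Sum>r\<in>I. f r)" by blast
  from step obtain s where s: "x \<in> V s" by blast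
  let ?g = "\<lambda>r. (if r = s then c *\<^sub>R x else 0) + (if r \<in> I then f r else 0)"
  have "?g r \<in> V r" for r using f(2) s V by (auto intro: subspace_add subspace_scale subspace_0)
  moreover have "(\<Sum>r\<in>insert s I. ?g r) = c *\<^sub>R x + y"
  proof -
    have "(\<Sum>r\<in>insert s I. if r = s then c *\<^sub>R x else 0) = c *\<^sub>R x" using f(1) by simp
    moreover have "(\<Sum>r\<in>insert s I. if r \<in> I then f r else 0) = y"
      unfolding f(3) using f(1) by (intro sum.mono_neutral_cong_right) auto
    ultimately show ?thesis by (simp only: sum.distrib)
  qed
  ultimately show ?case using f(1) by (intro exI[of _ "insert s I"] exI[of _ ?g]) simp
qed

lemma exp_eigenvector:
  assumes "app D x = c *\<^sub>R x"
  shows "app (exp D) x = exp c *\<^sub>R x"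
proof -
  have pow: "(app D ^^ k) x = c ^ k *\<^sub>R x" for k
    by (induction k) (simp_all add: assms linear_cmul[OF linear_app])
  have "(\<lambda>k. (c ^ k /\<^sub>R fact k) *\<^sub>R x) sums (exp c *\<^sub>R x)"
    by (intro sums_scaleR_left exp_converges)
  then show ?thesis using app_exp[of D x] sums_unique2 by (fastforce simp: pow)
qed

locale moment_setup = compatible_ip +
  fixes ipg :: "'a^'b^'b \<Rightarrow> 'a^'b^'b \<Rightarrow> real"
  assumes ipg_inner: "inner_product_on (lie_algebra G) ipg"
    and ipg_skew: "Z \<in> lie_algebra G \<Longrightarrow> sig Z = Z \<Longrightarrow> X \<in> lie_algebra G \<Longrightarrow> Y \<in> lie_algebra G \<Longrightarrow>
      ipg (bracket Z X) Y = - ipg X (bracket Z Y)"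
    and ipg_sig: "X \<in> lie_algebra G \<Longrightarrow> Y \<in> lie_algebra G \<Longrightarrow> ipg (sig X) (sig Y) = ipg X Y"
begin

sublocale ipg: ip_space \<gg> ipg
  by unfold_locales (rule subspace_lie, rule ipg_inner)

lemmas cl = lie_closed star_in_lie

definition pp :: "('a^'b^'b) set" where "pp = {X \<in> \<gg>. star X = X}"

lemma subspace_pp: "subspace pp"
  using subspace_lie unfolding pp_def
  by (auto simp: subspace_def linear_add[OF linear_star] linear_cmul[OF linear_star] linear_0[OF linear_star])

lemma pp_lie: "pp \<subseteq> \<gg>" by (auto simp: pp_def)

lemma pp_k_bracket: "X \<in> pp \<Longrightarrow> Z \<in> \<gg> \<Longrightarrow> star Z = - Z \<Longrightarrow> bracket Z X \<in> pp"
  by (simp add: pp_def cl star_bracket bracket_minus_right) (rule bracket_skew[symmetric])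

text \<open>The eigenspaces of the operator on p that relates the two forms, written without naming
  the operator.\<close>

definition pr :: "real \<Rightarrow> ('a^'b^'b) set" where
  "pr r = {x \<in> pp. \<forall>y\<in>pp. ip x y = r * ipg x y}"

lemma pr_pp: "x \<in> pr r \<Longrightarrow> x \<in> pp" by (simp add: pr_def)

lemma pr_lie: "x \<in> pr r \<Longrightarrow> x \<in> \<gg>" using pr_pp pp_lie by blast

lemma subspace_pr: "subspace (pr r)"
  using subspace_pp pp_lie unfolding pr_def
  by (auto simp: subspace_def ip.ip_add_left ipg.ip_add_left ip.ip_scale_left ipg.ip_scale_left
      ip.ip_zero_left ipg.ip_zero_left algebra_simps subset_iff)

lemma pr_orthogonal:
  assumes "x \<in> pr r" "y \<in> pr s" "r \<noteq> s"
  shows "ipg x y = 0" "ip x y = 0"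
proof -
  have xy: "x \<in> \<gg>" "y \<in> \<gg>" using assms pr_lie by auto
  have 1: "ip x y = r * ipg x y" using assms by (simp add: pr_def)
  have "ip y x = s * ipg y x" using assms by (simp add: pr_def)
  then have "ip x y = s * ipg x y" using ip.ip_sym[OF xy] ipg.ip_sym[OF xy] by simp
  then have "(r - s) * ipg x y = 0" using 1 by (simp add: algebra_simps)
  then show "ipg x y = 0" using assms(3) by simp
  then show "ip x y = 0" using 1 by simp
qed

text \<open>For Z in k, ad Z preserves p and is skew for both forms, so it commutes with the
  operator that relates them.\<close>

lemma pr_stable:
  assumes x: "x \<in> pr r" and Z: "Z \<in> \<gg>" "star Z = - Z"
  shows "bracket Z x \<in> pr r"
proof -
  have xp: "x \<in> pp" using x pr_pp by blast
  have "sig Z = Z" using Z by (simp add: star_def)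
  have "ip (bracket Z x) y = r * ipg (bracket Z x) y" if y: "y \<in> pp" for y
  proof -
    have xyg: "x \<in> \<gg>" "y \<in> \<gg>" using xp y pp_lie by auto
    have "ip (bracket Z x) y = - ip x (bracket Z y)"
      using xyg Z by (simp add: ip_adjoint bracket_minus_left ip.ip_minus_right cl)
    also have "\<dots> = - (r * ipg x (bracket Z y))"
      using x pp_k_bracket[OF y Z] by (simp add: pr_def)
    also have "\<dots> = r * ipg (bracket Z x) y"
      using ipg_skew[OF Z(1) \<open>sig Z = Z\<close> xyg] by simp
    finally show ?thesis .
  qed
  then show ?thesis using pp_k_bracket[OF xp Z] by (simp add: pr_def)
qed

text \<open>Z = [X, Y] lies in k, so [Z, X] stays in \<open>pr r\<close> and is orthogonal to Y,
  while |Z|^2 = -<Y, [Z, X]>.\<close>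

lemma pr_commute:
  assumes X: "X \<in> pr r" and Y: "Y \<in> pr s" and rs: "r \<noteq> s"
  shows "bracket X Y = 0"
proof -
  have XY: "X \<in> \<gg>" "Y \<in> \<gg>" "star X = X" "star Y = Y" using X Y pr_pp by (auto simp: pp_def)
  let ?Z = "bracket X Y"
  have Z: "?Z \<in> \<gg>" "star ?Z = - ?Z"
    using XY bracket_skew[of Y X] by (simp_all add: cl star_bracket)
  have "ip ?Z ?Z = ip Y (bracket X ?Z)" using XY Z by (simp add: ip_adjoint)
  also have "\<dots> = - ip Y (bracket ?Z X)"
    using XY Z bracket_skew[of X ?Z] by (simp add: ip.ip_minus_right cl)
  also have "ip Y (bracket ?Z X) = 0"
    using pr_orthogonal(2)[OF Y pr_stable[OF X Z]] rs by simp
  finally show ?thesis using ip.ip_eq_zero[OF Z(1)] by simp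
qed

text \<open>The spectral theorem for the pair of inner products: a maximiser of the Rayleigh quotient on the
  orthogonal complement of all eigenspaces would itself be an eigenvector.\<close>

lemma pp_span_pr: "pp \<subseteq> span (\<Union>r. pr r)"
proof
  fix x assume x: "x \<in> pp"
  let ?W = "span (\<Union>r. pr r)"
  have Wp: "?W \<subseteq> pp" by (intro span_minimal subspace_pp) (auto dest: pr_pp)
  have Wg: "?W \<subseteq> \<gg>" using Wp pp_lie by blast
  define Q where "Q = {y \<in> pp. \<forall>z\<in>?W. ipg y z = 0}"
  have Qg: "Q \<subseteq> \<gg>" using pp_lie by (auto simp: Q_def)
  have subQ: "subspace Q"
    using subspace_pp pp_lie Wg unfolding Q_def
    by (auto simp: subspace_def ipg.ip_add_left ipg.ip_scale_left ipg.ip_zero_left subset_iff)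
  have "Q \<subseteq> {0}"
  proof (rule ccontr)
    assume "\<not> Q \<subseteq> {0}"
    then obtain q where q: "q \<in> Q" "q \<noteq> 0" by blast
    let ?U = "{y \<in> Q. ipg y y = 1}"
    have cont: "continuous_on Q (\<lambda>y. ipg y y)" "continuous_on Q (\<lambda>y. ip y y)"
      using Qg by (intro ipg.continuous_on_ip ip.continuous_on_ip continuous_intros; blast)+
    obtain c where c: "c > 0" "\<And>y. y \<in> \<gg> \<Longrightarrow> c * (norm y)\<^sup>2 \<le> ipg y y" using ipg.ip_coercive by blast
    have "closed ?U"
      using continuous_closed_preimage[OF cont(1) closed_subspace[OF subQ], of "{1}"]
      by (simp add: vimage_def Int_def)
    moreover have "bounded ?U"
    proof -
      have "norm y \<le> sqrt (1 / c)" if "y \<in> ?U" for y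
        using c(2)[of y] that Qg c(1) by (intro real_le_rsqrt) (auto simp: field_simps)
      then show ?thesis by (auto simp: bounded_iff)
    qed
    ultimately have "compact ?U" by (simp add: compact_eq_bounded_closed)
    moreover have "?U \<noteq> {}"
    proof -
      have pos: "ipg q q > 0" using q Qg by (intro ipg.ip_pos) auto
      have "ipg ((1 / sqrt (ipg q q)) *\<^sub>R q) ((1 / sqrt (ipg q q)) *\<^sub>R q) = 1"
        using q Qg pos by (simp add: ipg.ip_scale_left ipg.ip_scale_right cl subset_iff)
      then have "(1 / sqrt (ipg q q)) *\<^sub>R q \<in> ?U" using q subQ by (simp add: subspace_scale)
      then show ?thesis by blast
    qed
    moreover have "continuous_on ?U (\<lambda>y. ip y y)" using cont(2) by (rule continuous_on_subset) auto
    ultimately obtain m where m: "m \<in> ?U" "\<And>y. y \<in> ?U \<Longrightarrow> ip y y \<le> ip m m"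
      using continuous_attains_sup[of ?U "\<lambda>y. ip y y"] by blast
    have mQ: "m \<in> Q" and mm: "ipg m m = 1" using m by auto
    have mg: "m \<in> \<gg>" using mQ Qg by blast
    define r where "r = ip m m"
    have le: "ip y y \<le> r * ipg y y" if y: "y \<in> Q" for y
    proof (cases "y = 0")
      case True
      then show ?thesis by (simp add: ip.ip_zero_left ipg.ip_zero_left cl)
    next
      case False
      have yg: "y \<in> \<gg>" using y Qg by blast
      have pos: "ipg y y > 0" using False yg by (rule ipg.ip_pos[rotated])
      let ?u = "(1 / sqrt (ipg y y)) *\<^sub>R y"
      have "ipg ?u ?u = 1" using yg pos by (simp add: ipg.ip_scale_left ipg.ip_scale_right cl)
      then have "ip ?u ?u \<le> r" unfolding r_def using y subQ by (intro m(2)) (simp add: subspace_scale)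
      moreover have "ip ?u ?u = ip y y / ipg y y" using yg pos by (simp add: ip.ip_scale_left ip.ip_scale_right cl)
      ultimately show ?thesis using pos by (simp add: field_simps)
    qed
    have eqQ: "ip m y = r * ipg m y" if y: "y \<in> Q" for y
    proof -
      have yg: "y \<in> \<gg>" using y Qg by blast
      \<comment> \<open>The Rayleigh inequality \<open>le\<close> along the line m + t y, with
        equality at t = 0; its linear term must vanish.\<close>
      have "0 \<le> t * (2 * (r * ipg m y - ip m y)) + t\<^sup>2 * (r * ipg y y - ip y y)" for t
      proof -
        have "m + t *\<^sub>R y \<in> Q" using mQ y subQ by (simp add: subspace_add subspace_scale)
        from le[OF this] show ?thesis
          using mg yg mm
          by (simp add: ip.ip_add_left ip.ip_add_right ip.ip_scale_left ip.ip_scale_right ipg.ip_add_left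
              ipg.ip_add_right ipg.ip_scale_left ipg.ip_scale_right cl ip.ip_sym[of y m] ipg.ip_sym[of y m]
              power2_eq_square algebra_simps flip: r_def)
      qed
      then show ?thesis using quadratic_nonneg_linear_zero by fastforce
    qed
    \<comment> \<open>m is orthogonal to the eigenspaces for \<open>ipg\<close>, hence also for
      \<open>ip\<close> by the eigenvalue equation; both sides are 0.\<close>
    have eqW: "ip m y = r * ipg m y" if y: "y \<in> ?W" for y
    proof -
      have "?W \<subseteq> {y \<in> \<gg>. ip m y = 0}"
      proof (rule span_minimal)
        show "subspace {y \<in> \<gg>. ip m y = 0}"
          using subspace_lie mg by (auto simp: subspace_def ip.ip_add_right ip.ip_scale_right ip.ip_zero_right)
        have "ip m z = 0" if z: "z \<in> pr s" for z s
        proof -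
          have "z \<in> ?W" using z by (intro span_base) auto
          then have "ipg m z = 0" using mQ by (simp add: Q_def)
          moreover have "ip z m = s * ipg z m" using z mQ by (simp add: pr_def Q_def)
          ultimately show ?thesis using mg pr_lie[OF z] by (simp add: ip.ip_sym ipg.ip_sym)
        qed
        then show "(\<Union>r. pr r) \<subseteq> {y \<in> \<gg>. ip m y = 0}" using pr_lie by blast
      qed
      moreover have "ipg m y = 0" using mQ y by (simp add: Q_def)
      ultimately show ?thesis using y by auto
    qed
    have "ip m y = r * ipg m y" if y: "y \<in> pp" for y
    proof -
      have yg: "y \<in> \<gg>" using y pp_lie by blast
      obtain w where w: "w \<in> ?W" "\<And>z. z \<in> ?W \<Longrightarrow> ipg (y - w) z = 0"
        using ipg.projection[OF subspace_span Wg yg] by blast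
      have "y - w \<in> Q" using w Wp y subspace_pp by (auto simp: Q_def subspace_diff)
      then have "ip m (y - w) = r * ipg m (y - w)" by (rule eqQ)
      moreover have "w \<in> \<gg>" using w Wg by blast
      ultimately show ?thesis using eqW[OF w(1)] mg yg
        by (simp add: ip.ip_diff_right ipg.ip_diff_right algebra_simps)
    qed
    then have "m \<in> pr r" using mQ by (simp add: pr_def Q_def)
    then have "m \<in> ?W" by (intro span_base) auto
    then show False using mQ mm by (auto simp: Q_def)
  qed
  moreover obtain w where w: "w \<in> ?W" "\<And>z. z \<in> ?W \<Longrightarrow> ipg (x - w) z = 0"
    using ipg.projection[OF subspace_span Wg] x pp_lie by blast
  moreover have "x - w \<in> Q" using w Wp x subspace_pp by (auto simp: Q_def subspace_diff)
  ultimately show "x \<in> ?W" by auto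
qed

text \<open>Split z into its k and p parts. For b in k, [Y, b] stays in \<open>pr s\<close> and
  commutes with X. Within p, every eigenspace commutes with X or with Y, and X commutes with
  Y.\<close>

lemma pr_double_bracket:
  assumes X: "X \<in> pr r" and Y: "Y \<in> pr s" and rs: "r \<noteq> s" and z: "z \<in> \<gg>"
  shows "bracket X (bracket Y z) = 0"
proof -
  obtain a b where ab: "a \<in> \<gg>" "star a = a" and b: "b \<in> \<gg>" "star b = - b" and z_eq: "z = a + b"
    using star_decomposition[OF z] by blast
  have a: "a \<in> pp" using ab by (simp add: pp_def)
  have "bracket X (bracket b Y) = 0" using pr_commute[OF X pr_stable[OF Y b] rs] .
  then have 1: "bracket X (bracket Y b) = 0" by (simp only: bracket_skew[of Y b] bracket_minus_right) simp
  have lin: "linear (\<lambda>z. bracket X (bracket Y z))" by (rule linear_bracket2)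
  have "(\<Union>t. pr t) \<subseteq> {z. bracket X (bracket Y z) = 0}"
  proof safe
    fix u t assume u: "u \<in> pr t"
    show "bracket X (bracket Y u) = 0"
    proof (cases "t = s")
      case True
      then have "bracket X u = 0" using pr_commute[OF X u] rs by simp
      then show ?thesis
        using jacobi[of X Y u] pr_commute[OF X Y rs] by simp
    next
      case False
      then show ?thesis using pr_commute[OF Y u] by simp
    qed
  qed
  then have "span (\<Union>t. pr t) \<subseteq> {z. bracket X (bracket Y z) = 0}"
    using linear_subspace_kernel[OF lin] by (rule span_minimal)
  then have 2: "bracket X (bracket Y a) = 0" using a pp_span_pr by blast
  show ?thesis
    by (simp only: z_eq bracket_add_right 1 2 add_0_left)
qed

text \<open>Let f r be the components of h and c r = [f r, e] / 2, so that e is the sum of the c r.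
  Each eigenspace acts on e through its own c r, so the c r can be rescaled independently. On
  \<open>pr r\<close> the form <[X, e], e> is r times \<open>ipg h X\<close>, and scaling c r by t
  multiplies it by t^2; so t^2 r = 1 is needed.\<close>

theorem balanced_in_orbit:
  assumes h: "h \<in> \<gg>" "star h = h" and e: "e \<in> \<gg>" "bracket h e = 2 *\<^sub>R e" "bracket e (star e) = h"
  shows "\<exists>A\<in>G. bracket h (Ad A e) = 2 *\<^sub>R Ad A e \<and> (\<forall>X\<in>pp. ipg h X = ip (bracket X (Ad A e)) (Ad A e))"
proof -
  have hp: "h \<in> pp" using h by (simp add: pp_def)
  obtain I0 f where f: "finite I0" "\<And>r. f r \<in> pr r" "h = (\<Sum>r\<in>I0. f r)"
    using span_Union_sum[of pr h] subspace_pr pp_span_pr hp by blast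
  \<comment> \<open>Zero components are dropped: r > 0 is read off from the positivity of both forms
    at f r.\<close>
  define I where "I = {r \<in> I0. f r \<noteq> 0}"
  have I: "finite I" using f by (simp add: I_def)
  have hI: "h = (\<Sum>r\<in>I. f r)" unfolding f(3) I_def using f(1) by (intro sum.mono_neutral_right) auto
  have fg: "f r \<in> \<gg>" for r using f(2) pr_lie by blast
  have pos: "r > 0" if "r \<in> I" for r
  proof -
    have "f r \<noteq> 0" using that by (simp add: I_def)
    then have "ip (f r) (f r) > 0" "ipg (f r) (f r) > 0" using fg ip.ip_pos ipg.ip_pos by blast+
    moreover have "ip (f r) (f r) = r * ipg (f r) (f r)" using f(2)[of r] by (simp add: pr_def)
    ultimately show ?thesis by (metis zero_less_mult_pos2)
  qed
  define c where "c = (\<lambda>r. (1/2) *\<^sub>R bracket (f r) e)"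
  have cg: "c r \<in> \<gg>" for r using fg e by (simp add: c_def cl)
  have br_sum: "bracket (sum a I) x = (\<Sum>r\<in>I. bracket (a r) x)" "bracket x (sum a I) = (\<Sum>r\<in>I. bracket x (a r))"
    for a and x :: "'a^'b^'b"
    using I by (induction I rule: finite_induct) (simp_all add: bracket_add_left bracket_add_right)
  have e_sum: "e = (\<Sum>r\<in>I. c r)"
  proof -
    have "(\<Sum>r\<in>I. c r) = (1/2) *\<^sub>R bracket h e"
      by (simp add: c_def hI br_sum scaleR_sum_right)
    then show ?thesis using e by simp
  qed
  have fc0: "bracket x (c r) = 0" if "x \<in> pr s" "s \<noteq> r" for x r s
    using pr_double_bracket[OF that(1) f(2) that(2) e(1)] by (simp add: c_def bracket_scale_right)
  have sum_single: "(\<Sum>r\<in>I. a r) = a s" if "s \<in> I" "\<And>r. r \<in> I \<Longrightarrow> r \<noteq> s \<Longrightarrow> a r = 0" for a :: "real \<Rightarrow> 'a^'b^'b" and s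
    using I that by (subst sum.remove[OF I that(1)]) (simp add: sum.neutral)
  have fe: "bracket x e = bracket x (c s)" if "x \<in> pr s" "s \<in> I" for x s
  proof -
    have "bracket x e = (\<Sum>r\<in>I. bracket x (c r))" by (subst e_sum) (simp only: br_sum)
    also have "\<dots> = bracket x (c s)" using fc0[OF that(1)] that(2) by (intro sum_single) auto
    finally show ?thesis .
  qed
  have fc: "bracket (f s) (c s) = 2 *\<^sub>R c s" if "s \<in> I" for s
    using fe[OF f(2) that] by (simp add: c_def)
  \<comment> \<open>ad Y acts on c r as 2 s r, so exp scales c r by exp (2 s r) = 1 / sqrt r, the
    solution of t^2 r = 1.\<close>
  define s where "s = (\<lambda>r::real. - ln r / 4)"
  define Y where "Y = (\<Sum>r\<in>I. s r *\<^sub>R f r)"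
  have Yg: "Y \<in> \<gg>" unfolding Y_def by (intro subspace_sum[OF subspace_lie] cl fg)
  define t where "t = (\<lambda>r. exp (2 * s r))"
  have t2: "t r * t r * r = 1" if "r \<in> I" for r
  proof -
    have "t r * t r = exp (- ln r)" by (simp add: t_def s_def flip: exp_add)
    then show ?thesis using pos[OF that] by (simp add: exp_minus)
  qed
  have Yc: "bracket Y (c r) = (2 * s r) *\<^sub>R c r" if "r \<in> I" for r
  proof -
    have "bracket Y (c r) = (\<Sum>q\<in>I. s q *\<^sub>R bracket (f q) (c r))"
      by (simp only: Y_def br_sum bracket_scale_left)
    also have "\<dots> = s r *\<^sub>R bracket (f r) (c r)"
      using fc0[OF f(2)] that by (intro sum_single) auto
    finally show ?thesis using fc[OF that] by simp
  qed
  define v where "v = Ad (mexp Y) e"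
  have v: "v = (\<Sum>r\<in>I. t r *\<^sub>R c r)"
  proof -
    have "v = (\<Sum>r\<in>I. app (exp (ad Y)) (c r))"
      unfolding v_def Ad_mexp by (subst e_sum) (rule linear_sum[OF linear_app])
    also have "\<dots> = (\<Sum>r\<in>I. t r *\<^sub>R c r)"
      unfolding t_def using Yc by (intro sum.cong refl exp_eigenvector) simp
    finally show ?thesis .
  qed
  have vg: "v \<in> \<gg>" unfolding v by (intro subspace_sum[OF subspace_lie] cl cg)
  have hc: "bracket h (c r) = 2 *\<^sub>R c r" if "r \<in> I" for r
  proof -
    have "bracket h (c r) = (\<Sum>q\<in>I. bracket (f q) (c r))" by (subst hI) (simp only: br_sum)
    also have "\<dots> = bracket (f r) (c r)" using fc0[OF f(2)] that by (intro sum_single) auto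
    finally show ?thesis using fc[OF that] by simp
  qed
  have hv: "bracket h v = 2 *\<^sub>R v"
  proof -
    have "bracket h v = (\<Sum>r\<in>I. t r *\<^sub>R bracket h (c r))" by (simp only: v br_sum bracket_scale_right)
    also have "\<dots> = (\<Sum>r\<in>I. 2 *\<^sub>R (t r *\<^sub>R c r))" using hc by (intro sum.cong) auto
    finally show ?thesis by (simp only: v scaleR_sum_right)
  qed
  have xv: "bracket x v = (if q \<in> I then t q *\<^sub>R bracket x e else 0)" if "x \<in> pr q" for x q
  proof -
    have "bracket x v = (\<Sum>r\<in>I. t r *\<^sub>R bracket x (c r))" by (simp only: v br_sum bracket_scale_right)
    also have "\<dots> = (if q \<in> I then t q *\<^sub>R bracket x e else 0)"
    proof (cases "q \<in> I")
      case True
      have "(\<Sum>r\<in>I. t r *\<^sub>R bracket x (c r)) = t q *\<^sub>R bracket x (c q)"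
        using fc0[OF that] True by (intro sum_single) auto
      then show ?thesis using True fe[OF that] by simp
    next
      case False
      then have "bracket x (c r) = 0" if "r \<in> I" for r using fc0[OF \<open>x \<in> pr q\<close>, of r] that by metis
      then show ?thesis using False by (simp add: sum.neutral)
    qed
    finally show ?thesis .
  qed
  have moment: "ip (bracket x e) e = ip x h" if "x \<in> \<gg>" for x
  proof -
    have "ip (bracket x e) e = - ip (bracket e x) e"
      using that e by (simp only: bracket_skew[of x e] ip.ip_minus_left cl)
    also have "\<dots> = - ip x (bracket (star e) e)" using that e by (simp add: ip_adjoint)
    also have "\<dots> = ip x h"
      using that e h by (simp only: bracket_skew[of "star e" e] ip.ip_minus_right cl)
    finally show ?thesis .
  qed
  have gen: "ipg h x = ip (bracket x v) v" if x: "x \<in> pr q" for x q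
  proof -
    have xg: "x \<in> \<gg>" "star x = x" using pr_pp[OF x] by (auto simp: pp_def)
    have xh: "ip x h = q * ipg x h" using x hp by (simp add: pr_def)
    show ?thesis
    proof (cases "q \<in> I")
      case True
      have "ip (bracket x v) v = t q * ip (bracket x e) v"
        using xv[OF x] True xg e vg by (simp add: ip.ip_scale_left cl)
      also have "ip (bracket x e) v = ip e (bracket x v)" using xg e vg by (simp add: ip_adjoint)
      also have "\<dots> = t q * ip e (bracket x e)"
        using xv[OF x] True xg e by (simp add: ip.ip_scale_right cl)
      also have "ip e (bracket x e) = ip x h" using moment[OF xg(1)] xg e by (simp add: ip.ip_sym cl)
      finally have "ip (bracket x v) v = (t q * t q * q) * ipg x h" by (simp add: xh)
      then show ?thesis using t2[OF True] xg h by (simp add: ipg.ip_sym)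
    next
      case False
      have "ipg x h = (\<Sum>r\<in>I. ipg x (f r))"
        unfolding hI using I fg xg by (intro ipg.ip_sum_right) auto
      also have "\<dots> = 0"
      proof (intro sum.neutral ballI)
        fix r assume "r \<in> I"
        then have "q \<noteq> r" using False by blast
        then show "ipg x (f r) = 0" by (rule pr_orthogonal(1)[OF x f(2)])
      qed
      finally show ?thesis using xv[OF x] False xg h vg by (simp add: ipg.ip_sym ip.ip_zero_left)
    qed
  qed
  have "ipg h X = ip (bracket X v) v" if X: "X \<in> pp" for X
  proof -
    have "subspace {X \<in> \<gg>. ipg h X = ip (bracket X v) v}"
      using subspace_lie h vg
      by (auto simp: subspace_def ipg.ip_add_right ipg.ip_scale_right ipg.ip_zero_right bracket_add_left
          bracket_scale_left ip.ip_add_left ip.ip_scale_left ip.ip_zero_left cl)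
    moreover have "(\<Union>r. pr r) \<subseteq> {X \<in> \<gg>. ipg h X = ip (bracket X v) v}" using gen pr_lie by blast
    ultimately have "span (\<Union>r. pr r) \<subseteq> {X \<in> \<gg>. ipg h X = ip (bracket X v) v}" by (rule span_minimal[rotated])
    then show ?thesis using X pp_span_pr by blast
  qed
  then show ?thesis using hv Yg unfolding v_def by (intro bexI[of _ "mexp Y"] conjI ballI) (simp_all add: mexp_in_G')
qed

end

section \<open>Critical points of the moment map and the null cone\<close>

context moment_setup
begin

lemma p_part_eq: "p_part G \<theta> = pp"
  by (auto simp: p_part_def pp_def star_def sig_eq) (metis minus_minus)

text \<open>The defining equation has to be checked on p only. On k the left side vanishes because
  \<theta> preserves \<open>ipg\<close> and changes the sign of M but not of k; the right side
  vanishes because k acts by skew maps.\<close>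

lemma moment_map_eq:
  assumes v: "v \<in> \<gg>" and M: "M \<in> pp" "\<And>X. X \<in> pp \<Longrightarrow> ipg M X = 2 * ip (bracket X v) v"
  shows "moment_map G \<theta> ip ipg v = M"
proof -
  have Mg: "M \<in> \<gg>" using M pp_lie by blast
  have all: "ipg M X = 2 * ip (bracket X v) v" if X: "X \<in> \<gg>" for X
  proof -
    obtain a b where ag: "a \<in> \<gg>" and sa: "star a = a" and b: "b \<in> \<gg>" "star b = - b" and eq: "X = a + b"
      using star_decomposition[OF X] by blast
    have a: "a \<in> pp" using ag sa by (simp add: pp_def)
    have "ipg M b = ipg (sig M) (sig b)" using ipg_sig[OF Mg b(1)] by simp
    also have "sig M = - M" using M(1) by (simp add: pp_def star_def) (metis minus_minus)
    also have "sig b = b" using b(2) by (simp add: star_def)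
    finally have 1: "ipg M b = 0" using ipg.ip_minus_left[OF Mg b(1)] by simp
    have "ip (bracket b v) v = - ip v (bracket b v)"
      using ip_adjoint[OF b(1) v v] b v by (simp only: b(2) bracket_minus_left ip.ip_minus_right cl)
    then have 2: "ip (bracket b v) v = 0" using ip.ip_sym[of "bracket b v" v] b(1) v by (simp only: cl)
    have "ipg M X = ipg M a + ipg M b" using ipg.ip_add_right[OF ag b(1) Mg] by (simp only: eq[symmetric])
    moreover have "ip (bracket X v) v = ip (bracket a v) v + ip (bracket b v) v"
      using ip.ip_add_left[OF bracket_in_lie[OF ag v] bracket_in_lie[OF b(1) v] v]
      by (simp only: bracket_add_left[symmetric] eq[symmetric])
    ultimately show ?thesis using M(2)[OF a] 1 2 by simp
  qed
  show ?thesis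
    unfolding moment_map_def p_part_eq
  proof (rule the_equality)
    show "M \<in> pp \<and> (\<forall>X\<in>\<gg>. ipg M X = 2 * ip (bracket X v) v)" using M all by blast
    fix M' assume "M' \<in> pp \<and> (\<forall>X\<in>\<gg>. ipg M' X = 2 * ip (bracket X v) v)"
    then show "M' = M" using all Mg pp_lie by (intro ipg.ip_eqI) auto
  qed
qed

text \<open>In an orthonormal basis of p the function becomes a quotient of polynomials, whose
  derivative is a multiple of <[m(v), v], w> |v|^2 - |m(v)|^2 <v, w>.\<close>

lemma distinguishedI:
  assumes v: "v \<in> \<gg>" and h: "h \<in> pp" and hv: "bracket h v = 2 *\<^sub>R v"
    and mom: "\<And>X. X \<in> pp \<Longrightarrow> ipg h X = ip (bracket X v) v"
  shows "distinguished G \<theta> ip ipg v"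
proof (cases "v = 0")
  case True
  then show ?thesis using v by (simp add: distinguished_def)
next
  case False
  have hg: "h \<in> \<gg>" using h pp_lie by blast
  obtain B where B: "ipg.orthonormal B" "span B = pp"
    using ipg.orthonormal_basis_subspace[OF subspace_pp pp_lie] .
  have fin: "finite B" and Bg: "\<And>b. b \<in> B \<Longrightarrow> b \<in> \<gg>"
    and orth: "\<And>b c. b \<in> B \<Longrightarrow> c \<in> B \<Longrightarrow> ipg b c = (if b = c then 1 else 0)"
    using B(1) by (auto simp: ipg.orthonormal_def)
  have Bp: "b \<in> pp" if "b \<in> B" for b using B(2) that span_base by blast
  have ipg_sum: "ipg (\<Sum>b\<in>B. q b *\<^sub>R b) (\<Sum>b\<in>B. q b *\<^sub>R b) = (\<Sum>b\<in>B. (q b)\<^sup>2)"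
    and ipg_sum1: "c \<in> B \<Longrightarrow> ipg (\<Sum>b\<in>B. q b *\<^sub>R b) c = q c" for q c
  proof -
    have sg: "(\<Sum>b\<in>B. q b *\<^sub>R b) \<in> \<gg>" by (intro subspace_sum[OF subspace_lie] cl Bg)
    show 1: "ipg (\<Sum>b\<in>B. q b *\<^sub>R b) c = q c" if c: "c \<in> B" for c
    proof -
      have "ipg (\<Sum>b\<in>B. q b *\<^sub>R b) c = (\<Sum>b\<in>B. ipg (q b *\<^sub>R b) c)"
        using fin Bg c by (intro ipg.ip_sum_left) (auto intro: cl)
      also have "\<dots> = (\<Sum>b\<in>B. if b = c then q c else 0)"
        using c Bg orth by (intro sum.cong) (auto simp: ipg.ip_scale_left)
      finally show ?thesis using fin c by simp
    qed
    have "ipg (\<Sum>b\<in>B. q b *\<^sub>R b) (\<Sum>b\<in>B. q b *\<^sub>R b) = (\<Sum>b\<in>B. ipg (\<Sum>b\<in>B. q b *\<^sub>R b) (q b *\<^sub>R b))"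
      using fin Bg sg by (intro ipg.ip_sum_right) (auto intro: cl)
    also have "\<dots> = (\<Sum>b\<in>B. (q b)\<^sup>2)"
      using 1 sg Bg by (intro sum.cong) (auto simp: ipg.ip_scale_right power2_eq_square)
    finally show "ipg (\<Sum>b\<in>B. q b *\<^sub>R b) (\<Sum>b\<in>B. q b *\<^sub>R b) = (\<Sum>b\<in>B. (q b)\<^sup>2)" .
  qed
  obtain \<beta> where \<beta>: "bounded_bilinear \<beta>" "\<And>x y. x \<in> \<gg> \<Longrightarrow> y \<in> \<gg> \<Longrightarrow> \<beta> x y = ip x y"
    using ip.bounded_bilinear_extension by blast
  define \<phi> where "\<phi> = (\<lambda>b x. 2 * \<beta> (bracket b x) x)"
  define F where "F = (\<lambda>x. (\<Sum>b\<in>B. (\<phi> b x)\<^sup>2) / (\<beta> x x)\<^sup>2)"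
  have map_eq: "moment_map G \<theta> ip ipg x = (\<Sum>b\<in>B. \<phi> b x *\<^sub>R b)" if x: "x \<in> \<gg>" for x
  proof (rule moment_map_eq[OF x])
    let ?M = "\<Sum>b\<in>B. \<phi> b x *\<^sub>R b"
    show M: "?M \<in> pp" unfolding B(2)[symmetric] by (intro span_sum span_scale span_base)
    have Mg: "?M \<in> \<gg>" using M pp_lie by blast
    fix X assume "X \<in> pp"
    have "span B \<subseteq> {X \<in> \<gg>. ipg ?M X = 2 * ip (bracket X x) x}"
    proof (rule span_minimal)
      show "B \<subseteq> {X \<in> \<gg>. ipg ?M X = 2 * ip (bracket X x) x}"
        using Bg x by (auto simp: ipg_sum1 \<phi>_def \<beta>(2) cl)
      show "subspace {X \<in> \<gg>. ipg ?M X = 2 * ip (bracket X x) x}"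
        using subspace_lie Mg x
        by (auto simp: subspace_def ipg.ip_add_right ipg.ip_scale_right ipg.ip_zero_right bracket_add_left
            bracket_scale_left ip.ip_add_left ip.ip_scale_left ip.ip_zero_left cl)
    qed
    then show "ipg ?M X = 2 * ip (bracket X x) x" using \<open>X \<in> pp\<close> B(2) by blast
  qed
  have norm_eq: "moment_norm_sq G \<theta> ip ipg x = F x" if x: "x \<in> \<gg>" for x
  proof -
    let ?M = "\<Sum>b\<in>B. \<phi> b x *\<^sub>R b"
    have Mg: "?M \<in> \<gg>" by (intro subspace_sum[OF subspace_lie] cl Bg)
    then show ?thesis
      using x by (simp add: moment_norm_sq_def Let_def map_eq ipg.ip_scale_left ipg.ip_scale_right cl ipg_sum
          F_def \<beta>(2) power2_eq_square divide_inverse)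
  qed
  define n where "n = ip v v"
  have n: "n > 0" using ip.ip_pos[OF v False] by (simp add: n_def)
  \<comment> \<open>The factor 2 is the one in the definition of the moment map, while h satisfies
    the equation without it.\<close>
  have mapv: "(\<Sum>b\<in>B. \<phi> b v *\<^sub>R b) = 2 *\<^sub>R h"
  proof -
    have "moment_map G \<theta> ip ipg v = 2 *\<^sub>R h"
      using h hg mom pp_lie by (intro moment_map_eq[OF v]) (auto simp: subspace_scale subspace_pp ipg.ip_scale_left subset_iff)
    then show ?thesis using map_eq[OF v] by simp
  qed
  define \<phi>' where "\<phi>' = (\<lambda>b w. 2 * (\<beta> (bracket b v) w + \<beta> (bracket b w) v))"
  have d\<phi>: "(\<phi> b has_derivative \<phi>' b) (at v)" for b
  proof -
    have "(bracket b has_derivative bracket b) (at v)"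
      using linear_bracket[of b] by (simp add: linear_conv_bounded_linear bounded_linear_imp_has_derivative)
    then show ?thesis
      unfolding \<phi>_def \<phi>'_def
      by (intro has_derivative_mult_right bounded_bilinear.FDERIV[OF \<beta>(1)] has_derivative_ident)
  qed
  define N' where "N' = (\<lambda>w. \<beta> v w + \<beta> w v)"
  have dN: "((\<lambda>x. \<beta> x x) has_derivative N') (at v)"
    unfolding N'_def by (intro bounded_bilinear.FDERIV[OF \<beta>(1)] has_derivative_ident)
  have \<beta>v: "\<beta> v v = n" using v by (simp add: \<beta>(2) n_def)
  define F' where "F' = (\<lambda>w. ((\<Sum>b\<in>B. 2 * \<phi>' b w * \<phi> b v) * n\<^sup>2 - (\<Sum>b\<in>B. (\<phi> b v)\<^sup>2) * (2 * N' w * n)) / (n\<^sup>2 * n\<^sup>2))"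
  have dF: "(F has_derivative F') (at v)"
  proof -
    have "((\<lambda>x. \<Sum>b\<in>B. (\<phi> b x)\<^sup>2) has_derivative (\<lambda>w. \<Sum>b\<in>B. 2 * \<phi>' b w * \<phi> b v)) (at v)"
      by (intro has_derivative_sum, rule has_derivative_eq_rhs[OF has_derivative_power[OF d\<phi>]]) (simp add: fun_eq_iff)
    moreover have "((\<lambda>x. (\<beta> x x)\<^sup>2) has_derivative (\<lambda>w. 2 * N' w * n)) (at v)"
      by (rule has_derivative_eq_rhs[OF has_derivative_power[OF dN]]) (simp add: fun_eq_iff \<beta>v)
    ultimately show ?thesis
      unfolding F_def F'_def
      by (rule has_derivative_eq_rhs[OF has_derivative_divide'])
        (use n in \<open>simp_all add: fun_eq_iff \<beta>v\<close>)
  qed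
  have F'0: "F' w = 0" if w: "w \<in> \<gg>" for w
  proof -
    have \<phi>'b: "\<phi>' b w = 4 * ip (bracket b v) w" if "b \<in> B" for b
    proof -
      have b: "b \<in> \<gg>" "star b = b" using Bp[OF that] by (auto simp: pp_def)
      have "ip (bracket b w) v = ip (bracket b v) w"
        using b v w by (simp add: ip_adjoint[of b w v] ip.ip_sym[of w] cl)
      then show ?thesis using b v w by (simp add: \<phi>'_def \<beta>(2) cl)
    qed
    have "(\<Sum>b\<in>B. 2 * \<phi>' b w * \<phi> b v) = 8 * (\<Sum>b\<in>B. ip (\<phi> b v *\<^sub>R bracket b v) w)"
      unfolding sum_distrib_left using \<phi>'b Bg v w
      by (intro sum.cong) (auto simp: ip.ip_scale_left cl)
    also have "(\<Sum>b\<in>B. ip (\<phi> b v *\<^sub>R bracket b v) w) = ip (\<Sum>b\<in>B. \<phi> b v *\<^sub>R bracket b v) w"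
      using fin Bg v w by (intro ip.ip_sum_left[symmetric]) (auto intro: cl)
    also have "(\<Sum>b\<in>B. \<phi> b v *\<^sub>R bracket b v) = bracket (\<Sum>b\<in>B. \<phi> b v *\<^sub>R b) v"
    proof -
      have "linear (\<lambda>y. bracket y v)" by (rule linearI) (simp_all add: bracket_add_left bracket_scale_left)
      from linear_sum[OF this, of "\<lambda>b. \<phi> b v *\<^sub>R b" B] show ?thesis
        by (simp add: bracket_scale_left)
    qed
    also have "\<dots> = 4 *\<^sub>R v" by (simp add: mapv bracket_scale_left hv)
    finally have 1: "(\<Sum>b\<in>B. 2 * \<phi>' b w * \<phi> b v) = 32 * ip v w"
      using v w by (simp add: ip.ip_scale_left)
    have "(\<Sum>b\<in>B. (\<phi> b v)\<^sup>2) = ipg (2 *\<^sub>R h) (2 *\<^sub>R h)" using ipg_sum[of "\<lambda>b. \<phi> b v"] by (simp add: mapv)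
    also have "\<dots> = 4 * ipg h h" using hg by (simp add: ipg.ip_scale_left ipg.ip_scale_right cl)
    also have "ipg h h = ip (bracket h v) v" by (rule mom[OF h])
    also have "\<dots> = 2 * n" using v by (simp add: hv ip.ip_scale_left n_def)
    finally have 2: "(\<Sum>b\<in>B. (\<phi> b v)\<^sup>2) = 8 * n" by simp
    have "N' w = 2 * ip v w" using v w by (simp add: N'_def \<beta>(2) ip.ip_sym)
    \<comment> \<open>The two terms of the numerator are 32 <v, w> n^2 and 8 n * 4 <v, w> n, and
      they cancel.\<close>
    then show ?thesis unfolding F'_def 1 2 by (simp add: power2_eq_square)
  qed
  \<comment> \<open>\<open>F\<close> matches the moment function on \<open>\<gg>\<close> only, and
    F' is known to vanish there only; after inserting \<open>proj\<close> the derivative is zero in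
    every direction.\<close>
  have "((\<lambda>x. F (proj x)) has_derivative (\<lambda>w. F' (proj w))) (at v within \<gg>)"
  proof -
    have 1: "(proj has_derivative proj) (at v within \<gg>)"
      using linear_proj by (simp add: linear_conv_bounded_linear bounded_linear_imp_has_derivative)
    have 2: "(F has_derivative F') (at (proj v))" using dF v by (simp add: proj_id)
    from has_derivative_compose[OF 1 2] show ?thesis .
  qed
  then have "((\<lambda>x. F (proj x)) has_derivative (\<lambda>_. 0)) (at v within \<gg>)"
    using F'0 proj_in_lie by simp
  then have "(moment_norm_sq G \<theta> ip ipg has_derivative (\<lambda>_. 0)) (at v within \<gg>)"
    using v by (rule has_derivative_transform[rotated 2]) (simp add: norm_eq proj_id)
  then show ?thesis using v by (simp add: distinguished_def)
qed

end

text \<open>On the stable range W of its powers, D has a right inverse S. If P D Q is smaller than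
  \<epsilon> with Q = P^(-1), then |D^m| \<le> C \<epsilon>^m, so w = D^m S^m w is at most C
  (\<epsilon> |S|)^m |w|. With \<epsilon> |S| \<le> 1/2 this tends to 0, and W = 0.\<close>

lemma small_conjugates_nilpotent:
  fixes D :: "'a::euclidean_space endo"
  assumes conj: "\<And>\<epsilon>. \<epsilon> > 0 \<Longrightarrow> \<exists>P Q. P * Q = 1 \<and> Q * P = 1 \<and> norm (P * D * Q) < \<epsilon>"
  shows "\<exists>r. D ^ r = 0"
proof -
  define d where "d = (\<lambda>r. dim (range (app (D ^ r))))"
  \<comment> \<open>A power whose range has least dimension; from there on the range no longer
    shrinks.\<close>
  obtain r where r: "\<And>s. d r \<le> d s" using ex_has_least_nat[of "\<lambda>_. True" undefined d] by auto
  define W where "W = range (app (D ^ r))"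
  have subW: "subspace W" unfolding W_def by (rule linear_subspace_image[OF linear_app subspace_UNIV])
  have im: "app D ` W = range (app (D ^ Suc r))" by (simp add: W_def image_image)
  have "app (D ^ Suc r) x \<in> W" for x
    unfolding W_def by (simp only: power_Suc2 app_mult rangeI)
  then have "app D ` W \<subseteq> W" unfolding im by blast
  moreover have "dim W \<le> dim (app D ` W)"
    unfolding im using r[of "Suc r"] by (simp only: W_def d_def)
  ultimately have DW: "app D ` W = W"
    by (intro subspace_dim_equal linear_subspace_image[OF linear_app] subW)
  obtain g where g: "range g \<subseteq> W" "linear g" "\<And>v. v \<in> W \<Longrightarrow> app D (g v) = v"
    using linear_exists_right_inverse_on[OF linear_app subW, of D] by (auto simp: DW)
  define S where "S = endo g"
  have S: "app S = g" using g(2) by (simp add: S_def app_endo)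
  have inv: "app (D ^ m) (app (S ^ m) w) = w \<and> app (S ^ m) w \<in> W" if "w \<in> W" for w m
  proof (induction m)
    case (Suc m)
    have "app (D ^ Suc m) (app (S ^ Suc m) w) = app (D ^ m) (app D (g (app (S ^ m) w)))"
      by (simp only: power_Suc2[of D m] power_Suc[of S m] app_mult S)
    also have "\<dots> = w" using Suc g(3) by simp
    finally show ?case using g(1) by (auto simp: S)
  qed (simp add: that)
  have "W \<subseteq> {0}"
  proof (rule ccontr)
    assume "\<not> W \<subseteq> {0}"
    then obtain w where w: "w \<in> W" "w \<noteq> 0" by blast
    \<comment> \<open>A single \<epsilon>, depending on S only, is enough: P and Q are then fixed,
      and C does not depend on m. The summand 1 covers S = 0.\<close>
    define \<epsilon> where "\<epsilon> = 1 / (2 * (norm S + 1))"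
    have \<epsilon>: "\<epsilon> > 0" by (simp add: \<epsilon>_def add_nonneg_pos)
    have \<epsilon>S: "\<epsilon> * norm S \<le> 1 / 2"
      using norm_ge_zero[of S] by (simp add: \<epsilon>_def divide_le_eq add_nonneg_pos)
    obtain P Q where PQ: "P * Q = 1" "Q * P = 1" "norm (P * D * Q) < \<epsilon>" using conj[OF \<epsilon>] by blast
    have pow: "D ^ m = Q * (P * D * Q) ^ m * P" for m
    proof (induction m)
      case (Suc m)
      have "Q * (P * D * Q) ^ Suc m * P = (Q * P) * D * (Q * (P * D * Q) ^ m * P)" by (simp add: mult.assoc)
      then show ?case using Suc PQ by simp
    qed (simp add: PQ)
    define C where "C = norm Q * norm P"
    have "norm w \<le> C * (1/2) ^ m * norm w" for m
    proof -
      have "norm w = norm (app (D ^ m) (app (S ^ m) w))" using inv[OF w(1)] by simp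
      also have "\<dots> \<le> norm (D ^ m) * (norm (S ^ m) * norm w)"
        by (meson norm_app_le order_trans mult_left_mono norm_ge_zero)
      also have "norm (D ^ m) \<le> norm Q * \<epsilon> ^ m * norm P"
      proof -
        have "norm (D ^ m) \<le> norm (Q * (P * D * Q) ^ m) * norm P" unfolding pow[of m] by (rule norm_mult_ineq)
        also have "\<dots> \<le> norm Q * norm ((P * D * Q) ^ m) * norm P" by (intro mult_right_mono norm_mult_ineq) auto
        also have "norm ((P * D * Q) ^ m) \<le> norm (P * D * Q) ^ m" by (rule norm_power_ineq)
        also have "\<dots> \<le> \<epsilon> ^ m" using PQ(3) by (intro power_mono) auto
        finally show ?thesis by (simp add: mult_left_mono mult_right_mono)
      qed
      also have "norm (S ^ m) \<le> norm S ^ m" by (rule norm_power_ineq)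
      finally have "norm w \<le> norm Q * \<epsilon> ^ m * norm P * (norm S ^ m * norm w)"
        using \<epsilon> by (simp add: mult_left_mono mult_right_mono)
      also have "\<dots> = C * (\<epsilon> * norm S) ^ m * norm w" by (simp add: C_def power_mult_distrib mult_ac)
      also have "\<dots> \<le> C * (1/2) ^ m * norm w"
        using \<epsilon> \<epsilon>S by (intro mult_right_mono mult_left_mono power_mono) (auto simp: C_def)
      finally show ?thesis .
    qed
    moreover have "(\<lambda>m. C * (1/2) ^ m * norm w) \<longlonglongrightarrow> C * 0 * norm w"
      by (intro tendsto_intros LIMSEQ_power_zero) auto
    ultimately have "norm w \<le> C * 0 * norm w"
      by (intro LIMSEQ_le_const) auto
    then show False using w by simp
  qed
  then have "app (D ^ r) x = 0" for x by (auto simp: W_def)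
  then have "D ^ r = 0" by (intro endo_eqI) simp
  then show ?thesis by blast
qed

context closed_matrix_group
begin

text \<open>Conjugating ad X by Ad A gives ad (Ad A X), which is small whenever Ad A X is.\<close>

lemma null_cone_nilpotent:
  assumes "X \<in> null_cone G"
  shows "\<exists>N. ad X ^ N = 0"
proof (rule small_conjugates_nilpotent)
  fix \<epsilon> :: real assume \<epsilon>: "\<epsilon> > 0"
  have lin: "linear (ad :: 'k^'n^'n \<Rightarrow> _)"
    by (rule linearI; rule endo_eqI) (simp_all add: bracket_add_left bracket_scale_left)
  then obtain K where K: "K > 0" "\<And>Z. norm (ad (Z :: 'k^'n^'n)) \<le> norm Z * K"
    using bounded_linear.pos_bounded by (auto simp: linear_conv_bounded_linear)
  have "0 \<in> closure (adjoint_orbit G X)" using assms by (simp add: null_cone_def)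
  then obtain Y where Y: "Y \<in> adjoint_orbit G X" "dist Y 0 < \<epsilon> / K"
    using \<epsilon> K(1) unfolding closure_approachable by (meson divide_pos_pos)
  then obtain A where A: "A \<in> G" "Y = Ad A X" by (auto simp: adjoint_orbit_def)
  note inv = G_invertible[OF A(1)] G_invertible[OF G_inv[OF A(1)]]
  let ?P = "endo (Ad A)" and ?Q = "endo (Ad (matrix_inv A))"
  have app: "app ?P = Ad A" "app ?Q = Ad (matrix_inv A)" by (simp_all add: app_endo linear_Ad)
  have AA: "Ad A (Ad (matrix_inv A) Z) = Z" "Ad (matrix_inv A) (Ad A Z) = Z" for Z
    using Ad_mult[OF inv(1,2), of Z] Ad_mult[OF inv(2,1), of Z] invertible_matrix_inv[OF inv(1)] by simp_all
  have "?P * ?Q = 1" "?Q * ?P = 1" by (rule endo_eqI, simp add: app AA)+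
  moreover have "?P * ad X * ?Q = ad Y"
    by (rule endo_eqI) (simp add: app A(2) Ad_bracket[OF inv(1)] AA)
  moreover have "norm (ad Y) < \<epsilon>"
  proof -
    have "norm (ad Y) \<le> norm Y * K" by (rule K)
    also have "\<dots> < \<epsilon>" using Y(2) K(1) by (simp add: field_simps)
    finally show ?thesis .
  qed
  ultimately show "\<exists>P Q. P * Q = 1 \<and> Q * P = 1 \<and> norm (P * ad X * Q) < \<epsilon>" by metis
qed

end

section \<open>From a point of the null cone to a distinguished point of its orbit\<close>

context cartan_group
begin

lemma triple_graded:
  assumes tr: "triple h e f" and nil: "ad e ^ N = 0"
  shows "graded h"
proof -
  have h: "h \<in> \<gg>" "bracket h e = 2 *\<^sub>R e" "bracket h f = - 2 *\<^sub>R f" "bracket e f = h"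
    using tr by (auto simp: triple_def)
  interpret sl2_rep "ad h" "ad e" "ad f" N
  proof
    show "ad h * ad e = ad e * ad h + 2 *\<^sub>R ad e"
      using ad_bracket[of h e] by (simp add: h ad_scaleR)
    show "ad h * ad f = ad f * ad h - 2 *\<^sub>R ad f"
      using ad_bracket[of h f] ad_scaleR[of "- 2" f] by (simp add: h algebra_simps)
    show "ad e * ad f = ad f * ad e + ad h"
      using ad_bracket[of e f] by (simp add: h)
  qed (rule nil)
  have "\<gg> = span {y \<in> \<gg>. \<exists>i::int. - 2 * int N \<le> i \<and> i \<le> int N \<and> app (ad h) y = of_int i *\<^sub>R y}"
    using subspace_lie h(1) by (intro H_diagonalizable) (simp_all add: lie_closed)
  also have "\<dots> \<subseteq> span (\<Union>i. gr h i)" by (intro span_mono) (auto simp: gr_def)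
  finally have "\<gg> \<subseteq> span (\<Union>i. gr h i)" .
  moreover have "span (\<Union>i. gr h i) \<subseteq> \<gg>"
    using subspace_lie by (intro span_minimal) (auto simp: gr_def)
  ultimately show ?thesis unfolding graded_def using h(1) by blast
qed

lemma triple_Ad: "A \<in> G \<Longrightarrow> triple h e f \<Longrightarrow> triple (Ad A h) (Ad A e) (Ad A f)"
  unfolding triple_def
  by (simp add: Ad_in_lie linear_cmul[OF linear_Ad] linear_neg[OF linear_Ad]
      flip: Ad_bracket[OF G_invertible])

end

context moment_setup
begin

theorem null_cone_orbit_distinguished:
  assumes X: "X \<in> null_cone G"
  shows "distinguished_orbit G \<theta> ip ipg (adjoint_orbit G X)"
proof -
  have Xg: "X \<in> \<gg>" using X by (simp add: null_cone_def)
  obtain N where nil: "ad X ^ N = 0" using null_cone_nilpotent[OF X] by blast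
  obtain h f where tr: "triple h X f" using jacobson_morozov[OF Xg nil] by blast
  obtain A where A: "A \<in> G" "star (Ad A h) = Ad A h"
    using conjugate_into_p[OF triple_graded[OF tr nil]] by blast
  let ?h = "Ad A h"
  have tr': "triple ?h (Ad A X) (Ad A f)" using triple_Ad[OF A(1) tr] .
  then have hg: "?h \<in> \<gg>" by (simp add: triple_def)
  \<comment> \<open>From here on h stays fixed: the two remaining conjugations move only the
    nilpotent element and keep it in the 2-eigenspace of ad h.\<close>
  obtain B where B: "B \<in> G" "bracket ?h (Ad B (Ad A X)) = 2 *\<^sub>R Ad B (Ad A X)"
    "bracket (Ad B (Ad A X)) (star (Ad B (Ad A X))) = ?h"
    using critical_in_orbit[OF tr' A(2)] by blast
  let ?e = "Ad B (Ad A X)"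
  have eg: "?e \<in> \<gg>" using A B Xg by (simp add: Ad_in_lie)
  obtain C where C: "C \<in> G" "bracket ?h (Ad C ?e) = 2 *\<^sub>R Ad C ?e"
    "\<And>X. X \<in> pp \<Longrightarrow> ipg ?h X = ip (bracket X (Ad C ?e)) (Ad C ?e)"
    using balanced_in_orbit[OF hg A(2) eg B(2,3)] by blast
  have "distinguished G \<theta> ip ipg (Ad C ?e)"
    using C(1) eg hg A(2) by (intro distinguishedI[OF _ _ C(2,3)]) (simp_all add: Ad_in_lie pp_def)
  moreover have "Ad C ?e = Ad (C ** B ** A) X"
    using A B C by (simp add: Ad_mult G_invertible G_mult)
  then have "Ad C ?e \<in> adjoint_orbit G X"
    using A B C by (auto simp: adjoint_orbit_def G_mult)
  ultimately show ?thesis by (auto simp: distinguished_orbit_def)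
qed

end

lemma null_cone_orbits_distinguished:
  fixes G :: "('k::rcfield^'n^'n) set"
  assumes alg: "linear_algebraic_group G" and cart: "cartan_involution G \<theta>"
    and ipV: "compatible_inner_product G \<theta> ipV" and ipg: "lie_inner_product G \<theta> ipg"
    and X: "X \<in> null_cone G"
  shows "distinguished_orbit G \<theta> ipV ipg (adjoint_orbit G X)"
proof -
  interpret closed_matrix_group G using alg by (rule algebraic_closed_matrix_group)
  interpret cartan_group G \<theta>
    using cart by unfold_locales (auto simp: cartan_involution_def)
  have ipVi: "inner_product_on \<gg> ipV" and ipVK: "Ad_invariant_on (fixed_group G \<theta>) \<gg> ipV"
    and ipVp: "\<And>P X Y. P \<in> p_part G \<theta> \<Longrightarrow> X \<in> \<gg> \<Longrightarrow> Y \<in> \<gg> \<Longrightarrow> ipV (bracket P X) Y = ipV X (bracket P Y)"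
    using ipV by (auto simp: compatible_inner_product_def)
  have ipgi: "inner_product_on \<gg> ipg" and ipgK: "Ad_invariant_on (fixed_group G \<theta>) \<gg> ipg"
    and ipgt: "\<And>X Y. X \<in> \<gg> \<Longrightarrow> Y \<in> \<gg> \<Longrightarrow> ipg (differential \<theta> X) (differential \<theta> Y) = ipg X Y"
    using ipg by (auto simp: lie_inner_product_def)
  interpret V: ip_space \<gg> ipV by unfold_locales (rule subspace_lie, rule ipVi)
  note cl = lie_closed star_in_lie
  interpret moment_setup G \<theta> ipV ipg
  proof
    \<comment> \<open>With X = a + b, star a = a and star b = -b, symmetry under a is part of
      compatibility, and skewness under b is the derivative of the invariance under the fixed
      group.\<close>
    show "ipV (bracket X Y) Z = ipV Y (bracket (star X) Z)" if g: "X \<in> \<gg>" "Y \<in> \<gg>" "Z \<in> \<gg>" for X Y Z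
    proof -
      obtain a b where a: "a \<in> \<gg>" "star a = a" and b: "b \<in> \<gg>" "star b = - b"
        and eq: "X = a + b" and seq: "star X = a - b"
        using star_decomposition[OF g(1)] by blast
      have "sig b = b" using b(2) by (simp add: star_def)
      then have 1: "ipV (bracket b Y) Z = - ipV Y (bracket b Z)"
        using Ad_fixed_skew[OF ipVi ipVK b(1)] g by blast
      have "differential \<theta> a = - a" using a by (simp add: star_def sig_eq[symmetric]) (metis minus_minus)
      then have 2: "ipV (bracket a Y) Z = ipV Y (bracket a Z)"
        using a g by (intro ipVp) (simp_all add: p_part_def)
      have "ipV (bracket X Y) Z = ipV (bracket a Y) Z + ipV (bracket b Y) Z"
        using V.ip_add_left[OF bracket_in_lie[OF a(1) g(2)] bracket_in_lie[OF b(1) g(2)] g(3)]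
        by (simp only: bracket_add_left[symmetric] eq[symmetric])
      also have "\<dots> = ipV Y (bracket a Z - bracket b Z)"
        using 1 2 V.ip_diff_right[OF bracket_in_lie[OF a(1) g(3)] bracket_in_lie[OF b(1) g(3)] g(2)] by simp
      also have "bracket a Z - bracket b Z = bracket (star X) Z"
        by (simp only: seq[symmetric] bracket_diff_left[symmetric])
      finally show ?thesis .
    qed
    show "ipg (bracket Z X) Y = - ipg X (bracket Z Y)"
      if "Z \<in> \<gg>" "sig Z = Z" "X \<in> \<gg>" "Y \<in> \<gg>" for X Y Z
      using Ad_fixed_skew[OF ipgi ipgK that] .
    show "ipg (sig X) (sig Y) = ipg X Y" if "X \<in> \<gg>" "Y \<in> \<gg>" for X Y
      using ipgt[OF that] that by (simp add: sig_eq)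
  qed (rule ipVi, rule ipgi)
  show ?thesis using X by (rule null_cone_orbit_distinguished)
qed

theorem theorem4p3:
  "(\<forall>(G :: (real^'n^'n) set) \<theta> ipV ipg.
      linear_algebraic_group G \<and> semisimple_group G \<and> cartan_involution G \<theta> \<and>
      compatible_inner_product G \<theta> ipV \<and> lie_inner_product G \<theta> ipg \<longrightarrow>
      (\<forall>X\<in>null_cone G. distinguished_orbit G \<theta> ipV ipg (adjoint_orbit G X)))
   \<and>
   (\<forall>(G :: (complex^'n^'n) set) \<theta> ipV ipg.
      linear_algebraic_group G \<and> semisimple_group G \<and> cartan_involution G \<theta> \<and>
      compatible_inner_product G \<theta> ipV \<and> lie_inner_product G \<theta> ipg \<longrightarrow>
      (\<forall>X\<in>null_cone G. distinguished_orbit G \<theta> ipV ipg (adjoint_orbit G X)))"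
  by (auto intro: null_cone_orbits_distinguished)

end
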